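(* Let $q$ be an odd prime, let $2 \le p \le \infty$ and let $\varepsilon > 0$. There exists a constant $C = C(p,q,\varepsilon)$ such that for all $\delta \in q^{-\mathbb{N}}$, $$D_{p}(\delta) \le C\, \delta^{-\varepsilon}\left(1 + \delta^{-(\frac12 - \frac3p)}\right),$$ where $D_p(\delta)$ is the $\ell^2L^p$ decoupling constant for the parabola over $\mathbb{Q}_q$ (and $3/p := 0$ when $p = \infty$).
   Context: $\mathbb{Q}_q$ carries the $q$-adic absolute value $|\cdot|$ with $|q| = 1/q$; $\mathbb{Z}_q = \{\xi : |\xi| \le 1\}$; $\mathbb{N} = \{0,1,2,\dots\}$ and $q^{-\mathbb{N}} = \{q^{-k} : k \in \mathbb{N}\}$. An interval of length $r$ ($r$ an integer power of $q$) is a set $I(a,r) = \{\xi \in \mathbb{Q}_q : |\xi - a| \le r\}$; its length is denoted $|I(a,r)| = r$. $P_\delta$ is the partition of $\mathbb{Z}_q$ into intervals of length $\delta$. For an interval $J \subset \mathbb{Z}_q$, $\theta_J := \{(\xi,\eta) \in \mathbb{Q}_q^2 : \xi \in J,\ |\eta - \xi^2| \le |J|^2\}$. $\chi$ is the additive character of $\mathbb{Q}_q$ given by $\chi(\sum_{j \ge k} a_j q^j) = e^{2\pi i \sum_{j=k}^{-1} a_j q^j}$ with $a_j \in \{0,\dots,q-1\}$ (trivial on $\mathbb{Z}_q$). Schwartz functions on $\mathbb{Q}_q^2$ are finite complex linear combinations of indicator functions of products of two intervals of equal length; $\hat f(\xi) = \int_{\mathbb{Q}_q^2} f(x)\chi(-x\cdot\xi)\,dx$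 with Haar measure normalized so that $\mathbb{Z}_q^2$ has measure $1$. For an interval $J \subset \mathbb{Z}_q$, $f_J$ is defined by $\widehat{f_J} = \hat f\, 1_{J \times \mathbb{Q}_q}$. For $\delta \in q^{-\mathbb{N}}$ and $2 \le p \le \infty$, $D_p(\delta)$ is the smallest constant such that $$\|f\|_{L^p(\mathbb{Q}_q^2)} \le D_p(\delta)\Big(\sum_{K \in P_\delta}\|f_K\|_{L^p(\mathbb{Q}_q^2)}^2\Big)^{1/2}$$ for all Schwartz $f$ with $\hat f$ supported in $\bigcup_{K \in P_\delta}\theta_K$. *)

theory Defs
  imports
    "HOL-Probability.Essential_Supremum"
    "HOL-Computational_Algebra.Primes"
begin

section \<open>The field of \<open>q\<close>-adic numbers\<close>

text \<open>
  The prime \<open>q\<close> is carried by a type: it is \<open>CARD('q)\<close> for a type \<open>'q\<close> of class \<open>prime_card\<close>.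
  The field \<open>'q padic\<close> is the completion of the rationals with respect to the \<open>q\<close>-adic absolute
  value, built as Cauchy sequences modulo null sequences.
\<close>

class prime_card =
  assumes prime_card: "prime CARD('a)"

subsection \<open>The \<open>q\<close>-adic absolute value on the rationals\<close>

lemma powi_le_powi_iff:
  fixes x :: real assumes "x > 1" shows "x powi m \<le> x powi n \<longleftrightarrow> m \<le> n"
  using power_int_strict_increasing[of n m x] power_int_increasing[of m n x] assms
  by (cases "m \<le> n") auto

lemma powi_le_1_iff: "(x :: real) > 1 \<Longrightarrow> x powi m \<le> 1 \<longleftrightarrow> m \<le> 0"
  using powi_le_powi_iff[of x m 0] by simp

definition qadic_abs :: "nat \<Rightarrow> rat \<Rightarrow> real" where
  "qadic_abs q x =
     (if x = 0 then 0
      else real q powi (int (multiplicity (int q) (snd (quotient_of x)))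
                          - int (multiplicity (int q) (fst (quotient_of x)))))"

lemma qadic_abs_0 [simp]: "qadic_abs q 0 = 0"
  by (simp add: qadic_abs_def)

lemma qadic_abs_frac:
  assumes q: "prime q" and "a \<noteq> 0" "b \<noteq> 0"
  shows "qadic_abs q (of_int a / of_int b)
           = real q powi (int (multiplicity (int q) b) - int (multiplicity (int q) a))"
proof -
  obtain c d where cd: "quotient_of (of_int a / of_int b) = (c, d)"
    by (cases "quotient_of (of_int a / of_int b)")
  have d: "d > 0" using quotient_of_denom_pos[OF cd] .
  have eq: "(of_int a / of_int b :: rat) = of_int c / of_int d"
    using quotient_of_div[OF cd] .
  have c: "c \<noteq> 0" using eq assms d by auto
  have "(of_int (a * d) :: rat) = of_int (c * b)"
    using eq assms d by (simp add: field_simps)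
  then have "a * d = c * b" by (simp only: of_int_eq_iff)
  then have "multiplicity (int q) (a * d) = multiplicity (int q) (c * b)" by simp
  then have "multiplicity (int q) a + multiplicity (int q) d
               = multiplicity (int q) c + multiplicity (int q) b"
    using assms c d by (simp add: prime_elem_multiplicity_mult_distrib)
  then have "int (multiplicity (int q) d) - int (multiplicity (int q) c)
               = int (multiplicity (int q) b) - int (multiplicity (int q) a)"
    by linarith
  then show ?thesis using assms by (simp add: qadic_abs_def cd)
qed

lemma qadic_abs_cases:
  fixes x :: rat
  obtains "x = 0" | a b where "x = of_int a / of_int b" "a \<noteq> 0" "b \<noteq> 0"
proof (cases "x = 0")
  case False
  obtain c d where cd: "quotient_of x = (c, d)" by (cases "quotient_of x")
  have "d > 0" using quotient_of_denom_pos[OF cd] .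
  moreover have "x = of_int c / of_int d" using quotient_of_div[OF cd] .
  ultimately show ?thesis using that False by auto
qed

lemma qadic_abs_nonneg [simp]: "0 \<le> qadic_abs q x"
  by (simp add: qadic_abs_def zero_le_power_int)

lemma qadic_abs_pos: "prime q \<Longrightarrow> x \<noteq> 0 \<Longrightarrow> 0 < qadic_abs q x"
  by (auto simp: qadic_abs_def intro!: zero_less_power_int dest: prime_gt_0_nat)

lemma qadic_abs_eq_0_iff: "prime q \<Longrightarrow> qadic_abs q x = 0 \<longleftrightarrow> x = 0"
  using qadic_abs_pos[of q x] by force

lemma qadic_abs_1: "prime q \<Longrightarrow> qadic_abs q 1 = 1"
  using qadic_abs_frac[of q 1 1] by simp

lemma qadic_abs_mult:
  assumes q: "prime q"
  shows "qadic_abs q (x * y) = qadic_abs q x * qadic_abs q y"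
proof (cases x rule: qadic_abs_cases)
  case (2 a b)
  show ?thesis
  proof (cases y rule: qadic_abs_cases)
    case (2 c d)
    have xy: "x * y = of_int (a * c) / of_int (b * d)"
      using \<open>x = _\<close> 2 by simp
    have q0: "real q \<noteq> 0" using q prime_gt_0_nat by auto
    have pq: "prime_elem (int q)" using q by auto
    show ?thesis
      unfolding xy unfolding \<open>x = _\<close> 2(1)
      using \<open>a \<noteq> 0\<close> \<open>b \<noteq> 0\<close> 2 pq
      by (simp only: qadic_abs_frac[OF q] mult_eq_0_iff simp_thms prime_elem_multiplicity_mult_distrib
            power_int_add[symmetric] q0 not_False_eq_True of_nat_add)
         (simp add: power_int_add[symmetric] q0 algebra_simps)
  qed simp
qed simp

lemma qadic_abs_minus: assumes q: "prime q" shows "qadic_abs q (- x) = qadic_abs q x"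
proof -
  have "qadic_abs q (- 1) * qadic_abs q (- 1) = 1"
    using qadic_abs_mult[OF q, of "- 1" "- 1"] qadic_abs_1[OF q] by simp
  then have "qadic_abs q (- 1) = 1"
    using qadic_abs_nonneg[of q "- 1"] by (auto simp: square_eq_1_iff simp del: qadic_abs_nonneg)
  then show ?thesis using qadic_abs_mult[OF q, of "- 1" x] by simp
qed

lemma qadic_abs_diff_commute: "prime q \<Longrightarrow> qadic_abs q (x - y) = qadic_abs q (y - x)"
  using qadic_abs_minus[of q "x - y"] by simp

lemma qadic_abs_inverse:
  assumes q: "prime q" shows "qadic_abs q (inverse x) = inverse (qadic_abs q x)"
proof (cases "x = 0")
  case False
  then have "qadic_abs q x * qadic_abs q (inverse x) = 1"
    using qadic_abs_mult[OF q, of x "inverse x"] qadic_abs_1[OF q] by simp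
  then show ?thesis by (metis inverse_unique)
qed simp

lemma qadic_abs_of_int:
  assumes "prime q" "a \<noteq> 0"
  shows "qadic_abs q (of_int a) = real q powi (- int (multiplicity (int q) a))"
  using qadic_abs_frac[OF assms(1), of a 1] assms by simp

lemma qadic_abs_of_int_le:
  assumes q: "prime q"
  shows "qadic_abs q (of_int a) \<le> real q powi (- int n) \<longleftrightarrow> int q ^ n dvd a"
proof (cases "a = 0")
  case False
  have q1: "real q > 1" using q prime_gt_1_nat by auto
  have "\<not> is_unit (int q)" using prime_gt_1_nat[OF q] by simp
  then have "int q ^ n dvd a \<longleftrightarrow> n \<le> multiplicity (int q) a"
    using False by (simp add: power_dvd_iff_le_multiplicity)
  moreover have "qadic_abs q (of_int a) \<le> real q powi (- int n) \<longleftrightarrow> n \<le> multiplicity (int q) a"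
    using q1 by (simp add: qadic_abs_of_int[OF q False] powi_le_powi_iff)
  ultimately show ?thesis by simp
qed (simp add: zero_le_power_int)

lemma qadic_abs_of_int_le_1: "prime q \<Longrightarrow> qadic_abs q (of_int a) \<le> 1"
  using qadic_abs_of_int_le[of q a 0] by simp

lemma qadic_abs_ultra:
  assumes q: "prime q"
  shows "qadic_abs q (x + y) \<le> max (qadic_abs q x) (qadic_abs q y)"
proof -
  have main: "qadic_abs q (1 + z) \<le> 1" if "qadic_abs q z \<le> 1" for z
  proof (cases z rule: qadic_abs_cases)
    case (2 a b)
    define k where "k = multiplicity (int q) b"
    have q1: "real q > 1" using q prime_gt_1_nat by auto
    have nu: "\<not> is_unit (int q)" using prime_gt_1_nat[OF q] by simp
    have "k \<le> multiplicity (int q) a"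
      using that 2 q q1 unfolding k_def
      by (simp add: qadic_abs_frac powi_le_1_iff)
    then have "int q ^ k dvd a" using 2 nu by (simp add: power_dvd_iff_le_multiplicity)
    moreover have "int q ^ k dvd b" unfolding k_def by (rule multiplicity_dvd)
    ultimately have d: "int q ^ k dvd a + b" by simp
    have z: "1 + z = of_int (a + b) / of_int b" using 2 by (simp add: field_simps)
    show ?thesis
    proof (cases "a + b = 0")
      case False
      then have "k \<le> multiplicity (int q) (a + b)"
        using d nu by (simp add: power_dvd_iff_le_multiplicity)
      then have "int (multiplicity (int q) b) - int (multiplicity (int q) (a + b)) \<le> 0"
        unfolding k_def by linarith
      then have "qadic_abs q (of_int (a + b) / of_int b) \<le> 1"
        unfolding qadic_abs_frac[OF q False \<open>b \<noteq> 0\<close>] powi_le_1_iff[OF q1] .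
      then show ?thesis by (simp only: z)
    next
      case True
      then have "1 + z = 0" unfolding z by (simp only: of_int_0 div_0)
      then show ?thesis by (simp only: qadic_abs_0)
    qed
  qed (simp add: qadic_abs_1[OF q])
  have gen: "qadic_abs q (x + y) \<le> qadic_abs q x" if "qadic_abs q y \<le> qadic_abs q x" for x y
  proof (cases "x = 0")
    case False
    have "qadic_abs q (y / x) = qadic_abs q y / qadic_abs q x"
      by (simp add: divide_inverse qadic_abs_mult[OF q] qadic_abs_inverse[OF q])
    then have "qadic_abs q (y / x) \<le> 1"
      using that qadic_abs_pos[OF q False] by simp
    then have "qadic_abs q (1 + y / x) \<le> 1" by (rule main)
    then have "qadic_abs q x * qadic_abs q (1 + y / x) \<le> qadic_abs q x"
      by (simp add: mult_left_le)
    moreover have "x * (1 + y / x) = x + y" using False by (simp add: field_simps)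
    ultimately show ?thesis by (simp flip: qadic_abs_mult[OF q])
  next
    case True
    then have "qadic_abs q y = 0" using that qadic_abs_nonneg[of q y] by simp
    then show ?thesis using True by simp
  qed
  show ?thesis using gen[of x y] gen[of y x] by (auto simp: add.commute max_def not_le)
qed

lemma qadic_abs_triangle: "prime q \<Longrightarrow> qadic_abs q (x + y) \<le> qadic_abs q x + qadic_abs q y"
  using qadic_abs_ultra[of q x y] qadic_abs_nonneg[of q x] qadic_abs_nonneg[of q y] by linarith

lemma qadic_abs_diff_ultra:
  "prime q \<Longrightarrow> qadic_abs q (x - y) \<le> max (qadic_abs q x) (qadic_abs q y)"
  using qadic_abs_ultra[of q x "- y"] by (simp add: qadic_abs_minus)

lemma qadic_abs_triangle_diff:
  "prime q \<Longrightarrow> \<bar>qadic_abs q x - qadic_abs q y\<bar> \<le> qadic_abs q (x - y)"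
  using qadic_abs_triangle[of q "x - y" y] qadic_abs_triangle[of q "y - x" x]
    qadic_abs_diff_commute[of q x y] by simp

subsection \<open>Cauchy sequences of rationals\<close>

definition qadic_Cauchy :: "nat \<Rightarrow> (nat \<Rightarrow> rat) \<Rightarrow> bool" where
  "qadic_Cauchy q X \<longleftrightarrow> (\<forall>e>0. \<exists>N. \<forall>m\<ge>N. \<forall>n\<ge>N. qadic_abs q (X m - X n) < e)"

lemma qadic_Cauchy_const: "qadic_Cauchy q (\<lambda>_. c)"
  by (simp add: qadic_Cauchy_def)

lemma qadic_Cauchy_minus: "prime q \<Longrightarrow> qadic_Cauchy q X \<Longrightarrow> qadic_Cauchy q (\<lambda>n. - X n)"
  using qadic_abs_diff_commute by (simp add: qadic_Cauchy_def)

lemma qadic_Cauchy_bounded: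
  assumes "qadic_Cauchy q X" "prime q"
  obtains B where "B > 0" "\<And>n. qadic_abs q (X n) \<le> B"
proof -
  obtain N where N: "\<And>m n. m \<ge> N \<Longrightarrow> n \<ge> N \<Longrightarrow> qadic_abs q (X m - X n) < 1"
    using assms(1) zero_less_one unfolding qadic_Cauchy_def by blast
  define B where "B = Max ((\<lambda>n. qadic_abs q (X n)) ` {..N}) + 1"
  have le: "qadic_abs q (X n) \<le> B - 1" if "n \<le> N" for n
    unfolding B_def using that by (simp add: Max_ge)
  have "qadic_abs q (X n) \<le> B" for n
  proof (cases "n \<le> N")
    case False
    then have "qadic_abs q (X n - X N) < 1" using N by simp
    then show ?thesis
      using qadic_abs_triangle[OF assms(2), of "X n - X N" "X N"] le[of N] by simp
  qed (use le in fastforce)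
  moreover have "B > 0" using le[of 0] qadic_abs_nonneg[of q "X 0"] by linarith
  ultimately show ?thesis using that by blast
qed

lemma qadic_Cauchy_add:
  assumes q: "prime q" and X: "qadic_Cauchy q X" and Y: "qadic_Cauchy q Y"
  shows "qadic_Cauchy q (\<lambda>n. X n + Y n)"
  unfolding qadic_Cauchy_def
proof (intro allI impI)
  fix e :: real assume e: "e > 0"
  obtain M where M: "\<forall>m\<ge>M. \<forall>n\<ge>M. qadic_abs q (X m - X n) < e"
    using X e unfolding qadic_Cauchy_def by blast
  obtain N where N: "\<forall>m\<ge>N. \<forall>n\<ge>N. qadic_abs q (Y m - Y n) < e"
    using Y e unfolding qadic_Cauchy_def by blast
  have "qadic_abs q (X m + Y m - (X n + Y n)) < e" if "m \<ge> max M N" "n \<ge> max M N" for m n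
  proof -
    have eq: "X m + Y m - (X n + Y n) = (X m - X n) + (Y m - Y n)" by simp
    have "max (qadic_abs q (X m - X n)) (qadic_abs q (Y m - Y n)) < e"
      using M N that by auto
    then show ?thesis
      unfolding eq by (rule order_le_less_trans[OF qadic_abs_ultra[OF q]])
  qed
  then show "\<exists>N. \<forall>m\<ge>N. \<forall>n\<ge>N. qadic_abs q (X m + Y m - (X n + Y n)) < e" by blast
qed

lemma qadic_Cauchy_mult:
  assumes q: "prime q" and X: "qadic_Cauchy q X" and Y: "qadic_Cauchy q Y"
  shows "qadic_Cauchy q (\<lambda>n. X n * Y n)"
  unfolding qadic_Cauchy_def
proof (intro allI impI)
  fix e :: real assume e: "e > 0"
  obtain A where A: "A > 0" "\<And>n. qadic_abs q (X n) \<le> A" using qadic_Cauchy_bounded[OF X q] by blast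
  obtain B where B: "B > 0" "\<And>n. qadic_abs q (Y n) \<le> B" using qadic_Cauchy_bounded[OF Y q] by blast
  have eA: "e / A > 0" and eB: "e / B > 0" using e A B by auto
  obtain M where M: "\<forall>m\<ge>M. \<forall>n\<ge>M. qadic_abs q (X m - X n) < e / B"
    using X eB unfolding qadic_Cauchy_def by blast
  obtain N where N: "\<forall>m\<ge>N. \<forall>n\<ge>N. qadic_abs q (Y m - Y n) < e / A"
    using Y eA unfolding qadic_Cauchy_def by blast
  have "qadic_abs q (X m * Y m - X n * Y n) < e" if mn: "m \<ge> max M N" "n \<ge> max M N" for m n
  proof -
    have "qadic_abs q ((X m - X n) * Y m) < e"
    proof -
      have "qadic_abs q (X m - X n) * qadic_abs q (Y m) \<le> qadic_abs q (X m - X n) * B"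
        by (rule mult_left_mono[OF B(2)]) simp
      also have "\<dots> < e" using M mn B(1) by (simp add: pos_less_divide_eq)
      finally show ?thesis by (simp add: qadic_abs_mult[OF q])
    qed
    moreover have "qadic_abs q (X n * (Y m - Y n)) < e"
    proof -
      have "qadic_abs q (X n) * qadic_abs q (Y m - Y n) \<le> A * qadic_abs q (Y m - Y n)"
        by (rule mult_right_mono[OF A(2)]) simp
      also have "\<dots> < e" using N mn A(1) by (simp add: pos_less_divide_eq mult.commute)
      finally show ?thesis by (simp add: qadic_abs_mult[OF q])
    qed
    moreover have "X m * Y m - X n * Y n = (X m - X n) * Y m + X n * (Y m - Y n)"
      by (simp add: algebra_simps)
    ultimately show ?thesis
      using qadic_abs_ultra[OF q, of "(X m - X n) * Y m" "X n * (Y m - Y n)"] by simp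
  qed
  then show "\<exists>N. \<forall>m\<ge>N. \<forall>n\<ge>N. qadic_abs q (X m * Y m - X n * Y n) < e" by blast
qed

typedef (overloaded) 'q qcauchy = "{X. qadic_Cauchy CARD('q::prime_card) X}"
  by (rule exI[of _ "\<lambda>_. 0"]) (simp add: qadic_Cauchy_const)

setup_lifting type_definition_qcauchy

instantiation qcauchy :: (prime_card) comm_ring_1
begin

lift_definition zero_qcauchy :: "'a qcauchy" is "\<lambda>_. 0" by (rule qadic_Cauchy_const)
lift_definition one_qcauchy :: "'a qcauchy" is "\<lambda>_. 1" by (rule qadic_Cauchy_const)
lift_definition uminus_qcauchy :: "'a qcauchy \<Rightarrow> 'a qcauchy" is "\<lambda>X n. - X n"
  by (rule qadic_Cauchy_minus[OF prime_card])
lift_definition plus_qcauchy :: "'a qcauchy \<Rightarrow> 'a qcauchy \<Rightarrow> 'a qcauchy" is "\<lambda>X Y n. X n + Y n"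
  by (rule qadic_Cauchy_add[OF prime_card])
lift_definition times_qcauchy :: "'a qcauchy \<Rightarrow> 'a qcauchy \<Rightarrow> 'a qcauchy" is "\<lambda>X Y n. X n * Y n"
  by (rule qadic_Cauchy_mult[OF prime_card])

definition minus_qcauchy :: "'a qcauchy \<Rightarrow> 'a qcauchy \<Rightarrow> 'a qcauchy" where
  "minus_qcauchy X Y = X + (- Y)"

instance
proof
  fix a b c :: "'a qcauchy"
  note eqs = plus_qcauchy.rep_eq times_qcauchy.rep_eq zero_qcauchy.rep_eq one_qcauchy.rep_eq
    uminus_qcauchy.rep_eq
  have eqI: "x = y" if "\<And>n. Rep_qcauchy x n = Rep_qcauchy y n" for x y :: "'a qcauchy"
    using that by (intro Rep_qcauchy_inject[THEN iffD1] ext)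
  show "a - b = a + - b" by (rule minus_qcauchy_def)
  show "a * b * c = a * (b * c)" by (rule eqI) (simp only: eqs mult.assoc)
  show "a * b = b * a" by (rule eqI) (simp only: eqs mult.commute)
  show "1 * a = a" by (rule eqI) (simp only: eqs mult_1_left)
  show "(a + b) * c = a * c + b * c" by (rule eqI) (simp only: eqs distrib_right)
  show "a + b + c = a + (b + c)" by (rule eqI) (simp only: eqs add.assoc)
  show "a + b = b + a" by (rule eqI) (simp only: eqs add.commute)
  show "0 + a = a" by (rule eqI) (simp only: eqs add_0_left)
  show "- a + a = 0" by (rule eqI) (simp only: eqs left_minus)
  show "(0::'a qcauchy) \<noteq> 1"
  proof
    assume "(0::'a qcauchy) = 1"
    then have "Rep_qcauchy (0::'a qcauchy) 0 = Rep_qcauchy (1::'a qcauchy) 0" by (simp only:)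
    then show False by (simp add: eqs)
  qed
qed

end

lemma Rep_qcauchy_minus: "Rep_qcauchy (X - Y) n = Rep_qcauchy X n - Rep_qcauchy Y n"
  unfolding minus_qcauchy_def plus_qcauchy.rep_eq uminus_qcauchy.rep_eq by simp

definition qc_abs :: "'q::prime_card qcauchy \<Rightarrow> real" where
  "qc_abs X = lim (\<lambda>n. qadic_abs CARD('q) (Rep_qcauchy X n))"

lemma qc_abs_LIMSEQ: "(\<lambda>n. qadic_abs CARD('q) (Rep_qcauchy (X :: 'q::prime_card qcauchy) n)) \<longlonglongrightarrow> qc_abs X"
proof -
  have "Cauchy (\<lambda>n. qadic_abs CARD('q) (Rep_qcauchy X n))"
    unfolding Cauchy_def dist_real_def
  proof (intro allI impI)
    fix e :: real assume "e > 0"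
    then obtain N where "\<forall>m\<ge>N. \<forall>n\<ge>N. qadic_abs CARD('q) (Rep_qcauchy X m - Rep_qcauchy X n) < e"
      using Rep_qcauchy[of X] unfolding qadic_Cauchy_def by blast
    then show "\<exists>N. \<forall>m\<ge>N. \<forall>n\<ge>N. \<bar>qadic_abs CARD('q) (Rep_qcauchy X m) - qadic_abs CARD('q) (Rep_qcauchy X n)\<bar> < e"
      using qadic_abs_triangle_diff[OF prime_card[where 'a='q]] by (meson order_le_less_trans)
  qed
  then show ?thesis unfolding qc_abs_def by (simp add: Cauchy_convergent_iff convergent_LIMSEQ_iff)
qed

lemma qc_abs_eqI: "(\<lambda>n. qadic_abs CARD('q) (Rep_qcauchy (X :: 'q::prime_card qcauchy) n)) \<longlonglongrightarrow> c \<Longrightarrow> qc_abs X = c"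
  using qc_abs_LIMSEQ LIMSEQ_unique by blast

lemma qc_abs_nonneg [simp]: "0 \<le> qc_abs X"
  by (rule LIMSEQ_le_const[OF qc_abs_LIMSEQ]) auto

lemma qc_abs_0 [simp]: "qc_abs 0 = 0"
  by (rule qc_abs_eqI) (simp add: zero_qcauchy.rep_eq)

lemma qc_abs_1 [simp]: "qc_abs (1 :: 'q::prime_card qcauchy) = 1"
  by (rule qc_abs_eqI) (simp add: one_qcauchy.rep_eq qadic_abs_1[OF prime_card[where 'a='q]])

lemma qc_abs_mult: "qc_abs (X * Y) = qc_abs X * qc_abs (Y :: 'q::prime_card qcauchy)"
  by (rule qc_abs_eqI)
     (simp add: times_qcauchy.rep_eq qadic_abs_mult[OF prime_card[where 'a='q]] tendsto_mult qc_abs_LIMSEQ)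

lemma qc_abs_minus: "qc_abs (- X) = qc_abs (X :: 'q::prime_card qcauchy)"
  by (rule qc_abs_eqI)
     (simp add: uminus_qcauchy.rep_eq qadic_abs_minus[OF prime_card[where 'a='q]] qc_abs_LIMSEQ)

lemma qc_abs_ultra: "qc_abs (X + Y) \<le> max (qc_abs X) (qc_abs (Y :: 'q::prime_card qcauchy))"
  by (rule LIMSEQ_le[OF qc_abs_LIMSEQ tendsto_max[OF qc_abs_LIMSEQ qc_abs_LIMSEQ]])
     (auto simp: plus_qcauchy.rep_eq qadic_abs_ultra[OF prime_card[where 'a='q]])

definition qc_rel :: "'q::prime_card qcauchy \<Rightarrow> 'q qcauchy \<Rightarrow> bool" where
  "qc_rel X Y \<longleftrightarrow> (\<lambda>n. qadic_abs CARD('q) (Rep_qcauchy X n - Rep_qcauchy Y n)) \<longlonglongrightarrow> 0"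

lemma qc_rel_iff: "qc_rel X Y \<longleftrightarrow> qc_abs (X - Y) = 0"
proof
  show "qc_rel X Y \<Longrightarrow> qc_abs (X - Y) = 0"
    unfolding qc_rel_def by (rule qc_abs_eqI) (simp add: Rep_qcauchy_minus)
  show "qc_abs (X - Y) = 0 \<Longrightarrow> qc_rel X Y"
    unfolding qc_rel_def using qc_abs_LIMSEQ[of "X - Y"] by (simp add: Rep_qcauchy_minus)
qed

lemma qc_abs_zero_add:
  assumes "qc_abs X = 0" "qc_abs Y = 0" shows "qc_abs (X + Y) = 0"
  using qc_abs_ultra[of X Y] qc_abs_nonneg[of "X + Y"] assms by simp

lemma qc_rel_abs: assumes "qc_rel X Y" shows "qc_abs X = qc_abs Y"
proof -
  have le: "qc_abs X \<le> qc_abs Y" if "qc_abs (X - Y) = 0" for X Y :: "'a qcauchy"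
    using qc_abs_ultra[of "X - Y" Y] that qc_abs_nonneg[of Y] by simp
  have "qc_abs (Y - X) = 0"
    using assms qc_abs_minus[of "X - Y"] by (simp add: qc_rel_iff)
  then show ?thesis using le[of X Y] le[of Y X] assms by (simp add: qc_rel_iff)
qed

subsection \<open>The completion\<close>

lemma equivp_qc_rel: "equivp (qc_rel :: 'q::prime_card qcauchy \<Rightarrow> _)"
proof (rule equivpI)
  show "reflp (qc_rel :: 'q qcauchy \<Rightarrow> _)" by (rule reflpI) (simp add: qc_rel_iff)
  show "symp (qc_rel :: 'q qcauchy \<Rightarrow> _)"
  proof (rule sympI)
    fix X Y :: "'q qcauchy" assume "qc_rel X Y"
    then show "qc_rel Y X" using qc_abs_minus[of "X - Y"] by (simp add: qc_rel_iff)
  qed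
  show "transp (qc_rel :: 'q qcauchy \<Rightarrow> _)"
  proof (rule transpI)
    fix X Y Z :: "'q qcauchy" assume "qc_rel X Y" "qc_rel Y Z"
    then show "qc_rel X Z" using qc_abs_zero_add[of "X - Y" "Y - Z"] by (simp add: qc_rel_iff)
  qed
qed

quotient_type (overloaded) 'q padic = "'q::prime_card qcauchy" / qc_rel
  by (rule equivp_qc_rel)

lemma qc_inverse_Cauchy:
  fixes X :: "'q::prime_card qcauchy"
  assumes nz: "qc_abs X \<noteq> 0"
  shows "qadic_Cauchy CARD('q) (\<lambda>n. inverse (Rep_qcauchy X n))"
  unfolding qadic_Cauchy_def
proof (intro allI impI)
  fix e :: real assume e: "e > 0"
  let ?X = "Rep_qcauchy X" and ?a = "qadic_abs CARD('q)"
  note q = prime_card[where 'a='q]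
  define c where "c = qc_abs X / 2"
  have c: "0 < c" "c < qc_abs X" using nz qc_abs_nonneg[of X] unfolding c_def by linarith+
  obtain M where M: "\<And>n. n \<ge> M \<Longrightarrow> c < ?a (?X n)"
    using order_tendstoD(1)[OF qc_abs_LIMSEQ c(2)] unfolding eventually_sequentially by blast
  have "e * c * c > 0" using e c by simp
  then obtain N where N: "\<forall>m\<ge>N. \<forall>n\<ge>N. ?a (?X m - ?X n) < e * c * c"
    using Rep_qcauchy[of X] unfolding qadic_Cauchy_def by blast
  have "?a (inverse (?X m) - inverse (?X n)) < e" if mn: "m \<ge> max M N" "n \<ge> max M N" for m n
  proof -
    have m: "c < ?a (?X m)" and n: "c < ?a (?X n)" using M mn by auto
    have nz: "?X m \<noteq> 0" "?X n \<noteq> 0" using m n c by auto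
    have "inverse (?X m) - inverse (?X n) = (?X n - ?X m) * (inverse (?X m) * inverse (?X n))"
      using nz by (simp add: field_simps)
    then have eq: "?a (inverse (?X m) - inverse (?X n)) = ?a (?X n - ?X m) / (?a (?X m) * ?a (?X n))"
      by (simp add: qadic_abs_mult[OF q] qadic_abs_inverse[OF q] divide_inverse)
    have "c * c \<le> ?a (?X m) * ?a (?X n)" using m n c by (intro mult_mono) auto
    then have "e * (c * c) \<le> e * (?a (?X m) * ?a (?X n))" using e by (intro mult_left_mono) auto
    moreover have "?a (?X n - ?X m) < e * (c * c)" using N mn by (simp add: mult.assoc)
    moreover have "0 < ?a (?X m) * ?a (?X n)" using m n c by simp
    ultimately show ?thesis unfolding eq by (simp add: pos_divide_less_eq)
  qed
  then show "\<exists>N. \<forall>m\<ge>N. \<forall>n\<ge>N. ?a (inverse (?X m) - inverse (?X n)) < e" by blast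
qed

lift_definition qc_inverse :: "'q::prime_card qcauchy \<Rightarrow> 'q qcauchy" is
  "\<lambda>X n. if (\<lambda>n. qadic_abs CARD('q) (X n)) \<longlonglongrightarrow> 0 then 0 else inverse (X n)"
proof -
  fix X :: "nat \<Rightarrow> rat" assume X: "qadic_Cauchy CARD('q) X"
  show "qadic_Cauchy CARD('q)
     (\<lambda>n. if (\<lambda>n. qadic_abs CARD('q) (X n)) \<longlonglongrightarrow> 0 then 0 else inverse (X n))"
  proof (cases "(\<lambda>n. qadic_abs CARD('q) (X n)) \<longlonglongrightarrow> 0")
    case False
    have "qc_abs (Abs_qcauchy X :: 'q qcauchy) \<noteq> 0"
      using qc_abs_LIMSEQ[of "Abs_qcauchy X :: 'q qcauchy"] False X by (auto simp: Abs_qcauchy_inverse)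
    from qc_inverse_Cauchy[OF this] show ?thesis using False X by (simp add: Abs_qcauchy_inverse)
  qed (simp add: qadic_Cauchy_const)
qed

lemma qc_inverse_0: "qc_abs X = 0 \<Longrightarrow> qc_inverse X = 0"
  using qc_abs_LIMSEQ[of X] by (intro Rep_qcauchy_inject[THEN iffD1]) (simp add: qc_inverse.rep_eq zero_qcauchy.rep_eq)

lemma qc_inverse_mult:
  fixes X :: "'q::prime_card qcauchy"
  assumes nz: "qc_abs X \<noteq> 0" shows "qc_rel (qc_inverse X * X) 1"
proof -
  have "0 < qc_abs X" using nz qc_abs_nonneg[of X] by linarith
  from order_tendstoD(1)[OF qc_abs_LIMSEQ this]
  have "eventually (\<lambda>n. Rep_qcauchy X n \<noteq> 0) sequentially"
    by (rule eventually_mono) auto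
  moreover have "\<not> (\<lambda>n. qadic_abs CARD('q) (Rep_qcauchy X n)) \<longlonglongrightarrow> 0"
    using nz qc_abs_LIMSEQ[of X] LIMSEQ_unique by blast
  ultimately have "eventually (\<lambda>n. qadic_abs CARD('q)
      (Rep_qcauchy (qc_inverse X * X) n - Rep_qcauchy 1 n) = 0) sequentially"
    by (auto elim!: eventually_mono simp: times_qcauchy.rep_eq qc_inverse.rep_eq one_qcauchy.rep_eq)
  then show ?thesis unfolding qc_rel_def by (rule tendsto_eventually)
qed

instantiation padic :: (prime_card) field
begin

lift_definition zero_padic :: "'a padic" is 0 .
lift_definition one_padic :: "'a padic" is 1 .
lift_definition uminus_padic :: "'a padic \<Rightarrow> 'a padic" is uminus
proof -
  fix X Y :: "'a qcauchy" assume "qc_rel X Y"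
  then have "qc_abs (- (X - Y)) = 0" by (simp only: qc_rel_iff qc_abs_minus)
  moreover have "- (X - Y) = - X - - Y" by simp
  ultimately show "qc_rel (- X) (- Y)" by (simp only: qc_rel_iff)
qed
lift_definition plus_padic :: "'a padic \<Rightarrow> 'a padic \<Rightarrow> 'a padic" is "(+)"
proof -
  fix X X' Y Y' :: "'a qcauchy" assume "qc_rel X X'" "qc_rel Y Y'"
  then have "qc_abs ((X - X') + (Y - Y')) = 0"
    unfolding qc_rel_iff by (rule qc_abs_zero_add)
  moreover have "(X - X') + (Y - Y') = X + Y - (X' + Y')" by (simp add: algebra_simps)
  ultimately show "qc_rel (X + Y) (X' + Y')" by (simp only: qc_rel_iff)
qed
lift_definition minus_padic :: "'a padic \<Rightarrow> 'a padic \<Rightarrow> 'a padic" is "(-)"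
proof -
  fix X X' Y Y' :: "'a qcauchy" assume "qc_rel X X'" "qc_rel Y Y'"
  then have "qc_abs ((X - X') + - (Y - Y')) = 0"
    unfolding qc_rel_iff by (intro qc_abs_zero_add) (simp_all only: qc_abs_minus)
  moreover have "(X - X') + - (Y - Y') = X - Y - (X' - Y')" by (simp add: algebra_simps)
  ultimately show "qc_rel (X - Y) (X' - Y')" by (simp only: qc_rel_iff)
qed
lift_definition times_padic :: "'a padic \<Rightarrow> 'a padic \<Rightarrow> 'a padic" is "(*)"
proof -
  fix X X' Y Y' :: "'a qcauchy" assume "qc_rel X X'" "qc_rel Y Y'"
  then have "qc_abs ((X - X') * Y + X' * (Y - Y')) = 0"
    unfolding qc_rel_iff by (intro qc_abs_zero_add) (simp_all only: qc_abs_mult mult_zero_left mult_zero_right)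
  moreover have "(X - X') * Y + X' * (Y - Y') = X * Y - X' * Y'" by (simp add: algebra_simps)
  ultimately show "qc_rel (X * Y) (X' * Y')" by (simp only: qc_rel_iff)
qed
lift_definition inverse_padic :: "'a padic \<Rightarrow> 'a padic" is qc_inverse
proof -
  fix X Y :: "'a qcauchy" assume XY: "qc_rel X Y"
  note XY' = qc_rel_abs[OF XY]
  show "qc_rel (qc_inverse X) (qc_inverse Y)"
  proof (cases "qc_abs X = 0")
    case True
    then show ?thesis using XY' by (simp add: qc_inverse_0 qc_rel_iff)
  next
    case False
    have X: "qc_abs (qc_inverse X * X - 1) = 0" and Y: "qc_abs (qc_inverse Y * Y - 1) = 0"
      using qc_inverse_mult[of X] qc_inverse_mult[of Y] False XY' by (simp_all add: qc_rel_iff)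
    let ?A = "qc_inverse X" and ?B = "qc_inverse Y"
    have "qc_abs (- (?A * (?B * Y - 1)) + (?B * (?A * X - 1) + ?A * ?B * (- (X - Y)))) = 0"
      using X Y XY by (intro qc_abs_zero_add) (simp_all only: qc_abs_mult qc_abs_minus qc_rel_iff mult_zero_right)
    also have "- (?A * (?B * Y - 1)) + (?B * (?A * X - 1) + ?A * ?B * (- (X - Y))) = ?A - ?B"
      by (simp add: algebra_simps)
    finally show ?thesis by (simp add: qc_rel_iff)
  qed
qed

definition divide_padic :: "'a padic \<Rightarrow> 'a padic \<Rightarrow> 'a padic" where
  "divide_padic x y = x * inverse y"

instance
proof
  fix a b c :: "'a padic"
  have eqI: "X = Y \<Longrightarrow> qc_rel X Y" for X Y :: "'a qcauchy" by (simp add: qc_rel_iff)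
  show "a * b * c = a * (b * c)" "a * b = b * a" "1 * a = a" "(a + b) * c = a * c + b * c"
    "a + b + c = a + (b + c)" "a + b = b + a" "0 + a = a" "- a + a = 0" "a - b = a + - b"
    by (transfer; rule eqI; simp add: algebra_simps)+
  show "(0::'a padic) \<noteq> 1"
    by transfer (use qc_abs_minus[of "1 :: 'a qcauchy"] in \<open>simp add: qc_rel_iff\<close>)
  show "a \<noteq> 0 \<Longrightarrow> inverse a * a = 1"
    by transfer (rule qc_inverse_mult, simp add: qc_rel_iff)
  show "inverse (0::'a padic) = 0"
    by transfer (simp add: qc_inverse_0 qc_rel_iff)
  show "a div b = a * inverse b" by (rule divide_padic_def)
qed

end

lift_definition padic_abs :: "'q::prime_card padic \<Rightarrow> real" is qc_abs
  by (rule qc_rel_abs)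

instantiation padic :: (prime_card) metric_space
begin

definition dist_padic :: "'a padic \<Rightarrow> 'a padic \<Rightarrow> real" where
  "dist_padic x y = padic_abs (x - y)"

definition uniformity_padic :: "('a padic \<times> 'a padic) filter" where
  "uniformity_padic = (INF e\<in>{0 <..}. principal {(x, y). dist x y < e})"

definition open_padic :: "'a padic set \<Rightarrow> bool" where
  "open_padic U = (\<forall>x\<in>U. eventually (\<lambda>(x', y). x' = x \<longrightarrow> y \<in> U) uniformity)"

instance
proof
  fix x y z :: "'a padic" and U :: "'a padic set"
  show "dist x y = 0 \<longleftrightarrow> x = y"
    unfolding dist_padic_def by transfer (simp add: qc_rel_iff)
  have ultra: "padic_abs (x + y) \<le> max (padic_abs x) (padic_abs y)" for x y :: "'a padic"
    by transfer (rule qc_abs_ultra)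
  have nonneg: "0 \<le> padic_abs x" for x :: "'a padic" by transfer simp
  have "padic_abs (- x) = padic_abs x" for x :: "'a padic" by transfer (rule qc_abs_minus)
  from this[of "y - z"] have "padic_abs (z - y) = padic_abs (y - z)" by simp
  then show "dist x y \<le> dist x z + dist y z"
    unfolding dist_padic_def using ultra[of "x - z" "z - y"] nonneg[of "x - z"] nonneg[of "y - z"]
    by simp
qed (rule uniformity_padic_def open_padic_def)+

end

subsection \<open>The absolute value and the embedding of the rationals\<close>

lemma padic_abs_ultra: "padic_abs (x + y) \<le> max (padic_abs x) (padic_abs (y :: 'q::prime_card padic))"
  by transfer (rule qc_abs_ultra)

lemma padic_abs_mult: "padic_abs (x * y) = padic_abs x * padic_abs (y :: 'q::prime_card padic)"
  by transfer (rule qc_abs_mult)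

lemma padic_abs_minus [simp]: "padic_abs (- x) = padic_abs (x :: 'q::prime_card padic)"
  by transfer (rule qc_abs_minus)

lemma padic_abs_nonneg [simp]: "0 \<le> padic_abs (x :: 'q::prime_card padic)"
  by transfer simp

lemma padic_abs_0 [simp]: "padic_abs (0 :: 'q::prime_card padic) = 0"
  by transfer simp

lemma padic_abs_1 [simp]: "padic_abs (1 :: 'q::prime_card padic) = 1"
  by transfer simp

lemma padic_abs_eq_0 [simp]: "padic_abs x = 0 \<longleftrightarrow> x = (0 :: 'q::prime_card padic)"
  by transfer (simp add: qc_rel_iff)

lemma padic_abs_minus_commute: "padic_abs (x - y) = padic_abs (y - x :: 'q::prime_card padic)"
  using padic_abs_minus[of "x - y"] by simp

lemma padic_abs_power: "padic_abs (x ^ n) = padic_abs (x :: 'q::prime_card padic) ^ n"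
  by (induction n) (simp_all add: padic_abs_mult)

lemma padic_abs_inverse: "padic_abs (inverse x) = inverse (padic_abs (x :: 'q::prime_card padic))"
proof (cases "x = 0")
  case False
  then have "padic_abs x * padic_abs (inverse x) = 1" by (simp flip: padic_abs_mult)
  then show ?thesis by (metis inverse_unique)
qed simp

lemma padic_abs_powi: "padic_abs (x powi n) = padic_abs (x :: 'q::prime_card padic) powi n"
  by (cases n rule: int_cases4) (simp_all add: power_int_minus padic_abs_inverse padic_abs_power)

lemma padic_diff_le:
  fixes x y z :: "'q::prime_card padic"
  assumes "padic_abs (x - y) \<le> r" "padic_abs (y - z) \<le> r" shows "padic_abs (x - z) \<le> r"
  using padic_abs_ultra[of "x - y" "y - z"] assms by simp

definition qc_const :: "rat \<Rightarrow> 'q::prime_card qcauchy" where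
  "qc_const r = Abs_qcauchy (\<lambda>_. r)"

lemma Rep_qc_const: "Rep_qcauchy (qc_const r :: 'q::prime_card qcauchy) n = r"
  unfolding qc_const_def by (subst Abs_qcauchy_inverse) (simp_all add: qadic_Cauchy_const)

definition padic_const :: "rat \<Rightarrow> 'q::prime_card padic" where
  "padic_const r = abs_padic (qc_const r)"

lemma padic_const_hom:
  "padic_const 0 = (0 :: 'q::prime_card padic)" "padic_const 1 = (1 :: 'q padic)"
  "padic_const (a + b) = (padic_const a + padic_const b :: 'q padic)"
  "padic_const (- a) = (- padic_const a :: 'q padic)"
  "padic_const (a * b) = (padic_const a * padic_const b :: 'q padic)"
proof -
  have I: "abs_padic X = abs_padic Y"
    if "\<And>n. Rep_qcauchy X n = Rep_qcauchy Y n" for X Y :: "'q qcauchy"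
  proof -
    have "Rep_qcauchy X = Rep_qcauchy Y" using that by (rule ext)
    then have "X = Y" by (simp only: Rep_qcauchy_inject)
    then show ?thesis by (simp only:)
  qed
  show "padic_const 0 = (0 :: 'q padic)" "padic_const 1 = (1 :: 'q padic)"
    "padic_const (a + b) = (padic_const a + padic_const b :: 'q padic)"
    "padic_const (- a) = (- padic_const a :: 'q padic)"
    "padic_const (a * b) = (padic_const a * padic_const b :: 'q padic)"
    unfolding padic_const_def zero_padic.abs_eq one_padic.abs_eq plus_padic.abs_eq
      uminus_padic.abs_eq times_padic.abs_eq
    by (rule I, simp add: Rep_qc_const zero_qcauchy.rep_eq one_qcauchy.rep_eq plus_qcauchy.rep_eq
        uminus_qcauchy.rep_eq times_qcauchy.rep_eq)+
qed

lemma padic_abs_const: "padic_abs (padic_const r :: 'q::prime_card padic) = qadic_abs CARD('q) r"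
proof -
  have "qc_abs (qc_const r :: 'q qcauchy) = qadic_abs CARD('q) r"
    by (rule qc_abs_eqI) (simp add: Rep_qc_const)
  then show ?thesis by (simp add: padic_const_def padic_abs.abs_eq)
qed

lemma padic_const_of_nat: "padic_const (of_nat n) = (of_nat n :: 'q::prime_card padic)"
  by (induction n) (simp_all add: padic_const_hom)

lemma padic_const_of_int: "padic_const (of_int n) = (of_int n :: 'q::prime_card padic)"
proof (cases n rule: int_cases2)
  case (nonneg m)
  then show ?thesis by (simp add: padic_const_of_nat)
next
  case (nonpos m)
  then show ?thesis using padic_const_of_nat[of m, where 'q='q] padic_const_hom(4)[of "of_nat m", where 'q='q] by simp
qed

instance padic :: (prime_card) field_char_0
proof
  show "inj (of_nat :: nat \<Rightarrow> 'a padic)"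
  proof (rule injI)
    fix m n :: nat assume "of_nat m = (of_nat n :: 'a padic)"
    then have "padic_const (of_nat m + - of_nat n) = (0 :: 'a padic)"
      by (simp only: padic_const_hom padic_const_of_nat) simp
    then have "qadic_abs CARD('a) (of_nat m + - of_nat n) = 0"
      by (metis padic_abs_const padic_abs_0)
    then have "(of_nat m :: rat) + - of_nat n = 0"
      by (simp only: qadic_abs_eq_0_iff[OF prime_card[where 'a='a]])
    then show "m = n" by simp
  qed
qed

lemma padic_const_of_rat: "padic_const r = (of_rat r :: 'q::prime_card padic)"
proof (cases r)
  case (Fract a b)
  then have r: "r = of_int a / of_int b" and b: "b > 0" by (simp_all add: Fract_of_int_quotient)
  have "padic_const r * of_int b = (padic_const (r * of_int b) :: 'q padic)"
    by (simp add: padic_const_hom padic_const_of_int)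
  also have "r * of_int b = of_int a" using r b by simp
  also have "padic_const (of_int a) = (of_int a :: 'q padic)" by (rule padic_const_of_int)
  finally have "padic_const r = (of_int a / of_int b :: 'q padic)"
    using b by (simp add: field_simps)
  then show ?thesis using r by (simp add: of_rat_divide)
qed

lemma padic_abs_of_rat: "padic_abs (of_rat r :: 'q::prime_card padic) = qadic_abs CARD('q) r"
  using padic_abs_const[of r, where 'q='q] by (simp add: padic_const_of_rat)

lemma padic_abs_of_int: "padic_abs (of_int a :: 'q::prime_card padic) = qadic_abs CARD('q) (of_int a)"
  using padic_abs_of_rat[of "of_int a", where 'q='q] by simp

lemma padic_abs_of_nat: "padic_abs (of_nat a :: 'q::prime_card padic) = qadic_abs CARD('q) (of_nat a)"
  using padic_abs_of_rat[of "of_nat a", where 'q='q] by simp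

lemma CARD_gt_1: "1 < real CARD('q::prime_card)" "0 < real CARD('q)"
  using prime_gt_1_nat[OF prime_card[where 'a='q]] by linarith+

lemma padic_abs_q: "padic_abs (of_nat CARD('q) :: 'q::prime_card padic) = inverse (real CARD('q))"
proof -
  let ?q = "CARD('q)"
  have q: "prime ?q" by (rule prime_card)
  have "multiplicity (int ?q) (int ?q) = 1"
    using prime_gt_1_nat[OF q] by (intro multiplicity_self) auto
  then have "qadic_abs ?q (of_int (int ?q)) = real ?q powi (- 1)"
    using qadic_abs_of_int[OF q, of "int ?q"] prime_gt_1_nat[OF q] by (simp del: of_int_of_nat_eq)
  then show ?thesis by (simp add: padic_abs_of_nat power_int_minus)
qed

lemma padic_abs_q_powi:
  "padic_abs (of_nat CARD('q) powi n :: 'q::prime_card padic) = real CARD('q) powi (- n)"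
  by (simp add: padic_abs_powi padic_abs_q power_int_inverse power_int_minus)

lemma padic_approx_rat:
  fixes x :: "'q::prime_card padic" assumes e: "e > 0"
  shows "\<exists>r. padic_abs (x - of_rat r) \<le> e"
proof -
  obtain X where abs_padic: "x = abs_padic X"
    using padic.abs_induct[of "\<lambda>x. \<exists>X. x = abs_padic X" x] by blast
  obtain N where N: "\<forall>m\<ge>N. \<forall>n\<ge>N. qadic_abs CARD('q) (Rep_qcauchy X m - Rep_qcauchy X n) < e"
    using e Rep_qcauchy[of X] unfolding qadic_Cauchy_def by blast
  let ?r = "Rep_qcauchy X N"
  have "qc_abs (X - qc_const ?r) \<le> e"
  proof (rule LIMSEQ_le_const2[OF qc_abs_LIMSEQ])
    show "\<exists>M. \<forall>n\<ge>M. qadic_abs CARD('q) (Rep_qcauchy (X - qc_const ?r) n) \<le> e"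
      using N by (auto simp: Rep_qcauchy_minus Rep_qc_const intro!: exI[of _ N] less_imp_le)
  qed
  moreover have "x - of_rat ?r = abs_padic (X - qc_const ?r)"
    unfolding abs_padic by (simp add: minus_padic.abs_eq padic_const_def flip: padic_const_of_rat)
  ultimately show ?thesis by (intro exI[of _ ?r]) (simp add: padic_abs.abs_eq)
qed

lemma padic_abs_cases:
  fixes x :: "'q::prime_card padic"
  obtains "x = 0" | k where "padic_abs x = real CARD('q) powi k"
proof (cases "x = 0")
  case False
  then have pos: "0 < padic_abs x / 2" by (simp add: less_le)
  obtain r where r: "padic_abs (x - of_rat r) \<le> padic_abs x / 2" using padic_approx_rat[OF pos] by blast
  have le1: "padic_abs x \<le> max (padic_abs (x - of_rat r)) (padic_abs (of_rat r :: 'q padic))"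
    using padic_abs_ultra[of "x - of_rat r" "of_rat r"] by simp
  have le2: "padic_abs (of_rat r :: 'q padic) \<le> max (padic_abs (of_rat r - x)) (padic_abs x)"
    using padic_abs_ultra[of "of_rat r - x" x] by simp
  have "padic_abs x = padic_abs (of_rat r :: 'q padic)"
    using le1 le2 r pos padic_abs_minus_commute[of x "of_rat r"] by linarith
  then have n: "padic_abs x = qadic_abs CARD('q) r" by (simp add: padic_abs_of_rat)
  then have "r \<noteq> 0" using pos by auto
  then show ?thesis using n that(2) by (auto simp: qadic_abs_def)
qed

lemma powi_small: assumes "e > 0" shows "\<exists>n::nat. real CARD('q::prime_card) powi (- int n) < e"
proof -
  obtain n where "inverse (real CARD('q)) ^ n < e"
    using real_arch_pow_inv[OF assms, of "inverse (real CARD('q))"] CARD_gt_1[where 'q='q]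
    by (auto simp: inverse_less_1_iff)
  then show ?thesis by (intro exI[of _ n]) (simp add: power_int_minus power_inverse)
qed

subsection \<open>Intervals\<close>

definition padic_interval :: "'q::prime_card padic \<Rightarrow> real \<Rightarrow> 'q padic set" where
  "padic_interval a r = {\<xi>. padic_abs (\<xi> - a) \<le> r}"

definition padic_integers :: "'q::prime_card padic set" where
  "padic_integers = {\<xi>. padic_abs \<xi> \<le> 1}"

lemma padic_integers_eq: "padic_integers = padic_interval (0 :: 'q::prime_card padic) 1"
  by (simp add: padic_integers_def padic_interval_def)

lemma padic_interval_recenter:
  fixes a b :: "'q::prime_card padic"
  assumes "b \<in> padic_interval a r" shows "padic_interval b r = padic_interval a r"
proof -
  have "padic_abs (b - a) \<le> r" "padic_abs (a - b) \<le> r"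
    using assms padic_abs_minus_commute[of a b] by (simp_all add: padic_interval_def)
  then show ?thesis unfolding padic_interval_def by (blast intro: padic_diff_le)
qed

lemma padic_interval_subset_or_disjoint:
  fixes a b :: "'q::prime_card padic"
  assumes "r \<le> s"
  shows "padic_interval a r \<subseteq> padic_interval b s \<or> padic_interval a r \<inter> padic_interval b s = {}"
proof (cases "padic_interval a r \<inter> padic_interval b s = {}")
  case False
  then obtain c where c: "c \<in> padic_interval a r" "c \<in> padic_interval b s" by blast
  have "padic_interval c r \<subseteq> padic_interval c s" using assms by (auto simp: padic_interval_def)
  then show ?thesis using c[THEN padic_interval_recenter] by simp
qed simp

lemma open_padic_interval:
  assumes "r > 0" shows "open (padic_interval (a :: 'q::prime_card padic) r)"
  unfolding open_dist
proof (intro ballI exI conjI allI impI)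
  fix x y assume "x \<in> padic_interval a r" "dist y x < r"
  then show "y \<in> padic_interval a r"
    using padic_diff_le[of y x r a] by (simp add: padic_interval_def dist_padic_def)
qed (rule assms)

lemma padic_basis:
  "topological_basis {padic_interval (of_rat c :: 'q::prime_card padic) (real CARD('q) powi (- int (Suc n))) | c n. True}"
proof (rule topological_basisI)
  fix U :: "'q padic set" and x assume "open U" "x \<in> U"
  then obtain e where e: "e > 0" "\<And>y. dist y x < e \<Longrightarrow> y \<in> U" by (auto simp: open_dist)
  obtain n where n: "real CARD('q) powi (- int n) < e" using powi_small[OF e(1)] by blast
  have n': "real CARD('q) powi (- int (Suc n)) < e"
    using n powi_le_powi_iff[OF CARD_gt_1(1)[where 'q='q], of "- int (Suc n)" "- int n"] by linarith
  let ?r = "real CARD('q) powi (- int (Suc n))"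
  have "?r > 0" using CARD_gt_1(2)[where 'q='q] by (simp add: zero_less_power_int)
  then obtain c where c: "padic_abs (x - of_rat c) \<le> ?r" using padic_approx_rat by blast
  then have x: "x \<in> padic_interval (of_rat c) ?r" by (simp add: padic_interval_def)
  moreover have "padic_interval (of_rat c) ?r \<subseteq> U"
    unfolding padic_interval_recenter[OF x, symmetric]
    using e(2) n' by (force simp: padic_interval_def dist_padic_def)
  ultimately show "\<exists>B'\<in>{padic_interval (of_rat c) (real CARD('q) powi (- int (Suc n))) | c n. True}.
     x \<in> B' \<and> B' \<subseteq> U" by blast
qed (auto intro!: open_padic_interval zero_less_power_int CARD_gt_1)

instance padic :: (prime_card) second_countable_topology
proof
  let ?f = "\<lambda>(c, n). padic_interval (of_rat c :: 'a padic) (real CARD('a) powi (- int (Suc n)))"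
  have "{padic_interval (of_rat c :: 'a padic) (real CARD('a) powi (- int (Suc n))) | c n. True}
          = range ?f" by auto
  then show "\<exists>B :: 'a padic set set. countable B \<and> open = generate_topology B"
    using topological_basis_imp_subbasis[OF padic_basis[where 'q='a]]
    by (intro exI[of _ "range ?f"]) auto
qed

definition padic_is_interval :: "'q::prime_card padic set \<Rightarrow> bool" where
  "padic_is_interval J \<longleftrightarrow> (\<exists>a k. J = padic_interval a (real CARD('q) powi k))"

text \<open>The length of a set that is an interval; meaningless on other sets.\<close>

definition padic_length :: "'q::prime_card padic set \<Rightarrow> real" where
  "padic_length J = (THE r. \<exists>a k. r = real CARD('q) powi k \<and> J = padic_interval a r)"

lemma padic_length_interval:
  fixes a :: "'q::prime_card padic"
  shows "padic_length (padic_interval a (real CARD('q) powi k)) = real CARD('q) powi k"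
  unfolding padic_length_def
proof (rule the_equality)
  fix r assume "\<exists>b j. r = real CARD('q) powi j \<and> padic_interval a (real CARD('q) powi k) = padic_interval b r"
  then obtain b j where r: "r = real CARD('q) powi j"
    and eq: "padic_interval a (real CARD('q) powi k) = padic_interval b (real CARD('q) powi j)" by blast
  have le: "k \<le> j" if eq: "padic_interval a (real CARD('q) powi k) = padic_interval b (real CARD('q) powi j)"
    for a b :: "'q padic" and j k
  proof -
    let ?x = "a + of_nat CARD('q) powi (- k)"
    have "a \<in> padic_interval a (real CARD('q) powi k)" "?x \<in> padic_interval a (real CARD('q) powi k)"
      by (simp_all add: padic_interval_def padic_abs_q_powi zero_le_power_int)
    then have "padic_abs (a - b) \<le> real CARD('q) powi j" "padic_abs (?x - b) \<le> real CARD('q) powi j"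
      unfolding eq by (simp_all add: padic_interval_def)
    then have "padic_abs (?x - a) \<le> real CARD('q) powi j"
      using padic_diff_le[of ?x b _ a] padic_abs_minus_commute[of a b] by simp
    then show ?thesis
      by (simp add: padic_abs_q_powi powi_le_powi_iff[OF CARD_gt_1(1)])
  qed
  show "r = real CARD('q) powi k" using le[OF eq] le[OF eq[symmetric]] r by simp
qed blast

lemma sets_borel_padic:
  "sets (borel :: 'q::prime_card padic measure) =
     sigma_sets UNIV (insert {} {padic_interval a (real CARD('q) powi (- int (Suc n))) | a n. True})"
  (is "_ = sigma_sets UNIV ?E")
proof
  let ?B = "{padic_interval (of_rat c :: 'q padic) (real CARD('q) powi (- int (Suc n))) | c n. True}"
  have "?B = range (\<lambda>(c, n). padic_interval (of_rat c :: 'q padic) (real CARD('q) powi (- int (Suc n))))"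
    by auto
  then have cB: "countable ?B" by simp
  have gen: "U \<in> sigma_sets UNIV ?E" if "open U" for U :: "'q padic set"
  proof -
    have "\<forall>x. open x \<longrightarrow> (\<exists>B'\<subseteq>?B. \<Union>B' = x)"
      using padic_basis[where 'q='q] unfolding topological_basis_def by (rule conjunct2)
    from this[THEN spec, THEN mp, OF that] obtain B' where B': "B' \<subseteq> ?B" and U: "U = \<Union>B'" by (elim exE conjE) simp
    have "countable B'" using B' cB by (rule countable_subset)
    moreover have "?B \<subseteq> ?E" by blast
    then have "b \<in> sigma_sets UNIV ?E" if "b \<in> B'" for b
      using that B' by (intro sigma_sets.Basic) (elim subsetD)
    ultimately show ?thesis unfolding U by (intro sigma_sets_UNION)
  qed
  have "sets (borel :: 'q padic measure) = sigma_sets UNIV {U. open U}"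
    by (simp add: borel_def)
  also have "\<dots> \<subseteq> sigma_sets UNIV ?E" using gen by (intro sigma_sets_mono) auto
  finally show "sets borel \<subseteq> sigma_sets UNIV ?E" .
  have "?E \<subseteq> sets borel"
    by (auto intro!: borel_open open_padic_interval zero_less_power_int CARD_gt_1)
  then show "sigma_sets UNIV ?E \<subseteq> sets borel"
    using sets.sigma_sets_subset[of ?E "borel :: 'q padic measure"] by simp
qed

lemma padic_measure_eqI:
  fixes M N :: "'q::prime_card padic measure"
  assumes "sets M = sets borel" "sets N = sets borel"
    and M: "\<And>a n. emeasure M (padic_interval a (real CARD('q) powi (- int (Suc n))))
                     = ennreal (real CARD('q) powi (- int (Suc n)))"
    and N: "\<And>a n. emeasure N (padic_interval a (real CARD('q) powi (- int (Suc n))))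
                     = ennreal (real CARD('q) powi (- int (Suc n)))"
  shows "M = N"
proof (rule measure_eqI_generator_eq_countable)
  let ?E = "insert {} {padic_interval a (real CARD('q) powi (- int (Suc n))) | (a :: 'q padic) n. True}"
  let ?A = "range (\<lambda>c. padic_interval (of_rat c :: 'q padic) (real CARD('q) powi (- int (Suc 0))))"
  show "Int_stable ?E"
  proof (rule Int_stableI)
    fix A B assume AB: "A \<in> ?E" "B \<in> ?E"
    show "A \<inter> B \<in> ?E"
    proof (cases "A \<inter> B = {}")
      case False
      then obtain a m b n
        where A: "A = padic_interval a (real CARD('q) powi (- int (Suc m)))"
          and B: "B = padic_interval b (real CARD('q) powi (- int (Suc n)))"
        using AB by (elim insertE CollectE exE conjE) simp_all
      have "A \<subseteq> B \<or> B \<subseteq> A"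
      proof (cases "real CARD('q) powi (- int (Suc m)) \<le> real CARD('q) powi (- int (Suc n))")
        case True
        from padic_interval_subset_or_disjoint[OF this, of a b] False show ?thesis
          unfolding A B by blast
      next
        case F: False
        then have "real CARD('q) powi (- int (Suc n)) \<le> real CARD('q) powi (- int (Suc m))" by linarith
        from padic_interval_subset_or_disjoint[OF this, of b a] False show ?thesis
          unfolding A B by blast
      qed
      then have "A \<inter> B = A \<or> A \<inter> B = B" by blast
      then show ?thesis using AB by (elim disjE) (simp_all only:)
    qed simp
  qed
  show "emeasure M X = emeasure N X" if "X \<in> ?E" for X
    using that
  proof (rule insertE)
    assume "X \<in> {padic_interval a (real CARD('q) powi (- int (Suc n))) | (a :: 'q padic) n. True}"
    then obtain a n where "X = padic_interval (a :: 'q padic) (real CARD('q) powi (- int (Suc n)))"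
      by blast
    then show ?thesis by (simp only: M N)
  qed simp
  show "sets M = sigma_sets UNIV ?E" "sets N = sigma_sets UNIV ?E"
    by (simp_all only: assms(1,2) sets_borel_padic)
  show "\<Union>?A = UNIV"
  proof (rule UNIV_eq_I[symmetric])
    fix x :: "'q padic"
    have "real CARD('q) powi (- int (Suc 0)) > 0"
      using CARD_gt_1(2)[where 'q='q] by (rule zero_less_power_int)
    then obtain c where "padic_abs (x - of_rat c) \<le> real CARD('q) powi (- int (Suc 0))"
      using padic_approx_rat by blast
    then have "x \<in> padic_interval (of_rat c) (real CARD('q) powi (- int (Suc 0)))"
      by (simp add: padic_interval_def)
    then show "x \<in> \<Union>?A" by blast
  qed
  show "?A \<subseteq> ?E" by blast
  show "emeasure M a \<noteq> \<infinity>" if "a \<in> ?A" for a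
  proof -
    from that obtain c where "a = padic_interval (of_rat c :: 'q padic) (real CARD('q) powi (- int (Suc 0)))"
      by blast
    then show ?thesis by (simp only: M infinity_ennreal_def ennreal_neq_top not_False_eq_True)
  qed
  show "?E \<subseteq> Pow UNIV" by (rule subset_Pow_Union[THEN subset_trans]) simp
  show "countable ?A" by (rule countable_image) simp
qed

lemma padic_integer_approx:
  fixes x :: "'q::prime_card padic"
  assumes x: "padic_abs x \<le> 1"
  shows "\<exists>N < CARD('q) ^ n. padic_abs (x - of_nat N) \<le> real CARD('q) powi (- int n)"
proof -
  let ?q = "CARD('q)" and ?e = "real CARD('q) powi (- int n)"
  have q: "prime ?q" by (rule prime_card)
  have e: "0 < ?e" "?e \<le> 1"
    using CARD_gt_1[where 'q='q] by (simp_all add: zero_less_power_int powi_le_1_iff)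
  obtain r where r: "padic_abs (x - of_rat r) \<le> ?e" using padic_approx_rat[OF e(1)] by blast
  have r1: "qadic_abs ?q r \<le> 1"
    using padic_abs_ultra[of "of_rat r - x" x] padic_abs_minus_commute[of x "of_rat r"] r e x
    by (simp add: padic_abs_of_rat)
  obtain a b where ab: "quotient_of r = (a, b)" by (cases "quotient_of r")
  have b: "b > 0" and cop: "coprime a b" and rab: "r = of_int a / of_int b"
    using quotient_of_denom_pos[OF ab] quotient_of_coprime[OF ab] quotient_of_div[OF ab] by auto
  have nb: "\<not> int ?q dvd b"
  proof
    assume d: "int ?q dvd b"
    have "\<not> int ?q dvd a"
    proof
      assume "int ?q dvd a"
      then have "is_unit (int ?q)" using cop d coprime_common_divisor by blast
      then show False using prime_gt_1_nat[OF q] by simp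
    qed
    then have a: "multiplicity (int ?q) a = 0" "a \<noteq> 0" by (auto simp: not_dvd_imp_multiplicity_0)
    have "multiplicity (int ?q) b > 0"
      using d b prime_gt_1_nat[OF q] by (subst multiplicity_gt_zero_iff) auto
    moreover have "qadic_abs ?q r = real ?q powi (int (multiplicity (int ?q) b))"
      unfolding rab using qadic_abs_frac[OF q a(2), of b] b a(1) by simp
    ultimately show False
      using r1 powi_le_1_iff[OF CARD_gt_1(1)[where 'q='q], of "int (multiplicity (int ?q) b)"]
      by (simp del: power_int_of_nat)
  qed
  have "prime (int ?q)" using q by simp
  then have "coprime (int ?q ^ n) b" using nb by (simp add: prime_imp_coprime)
  then obtain u v where uv: "u * int ?q ^ n + v * b = 1"
    using bezout_int[of "int ?q ^ n" b] by (auto simp: coprime_iff_gcd_eq_1)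
  define N where "N = nat ((a * v) mod (int ?q ^ n))"
  have qn: "int ?q ^ n > 0" using prime_gt_0_nat[OF q] by simp
  have N: "int N = (a * v) mod (int ?q ^ n)" unfolding N_def using qn by simp
  have lt: "N < ?q ^ n"
  proof -
    have "int N < int (?q ^ n)" unfolding N using qn by simp
    then show ?thesis by (simp only: of_nat_less_iff)
  qed
  have "int ?q ^ n dvd a - b * int N"
  proof -
    have "a - b * int N = b * (a * v - int N) + a * u * int ?q ^ n"
    proof -
      have "a * (u * int ?q ^ n + v * b) = a" using uv by simp
      then show ?thesis by (simp add: algebra_simps)
    qed
    moreover have "int ?q ^ n dvd a * v - int N" unfolding N by (simp add: minus_mod_eq_mult_div)
    ultimately show ?thesis by simp
  qed
  then have "qadic_abs ?q (of_int (a - b * int N)) \<le> ?e" by (simp only: qadic_abs_of_int_le[OF q])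
  moreover have "qadic_abs ?q (of_int b) = 1"
    using qadic_abs_of_int[OF q, of b] b nb by (simp add: not_dvd_imp_multiplicity_0)
  moreover have "r - of_nat N = of_int (a - b * int N) * inverse (of_int b)"
    unfolding rab using b by (simp add: field_simps)
  ultimately have "qadic_abs ?q (r - of_nat N) \<le> ?e"
    by (simp only: qadic_abs_mult[OF q] qadic_abs_inverse[OF q]) simp
  then have "padic_abs (of_rat (r - of_nat N) :: 'q padic) \<le> ?e" by (simp only: padic_abs_of_rat)
  then have "padic_abs (of_rat r - of_nat N :: 'q padic) \<le> ?e" by (simp add: of_rat_diff)
  then have "padic_abs (x - of_nat N) \<le> ?e" by (rule padic_diff_le[OF r])
  then show ?thesis using lt by (intro exI[of _ N] conjI)
qed

lemma emeasure_padic_integers: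
  fixes M :: "'q::prime_card padic measure"
  assumes sets: "sets M = sets borel"
    and c: "\<And>a. emeasure M (padic_interval a (real CARD('q) powi (- int n))) = c"
  shows "emeasure M padic_integers = of_nat (CARD('q) ^ n) * c"
proof -
  let ?q = "CARD('q)" and ?r = "real CARD('q) powi (- int n)"
  let ?I = "\<lambda>N. padic_interval (of_nat N :: 'q padic) ?r"
  have r: "0 < ?r" "?r \<le> 1"
    using CARD_gt_1[where 'q='q] by (simp_all add: zero_less_power_int powi_le_1_iff)
  have le1: "padic_abs (of_nat N :: 'q padic) \<le> 1" for N
    using qadic_abs_of_int_le_1[OF prime_card[where 'a='q], of "int N"] by (simp add: padic_abs_of_nat)
  have eq: "padic_integers = (\<Union>N<?q ^ n. ?I N)"
  proof (intro set_eqI iffI)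
    fix x :: "'q padic" assume "x \<in> padic_integers"
    then show "x \<in> (\<Union>N<?q ^ n. ?I N)"
      using padic_integer_approx[of x n] by (auto simp: padic_integers_def padic_interval_def)
  next
    fix x :: "'q padic" assume "x \<in> (\<Union>N<?q ^ n. ?I N)"
    then obtain N where "padic_abs (x - of_nat N) \<le> ?r" by (auto simp: padic_interval_def)
    then show "x \<in> padic_integers"
      using padic_abs_ultra[of "x - of_nat N" "of_nat N"] le1[of N] r by (simp add: padic_integers_def)
  qed
  have disj: "disjoint_family_on ?I {..<?q ^ n}"
    unfolding disjoint_family_on_def
  proof (intro ballI impI)
    fix N N' assume N: "N \<in> {..<?q ^ n}" "N' \<in> {..<?q ^ n}" "N \<noteq> N'"
    show "?I N \<inter> ?I N' = {}"
    proof (rule ccontr)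
      assume "?I N \<inter> ?I N' \<noteq> {}"
      then obtain x :: "'q padic" where x: "padic_abs (x - of_nat N) \<le> ?r" "padic_abs (x - of_nat N') \<le> ?r"
        by (auto simp: padic_interval_def)
      then have "padic_abs (of_nat N - of_nat N' :: 'q padic) \<le> ?r"
        using padic_diff_le[of "of_nat N" x] padic_abs_minus_commute[of x "of_nat N"] by simp
      then have "padic_abs (of_int (int N - int N') :: 'q padic) \<le> ?r" by simp
      then have "int ?q ^ n dvd int N - int N'"
        by (simp only: padic_abs_of_int qadic_abs_of_int_le[OF prime_card])
      then have "int N mod int (?q ^ n) = int N' mod int (?q ^ n)" by (simp add: mod_eq_dvd_iff)
      moreover have "int N < int (?q ^ n)" "int N' < int (?q ^ n)"
        using N by (simp_all only: of_nat_less_iff lessThan_iff)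
      ultimately show False using N(3) by simp
    qed
  qed
  have "emeasure M padic_integers = (\<Sum>N<?q ^ n. emeasure M (?I N))"
    unfolding eq using disj r(1)
    by (subst sum_emeasure) (auto simp: sets intro!: borel_open open_padic_interval)
  then show ?thesis by (simp add: c)
qed

subsection \<open>Haar measure\<close>

text \<open>
  Existence of Haar measure is shown by transporting Lebesgue measure on \<open>[0, \<infinity>)\<close> along the map
  that reads the base-\<open>q\<close> expansion of a real number backwards,
  \<open>\<Sum> b\<^sub>j q\<^sup>j \<mapsto> \<Sum> b\<^sub>j q\<^sup>-\<^sup>j\<^sup>-\<^sup>1\<close>: preimages of small intervals are real intervals of the same length.
\<close>

fun digit_reverse :: "nat \<Rightarrow> nat \<Rightarrow> rat" where
  "digit_reverse q m =
     (if m = 0 \<or> q \<le> 1 then 0 else of_nat (m mod q) + digit_reverse q (m div q) / of_nat q)"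

declare digit_reverse.simps [simp del]

lemma digit_reverse_rec:
  assumes "q > 1"
  shows "digit_reverse q m = of_nat (m mod q) + digit_reverse q (m div q) / of_nat q"
  using assms by (subst digit_reverse.simps) (auto simp: digit_reverse.simps[of q 0])

lemma digit_reverse_integral:
  assumes q: "q > 1" and "m < q ^ Suc k"
  shows "\<exists>N < q ^ Suc k. of_nat q ^ k * digit_reverse q m = of_nat N"
  using assms(2)
proof (induction k arbitrary: m)
  case 0
  then have "digit_reverse q m = of_nat m"
    using digit_reverse_rec[OF q, of m] by (simp add: digit_reverse.simps[of q 0])
  then show ?case using 0 by auto
next
  case (Suc k)
  have "m div q < q ^ Suc k" using Suc.prems q by (simp add: less_mult_imp_div_less mult.commute)
  from Suc.IH[OF this] obtain N where N: "N < q ^ Suc k"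
    "of_nat q ^ k * digit_reverse q (m div q) = of_nat N" by blast
  have "of_nat q ^ Suc k * digit_reverse q m
          = of_nat (q ^ Suc k * (m mod q)) + of_nat q ^ k * digit_reverse q (m div q)"
    using q by (subst digit_reverse_rec[OF q]) (simp add: field_simps)
  then have eq: "of_nat q ^ Suc k * digit_reverse q m = of_nat (q ^ Suc k * (m mod q) + N)"
    using N(2) by simp
  have "q ^ Suc k * (m mod q) + N < q ^ Suc k * (m mod q + 1)" using N(1) by simp
  also have "\<dots> \<le> q ^ Suc k * q" using q by (intro mult_left_mono) (simp_all add: Suc_leI)
  finally have "q ^ Suc k * (m mod q) + N < q ^ Suc (Suc k)" by (simp add: mult_ac)
  then show ?case using eq by blast
qed

lemma less_power_Suc: "(1::nat) < q \<Longrightarrow> m < q ^ Suc m"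
  using power_gt_expt[of q "Suc m"] by simp

lemma digit_reverse_bounds:
  assumes q: "q > 1" shows "0 \<le> digit_reverse q m \<and> digit_reverse q m < of_nat q"
proof -
  from digit_reverse_integral[OF q less_power_Suc[OF q]] obtain N
    where N: "N < q ^ Suc m" "of_nat q ^ m * digit_reverse q m = of_nat N" by blast
  have qp: "(0 :: rat) < of_nat q ^ m" using q by simp
  have "(of_nat N :: rat) < of_nat (q ^ Suc m)" using N(1) by (simp only: of_nat_less_iff)
  then have "of_nat q ^ m * digit_reverse q m < of_nat q ^ m * of_nat q" unfolding N(2) by (simp add: mult.commute)
  moreover have "0 \<le> of_nat q ^ m * digit_reverse q m" unfolding N(2) by simp
  ultimately show ?thesis using qp by (simp add: zero_le_mult_iff)
qed

lemma digit_reverse_inj: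
  assumes q: "q > 1" shows "digit_reverse q m = digit_reverse q m' \<Longrightarrow> m = m'"
proof (induction m arbitrary: m' rule: less_induct)
  case (less m)
  have split: "digit_reverse q x = of_nat (x mod q) + digit_reverse q (x div q) / of_nat q"
    "0 \<le> digit_reverse q (x div q) / of_nat q" "digit_reverse q (x div q) / of_nat q < 1" for x
    using digit_reverse_rec[OF q, of x] digit_reverse_bounds[OF q, of "x div q"] q by simp_all
  have fl: "\<lfloor>digit_reverse q x\<rfloor> = int (x mod q)" for x
    using split[of x] by (intro floor_unique) simp_all
  have md: "m mod q = m' mod q" using fl[of m] fl[of m'] less.prems by simp
  have "of_nat (m mod q) + digit_reverse q (m div q) / of_nat q
      = of_nat (m' mod q) + digit_reverse q (m' div q) / of_nat q"
    by (rule trans[OF split(1)[of m, symmetric] trans[OF less.prems split(1)[of m']]])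
  then have "digit_reverse q (m div q) / of_nat q = digit_reverse q (m' div q) / of_nat q"
    unfolding md by (rule add_left_imp_eq)
  then have dr: "digit_reverse q (m div q) = digit_reverse q (m' div q)"
    using q by (simp only: divide_cancel_right of_nat_eq_0_iff) auto
  show ?case
  proof (cases "m = 0")
    case True
    then have "digit_reverse q (m' div q) = 0" "m' mod q = 0"
      using dr md by (simp_all add: digit_reverse.simps[of q 0])
    moreover have "x = 0" if "digit_reverse q x = 0" for x
      using that
    proof (induction x rule: less_induct)
      case (less x)
      have "of_nat (x mod q) = (0 :: rat)" "digit_reverse q (x div q) / of_nat q = 0"
        using split(1,2)[of x] less.prems of_nat_0_le_iff[of "x mod q", where 'a=rat] by linarith+
      then have "x mod q = 0" "digit_reverse q (x div q) = 0" using q by simp_all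
      then show ?case
        using less.IH[of "x div q"] q by (cases "x = 0") (auto simp: div_less_dividend)
    qed
    ultimately have "m' div q = 0" by blast
    then have "m' = 0" using \<open>m' mod q = 0\<close> by (metis mult_div_mod_eq add_0 mult_0_right)
    then show ?thesis using True by simp
  next
    case False
    then have "m div q < m" using q by (intro div_less_dividend) auto
    from less.IH[OF this dr] show ?thesis using md by (metis mult_div_mod_eq)
  qed
qed

lemma digit_reverse_ex1:
  fixes a :: "'q::prime_card padic"
  shows "\<exists>!m. padic_abs (of_rat (digit_reverse CARD('q) m) - a) \<le> inverse (real CARD('q))"
proof -
  let ?q = "CARD('q)"
  note pq = prime_card[where 'a='q]
  have q: "?q > 1" using prime_gt_1_nat[OF pq] .
  have q0: "(of_nat ?q :: 'q padic) \<noteq> 0" using q by simp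
  have scale: "padic_abs (x - y) \<le> inverse (real ?q) \<longleftrightarrow>
      padic_abs (of_nat ?q ^ k * x - of_nat ?q ^ k * y) \<le> real ?q powi (- int (Suc k))"
    for x y :: "'q padic" and k
  proof -
    have "padic_abs (of_nat ?q ^ k * x - of_nat ?q ^ k * y) = inverse (real ?q) ^ k * padic_abs (x - y)"
      by (simp add: padic_abs_mult padic_abs_power padic_abs_q flip: right_diff_distrib)
    moreover have "real ?q powi (- int (Suc k)) = inverse (real ?q) ^ k * inverse (real ?q)"
      by (subst power_int_minus, subst power_int_of_nat) (simp add: power_inverse)
    moreover have "inverse (real ?q) ^ k > 0" using q by simp
    ultimately show ?thesis by (simp only: mult_le_cancel_left_pos)
  qed
  have lift: "of_nat ?q ^ k * of_rat (digit_reverse ?q m) = (of_nat N :: 'q padic)"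
    if "of_nat ?q ^ k * digit_reverse ?q m = of_nat N" for k m N
    using arg_cong[OF that, of "of_rat :: rat \<Rightarrow> 'q padic"] by (simp add: of_rat_mult of_rat_power)
  show ?thesis
  proof (rule ex_ex1I)
    obtain k :: nat where k: "padic_abs a \<le> real ?q ^ k"
      using real_arch_pow[of "real ?q" "padic_abs a"] q less_imp_le by auto
    have "padic_abs (of_nat ?q ^ k * a) = inverse (real ?q) ^ k * padic_abs a"
      by (simp add: padic_abs_mult padic_abs_power padic_abs_q)
    also have "\<dots> \<le> 1" using k q by (simp add: power_inverse field_simps)
    finally obtain N where N: "N < ?q ^ Suc k"
        "padic_abs (of_nat ?q ^ k * a - of_nat N) \<le> real ?q powi (- int (Suc k))"
      using padic_integer_approx[of "of_nat ?q ^ k * a" "Suc k"] by blast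
    define f where "f m = nat \<lfloor>of_nat ?q ^ k * digit_reverse ?q m\<rfloor>" for m
    have f: "of_nat ?q ^ k * digit_reverse ?q m = of_nat (f m)" "f m < ?q ^ Suc k" if "m < ?q ^ Suc k" for m
    proof -
      from digit_reverse_integral[OF q that] obtain M
        where "M < ?q ^ Suc k" "of_nat ?q ^ k * digit_reverse ?q m = of_nat M" by blast
      then show "of_nat ?q ^ k * digit_reverse ?q m = of_nat (f m)" "f m < ?q ^ Suc k"
        by (simp_all add: f_def)
    qed
    have "inj_on f {..<?q ^ Suc k}"
    proof (rule inj_onI)
      fix m m' assume m: "m \<in> {..<?q ^ Suc k}" "m' \<in> {..<?q ^ Suc k}" "f m = f m'"
      then have "of_nat ?q ^ k * digit_reverse ?q m = of_nat ?q ^ k * digit_reverse ?q m'"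
        using f(1) by simp
      then have "digit_reverse ?q m = digit_reverse ?q m'" using q by simp
      then show "m = m'" by (rule digit_reverse_inj[OF q])
    qed
    moreover have "f ` {..<?q ^ Suc k} \<subseteq> {..<?q ^ Suc k}" using f(2) by auto
    ultimately have "f ` {..<?q ^ Suc k} = {..<?q ^ Suc k}" by (intro endo_inj_surj) simp_all
    then obtain m where m: "m < ?q ^ Suc k" "f m = N" using N(1) by (metis imageE lessThan_iff)
    have "of_nat ?q ^ k * of_rat (digit_reverse ?q m) = (of_nat N :: 'q padic)"
      using f(1)[OF m(1)] m(2) by (intro lift) simp
    then have "padic_abs (of_rat (digit_reverse ?q m) - a) \<le> inverse (real ?q)"
      using N(2) by (subst scale[of _ _ k]) (simp add: padic_abs_minus_commute)
    then show "\<exists>m. padic_abs (of_rat (digit_reverse ?q m) - a) \<le> inverse (real ?q)" by blast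
  next
    fix m m'
    assume m: "padic_abs (of_rat (digit_reverse ?q m) - a) \<le> inverse (real ?q)"
      and m': "padic_abs (of_rat (digit_reverse ?q m') - a) \<le> inverse (real ?q)"
    define k where "k = max m m'"
    have lt: "m < ?q ^ Suc k" "m' < ?q ^ Suc k"
      using less_power_Suc[OF q, of k] unfolding k_def by linarith+
    obtain N where N: "N < ?q ^ Suc k" "of_nat ?q ^ k * digit_reverse ?q m = of_nat N"
      using digit_reverse_integral[OF q lt(1)] by blast
    obtain N' where N': "N' < ?q ^ Suc k" "of_nat ?q ^ k * digit_reverse ?q m' = of_nat N'"
      using digit_reverse_integral[OF q lt(2)] by blast
    have "padic_abs (of_rat (digit_reverse ?q m) - of_rat (digit_reverse ?q m') :: 'q padic) \<le> inverse (real ?q)"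
      using m m' padic_abs_minus_commute[of a "of_rat (digit_reverse ?q m')"]
      by (intro padic_diff_le[OF m]) simp
    then have "padic_abs (of_nat N - of_nat N' :: 'q padic) \<le> real ?q powi (- int (Suc k))"
      unfolding scale[of _ _ k] lift[OF N(2)] lift[OF N'(2)] .
    then have "padic_abs (of_int (int N - int N') :: 'q padic) \<le> real ?q powi (- int (Suc k))"
      by (simp only: of_int_diff of_int_of_nat_eq)
    then have "int ?q ^ Suc k dvd int N - int N'"
      by (simp only: padic_abs_of_int qadic_abs_of_int_le[OF pq])
    then have "int N mod int (?q ^ Suc k) = int N' mod int (?q ^ Suc k)"
      by (simp only: mod_eq_dvd_iff of_nat_power)
    moreover have "int N < int (?q ^ Suc k)" "int N' < int (?q ^ Suc k)"
      using N(1) N'(1) by (simp_all only: of_nat_less_iff)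
    ultimately have "N = N'" by (simp only: mod_pos_pos_trivial of_nat_0_le_iff of_nat_eq_iff)
    then have "of_nat ?q ^ k * digit_reverse ?q m = of_nat ?q ^ k * digit_reverse ?q m'"
      using N(2) N'(2) by simp
    then have "digit_reverse ?q m = digit_reverse ?q m'" using q by simp
    then show "m = m'" by (rule digit_reverse_inj[OF q])
  qed
qed

definition reversal_seq :: "nat \<Rightarrow> real \<Rightarrow> nat \<Rightarrow> rat" where
  "reversal_seq q x n = of_nat q ^ n * digit_reverse q (nat \<lfloor>x * real q ^ Suc n\<rfloor>)"

lemma floor_mult_div:
  assumes "x \<ge> 0" "q > 0"
  shows "nat \<lfloor>x * real q\<rfloor> div q = nat \<lfloor>x\<rfloor>"
proof -
  have "\<lfloor>(x * real q) / real q\<rfloor> = \<lfloor>x * real q\<rfloor> div int q"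
    using floor_divide_real_eq_div[of "int q" "x * real q"] by simp
  then have "\<lfloor>x\<rfloor> = \<lfloor>x * real q\<rfloor> div int q" using assms by simp
  moreover have "\<lfloor>x * real q\<rfloor> \<ge> 0" using assms by simp
  ultimately show ?thesis by (simp add: nat_div_distrib)
qed

lemma reversal_seq_step:
  assumes q: "prime q" and x: "x \<ge> 0"
  shows "qadic_abs q (reversal_seq q x (Suc n) - reversal_seq q x n) \<le> real q powi (- int (Suc n))"
proof -
  let ?m = "nat \<lfloor>x * real q ^ Suc (Suc n)\<rfloor>"
  have q1: "q > 1" using prime_gt_1_nat[OF q] .
  have "?m div q = nat \<lfloor>x * real q ^ Suc n\<rfloor>"
    using floor_mult_div[of "x * real q ^ Suc n" q] x q1 by (simp add: mult_ac)
  then have "reversal_seq q x (Suc n) - reversal_seq q x n = of_int (int q ^ Suc n * int (?m mod q))"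
    unfolding reversal_seq_def
    using q1 by (subst digit_reverse_rec[OF q1, of ?m]) (simp add: field_simps)
  then show ?thesis by (simp only: qadic_abs_of_int_le[OF q] dvd_triv_left)
qed

lemma reversal_seq_diff:
  assumes q: "prime q" and x: "x \<ge> 0" and "n \<le> m"
  shows "qadic_abs q (reversal_seq q x m - reversal_seq q x n) \<le> real q powi (- int (Suc n))"
  using \<open>n \<le> m\<close>
proof (induction m rule: dec_induct)
  case base
  then show ?case by (simp add: zero_le_power_int)
next
  case (step m)
  have "real q powi (- int (Suc m)) \<le> real q powi (- int (Suc n))"
    using step.hyps prime_gt_1_nat[OF q] by (subst powi_le_powi_iff) auto
  then have "qadic_abs q (reversal_seq q x (Suc m) - reversal_seq q x m) \<le> real q powi (- int (Suc n))"
    using reversal_seq_step[OF q x, of m] by linarith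
  then have "max (qadic_abs q (reversal_seq q x (Suc m) - reversal_seq q x m))
      (qadic_abs q (reversal_seq q x m - reversal_seq q x n)) \<le> real q powi (- int (Suc n))"
    using step.IH by simp
  from order_trans[OF qadic_abs_ultra[OF q] this] show ?case by simp
qed

lemma reversal_seq_Cauchy:
  assumes x: "x \<ge> 0" shows "qadic_Cauchy CARD('q::prime_card) (reversal_seq CARD('q) x)"
  unfolding qadic_Cauchy_def
proof (intro allI impI)
  fix e :: real assume "e > 0"
  then obtain N where N: "real CARD('q) powi (- int N) < e" using powi_small by blast
  note q = prime_card[where 'a='q]
  have le: "real CARD('q) powi (- int (Suc N)) \<le> real CARD('q) powi (- int N)"
    using CARD_gt_1(1)[where 'q='q] by (subst powi_le_powi_iff) auto
  have "qadic_abs CARD('q) (reversal_seq CARD('q) x m - reversal_seq CARD('q) x n) < e"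
    if "m \<ge> N" "n \<ge> N" for m n
  proof -
    have "qadic_abs CARD('q) ((reversal_seq CARD('q) x m - reversal_seq CARD('q) x N)
        - (reversal_seq CARD('q) x n - reversal_seq CARD('q) x N)) < e"
      using qadic_abs_diff_ultra[OF q] reversal_seq_diff[OF q x that(1)] reversal_seq_diff[OF q x that(2)]
        le N by (meson le_less_trans max.bounded_iff order_trans max.boundedI)
    then show ?thesis by simp
  qed
  then show "\<exists>N. \<forall>m\<ge>N. \<forall>n\<ge>N.
      qadic_abs CARD('q) (reversal_seq CARD('q) x m - reversal_seq CARD('q) x n) < e" by blast
qed

definition reversal :: "real \<Rightarrow> 'q::prime_card padic" where
  "reversal x = abs_padic (Abs_qcauchy (reversal_seq CARD('q) x))"

lemma reversal_approx:
  assumes x: "x \<ge> 0"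
  shows "padic_abs (reversal x - of_rat (reversal_seq CARD('q) x n) :: 'q::prime_card padic)
           \<le> real CARD('q) powi (- int (Suc n))"
proof -
  let ?X = "Abs_qcauchy (reversal_seq CARD('q) x) :: 'q qcauchy" and ?r = "reversal_seq CARD('q) x n"
  have Rep: "Rep_qcauchy ?X = reversal_seq CARD('q) x"
    by (rule Abs_qcauchy_inverse) (simp add: reversal_seq_Cauchy[OF x])
  have "qc_abs (?X - qc_const ?r) \<le> real CARD('q) powi (- int (Suc n))"
  proof (rule LIMSEQ_le_const2[OF qc_abs_LIMSEQ], intro exI[of _ n] allI impI)
    fix m assume "n \<le> m"
    then show "qadic_abs CARD('q) (Rep_qcauchy (?X - qc_const ?r) m) \<le> real CARD('q) powi (- int (Suc n))"
      unfolding Rep_qcauchy_minus Rep_qc_const Rep by (rule reversal_seq_diff[OF prime_card x])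
  qed
  moreover have "reversal x - of_rat ?r = abs_padic (?X - qc_const ?r)"
    by (simp only: reversal_def minus_padic.abs_eq padic_const_def flip: padic_const_of_rat)
  ultimately show ?thesis by (simp only: padic_abs.abs_eq)
qed

lemma reversal_vimage:
  fixes a :: "'q::prime_card padic"
  shows "\<exists>m::nat. reversal -` padic_interval a (real CARD('q) powi (- int (Suc n))) \<inter> {0..}
           = {real m / real CARD('q) ^ Suc n ..< (real m + 1) / real CARD('q) ^ Suc n}"
proof -
  let ?q = "CARD('q)" and ?r = "real CARD('q) powi (- int (Suc n))"
  have q: "real ?q > 1" by (rule CARD_gt_1)
  have q0: "(of_nat ?q :: 'q padic) \<noteq> 0" using q by simp
  let ?P = "\<lambda>k. padic_abs (of_rat (digit_reverse ?q k) - a / of_nat ?q ^ n) \<le> inverse (real ?q)"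
  from digit_reverse_ex1[of "a / of_nat ?q ^ n"] obtain m where Pm: "?P m" and Pk: "\<And>k. ?P k \<Longrightarrow> k = m"
    by (elim ex1E) blast
  have m: "?P k \<longleftrightarrow> k = m" for k using Pm Pk by blast
  have "reversal x \<in> padic_interval a ?r \<longleftrightarrow> nat \<lfloor>x * real ?q ^ Suc n\<rfloor> = m" if x: "x \<ge> 0" for x
  proof -
    let ?k = "nat \<lfloor>x * real ?q ^ Suc n\<rfloor>" and ?s = "of_rat (reversal_seq ?q x n) :: 'q padic"
    have ap: "padic_abs (reversal x - ?s) \<le> ?r" by (rule reversal_approx[OF x])
    have "reversal x \<in> padic_interval a ?r \<longleftrightarrow> padic_abs (?s - a) \<le> ?r"
      unfolding padic_interval_def mem_Collect_eq
    proof
      assume "padic_abs (reversal x - a) \<le> ?r"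
      moreover have "padic_abs (?s - reversal x) \<le> ?r" using ap by (subst padic_abs_minus_commute)
      ultimately show "padic_abs (?s - a) \<le> ?r" by (rule padic_diff_le[rotated])
    qed (rule padic_diff_le[OF ap])
    also have "\<dots> \<longleftrightarrow> padic_abs (of_rat (digit_reverse ?q ?k) - a / of_nat ?q ^ n) \<le> inverse (real ?q)"
    proof -
      have "?s - a = of_nat ?q ^ n * (of_rat (digit_reverse ?q ?k) - a / of_nat ?q ^ n)"
        unfolding reversal_seq_def using q0 by (simp add: of_rat_mult of_rat_power field_simps)
      then have "padic_abs (?s - a)
          = inverse (real ?q) ^ n * padic_abs (of_rat (digit_reverse ?q ?k) - a / of_nat ?q ^ n)"
        by (simp only: padic_abs_mult padic_abs_power padic_abs_q)
      moreover have "?r = inverse (real ?q) ^ n * inverse (real ?q)"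
        by (subst power_int_minus, subst power_int_of_nat) (simp add: power_inverse)
      moreover have "inverse (real ?q) ^ n > 0" using q by simp
      ultimately show ?thesis by (simp only: mult_le_cancel_left_pos)
    qed
    finally show ?thesis by (simp only: m)
  qed
  moreover have "nat \<lfloor>x * real ?q ^ Suc n\<rfloor> = m \<longleftrightarrow> x \<in> {real m / real ?q ^ Suc n ..< (real m + 1) / real ?q ^ Suc n}"
    if "x \<ge> 0" for x
  proof -
    have Q: "real ?q ^ Suc n > 0" using q by simp
    have "\<lfloor>x * real ?q ^ Suc n\<rfloor> \<ge> 0" using that q by simp
    then have "nat \<lfloor>x * real ?q ^ Suc n\<rfloor> = m \<longleftrightarrow> \<lfloor>x * real ?q ^ Suc n\<rfloor> = int m" by linarith
    also have "\<dots> \<longleftrightarrow> real m \<le> x * real ?q ^ Suc n \<and> x * real ?q ^ Suc n < real m + 1"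
      by (simp add: floor_eq_iff)
    also have "\<dots> \<longleftrightarrow> x \<in> {real m / real ?q ^ Suc n ..< (real m + 1) / real ?q ^ Suc n}"
      using Q by (simp only: pos_divide_le_eq pos_less_divide_eq atLeastLessThan_iff)
    finally show ?thesis .
  qed
  moreover have "x \<ge> 0" if "x \<in> {real m / real ?q ^ Suc n ..< (real m + 1) / real ?q ^ Suc n}" for x
    using that by (meson atLeastLessThan_iff divide_nonneg_nonneg of_nat_0_le_iff order_trans zero_le_power)
  ultimately have "reversal -` padic_interval a ?r \<inter> {0..}
      = {real m / real ?q ^ Suc n ..< (real m + 1) / real ?q ^ Suc n}"
    by (intro set_eqI) (simp only: Int_iff vimage_eq atLeast_iff, blast)
  then show ?thesis by blast
qed

lemma reversal_measurable:
  "(reversal :: real \<Rightarrow> 'q::prime_card padic) \<in> measurable (restrict_space lborel {0..}) borel"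
proof (rule measurable_sigma_sets[OF sets_borel_padic])
  fix A :: "'q padic set"
  assume "A \<in> insert {} {padic_interval a (real CARD('q) powi (- int (Suc n))) | a n. True}"
  then have "A = {} \<or> (\<exists>a n. A = padic_interval a (real CARD('q) powi (- int (Suc n))))" by blast
  then show "reversal -` A \<inter> space (restrict_space lborel {0..}) \<in> sets (restrict_space lborel {0..})"
  proof (elim disjE exE)
    fix a n assume A: "A = padic_interval a (real CARD('q) powi (- int (Suc n)))"
    obtain m :: nat where m: "reversal -` A \<inter> {0..}
        = {real m / real CARD('q) ^ Suc n ..< (real m + 1) / real CARD('q) ^ Suc n}"
      using reversal_vimage[of a n] unfolding A by blast
    have "space (restrict_space lborel {0::real..}) = {0..}" by (simp add: space_restrict_space)
    then show ?thesis unfolding sets_restrict_space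
      using m by (intro image_eqI[of _ _ "reversal -` A \<inter> {0..}"]) auto
  qed simp
qed auto

lemma emeasure_haar_model:
  fixes a :: "'q::prime_card padic"
  shows "emeasure (distr (restrict_space lborel {0..}) borel reversal)
           (padic_interval a (real CARD('q) powi (- int (Suc n)))) = ennreal (real CARD('q) powi (- int (Suc n)))"
    (is "emeasure _ ?I = _")
proof -
  obtain m :: nat where m: "reversal -` ?I \<inter> {0..}
      = {real m / real CARD('q) ^ Suc n ..< (real m + 1) / real CARD('q) ^ Suc n}"
    using reversal_vimage[of a n] by blast
  have Q: "real CARD('q) ^ Suc n > 0" using CARD_gt_1(2)[where 'q='q] by simp
  have I: "?I \<in> sets borel"
    by (intro borel_open open_padic_interval zero_less_power_int CARD_gt_1)
  have "space (restrict_space lborel {0::real..}) = {0..}" by (simp add: space_restrict_space)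
  then have "emeasure (distr (restrict_space lborel {0..}) borel reversal) ?I
      = emeasure (restrict_space lborel {0..}) (reversal -` ?I \<inter> {0..})"
    by (simp only: emeasure_distr[OF reversal_measurable I])
  also have "\<dots> = emeasure lborel (reversal -` ?I \<inter> {0..})"
    by (rule emeasure_restrict_space) simp_all
  also have "\<dots> = ennreal ((real m + 1) / real CARD('q) ^ Suc n - real m / real CARD('q) ^ Suc n)"
    unfolding m using Q by (intro emeasure_lborel_Ico divide_right_mono) simp_all
  also have "(real m + 1) / real CARD('q) ^ Suc n - real m / real CARD('q) ^ Suc n = 1 / real CARD('q) ^ Suc n"
    by (simp only: diff_divide_distrib[symmetric]) simp
  also have "\<dots> = real CARD('q) powi (- int (Suc n))"
    by (subst power_int_minus, subst power_int_of_nat) (simp only: inverse_eq_divide)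
  finally show ?thesis .
qed

lemma padic_translate_measurable: "(\<lambda>x. a + x :: 'q::prime_card padic) \<in> borel_measurable borel"
proof (rule borel_measurable_continuous_onI)
  show "continuous_on UNIV (\<lambda>x. a + x)"
    by (auto simp: continuous_on_iff dist_padic_def)
qed

lemma padic_translate_vimage:
  "(\<lambda>x. a + x) -` padic_interval b r = padic_interval (b - a :: 'q::prime_card padic) r"
  by (auto simp: padic_interval_def algebra_simps)

definition padic_is_haar :: "'q::prime_card padic measure \<Rightarrow> bool" where
  "padic_is_haar M \<longleftrightarrow> sets M = sets borel \<and> (\<forall>a. distr M borel (\<lambda>x. a + x) = M)
     \<and> emeasure M padic_integers = 1"

lemma emeasure_padic_haar_small:
  fixes M :: "'q::prime_card padic measure"
  assumes M: "padic_is_haar M"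
  shows "emeasure M (padic_interval a (real CARD('q) powi (- int n))) = ennreal (real CARD('q) powi (- int n))"
proof -
  let ?r = "real CARD('q) powi (- int n)"
  have sets: "sets M = sets borel" and inv: "\<And>a. distr M borel (\<lambda>x. a + x) = M"
    and 1: "emeasure M padic_integers = 1"
    using M by (auto simp: padic_is_haar_def)
  have r: "?r > 0" using CARD_gt_1(2) by (rule zero_less_power_int)
  have c: "emeasure M (padic_interval b ?r) = emeasure M (padic_interval a ?r)" for b
  proof -
    have "emeasure M (padic_interval b ?r) = emeasure (distr M borel (\<lambda>x. (b - a) + x)) (padic_interval b ?r)"
      by (simp only: inv)
    also have "\<dots> = emeasure M ((\<lambda>x. (b - a) + x) -` padic_interval b ?r \<inter> space M)"
    proof (rule emeasure_distr)
      show "(\<lambda>x. b - a + x) \<in> measurable M borel"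
        using padic_translate_measurable[of "b - a"] measurable_cong_sets[OF sets refl] by blast
      show "padic_interval b ?r \<in> sets borel" by (intro borel_open open_padic_interval r)
    qed
    also have "space M = UNIV" using sets_eq_imp_space_eq[OF sets] by simp
    finally show ?thesis by (simp add: padic_translate_vimage)
  qed
  have eq: "of_nat (CARD('q) ^ n) * emeasure M (padic_interval a ?r) = 1"
    using emeasure_padic_integers[OF sets c] 1 by simp
  have "ennreal ?r * of_nat (CARD('q) ^ n) = 1"
  proof -
    have "ennreal ?r * of_nat (CARD('q) ^ n) = ennreal (?r * real (CARD('q) ^ n))"
      using r by (simp add: ennreal_mult ennreal_of_nat_eq_real_of_nat)
    also have "?r * real (CARD('q) ^ n) = 1"
      using CARD_gt_1(2)[where 'q='q] by (simp add: power_int_minus)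
    finally show ?thesis by simp
  qed
  then have "emeasure M (padic_interval a ?r) = ennreal ?r * (of_nat (CARD('q) ^ n) * emeasure M (padic_interval a ?r))"
    by (simp only: mult.assoc[symmetric] mult_1_left)
  then show ?thesis by (simp only: eq mult_1_right)
qed

lemma padic_haar_ex1: "\<exists>!M :: 'q::prime_card padic measure. padic_is_haar M"
proof (rule ex_ex1I)
  let ?M = "distr (restrict_space lborel {0..}) borel reversal :: 'q padic measure"
  have sets: "sets ?M = sets borel" by simp
  have "distr ?M borel (\<lambda>x. a + x) = ?M" for a
  proof (rule padic_measure_eqI)
    fix b :: "'q padic" and n
    let ?r = "real CARD('q) powi (- int (Suc n))"
    have I: "padic_interval b ?r \<in> sets borel"
      by (intro borel_open open_padic_interval zero_less_power_int CARD_gt_1)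
    have m: "(\<lambda>x. a + x) \<in> measurable ?M borel" using padic_translate_measurable[of a] by simp
    have "emeasure (distr ?M borel (\<lambda>x. a + x)) (padic_interval b ?r) = emeasure ?M (padic_interval (b - a) ?r)"
      by (simp only: emeasure_distr[OF m I] padic_translate_vimage space_distr space_borel Int_UNIV_right)
    also have "\<dots> = ennreal ?r" by (rule emeasure_haar_model)
    finally show "emeasure (distr ?M borel (\<lambda>x. a + x)) (padic_interval b ?r) = ennreal ?r" .
    show "emeasure ?M (padic_interval b ?r) = ennreal ?r" by (rule emeasure_haar_model)
  qed simp_all
  moreover have "emeasure ?M padic_integers = 1"
  proof -
    have "emeasure ?M padic_integers = of_nat (CARD('q) ^ Suc 0) * ennreal (real CARD('q) powi (- int (Suc 0)))"
      by (rule emeasure_padic_integers[OF sets emeasure_haar_model])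
    also have "\<dots> = ennreal (real CARD('q) * real CARD('q) powi (- int (Suc 0)))"
      by (simp add: ennreal_mult ennreal_of_nat_eq_real_of_nat zero_le_power_int)
    also have "real CARD('q) * real CARD('q) powi (- int (Suc 0)) = 1"
      using CARD_gt_1(2)[where 'q='q] by (simp add: power_int_minus)
    finally show ?thesis by simp
  qed
  ultimately show "\<exists>M :: 'q padic measure. padic_is_haar M"
    unfolding padic_is_haar_def using sets by blast
next
  fix M N :: "'q padic measure" assume "padic_is_haar M" "padic_is_haar N"
  then show "M = N"
    by (intro padic_measure_eqI emeasure_padic_haar_small) (simp_all add: padic_is_haar_def)
qed

definition padic_haar :: "'q::prime_card padic measure" where
  "padic_haar = (THE M. padic_is_haar M)"

lemma padic_haar: "padic_is_haar padic_haar"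
  unfolding padic_haar_def by (rule theI'[OF padic_haar_ex1])

subsection \<open>The additive character\<close>

text \<open>\<open>x = \<Sum>\<^sub>j\<^sub>\<ge>\<^sub>k a\<^sub>j q\<^sup>j\<close> with digits \<open>0 \<le> a\<^sub>j < q\<close>.\<close>

definition padic_expansion :: "'q::prime_card padic \<Rightarrow> int \<Rightarrow> (int \<Rightarrow> nat) \<Rightarrow> bool" where
  "padic_expansion x k a \<longleftrightarrow> (\<forall>j. a j < CARD('q)) \<and>
     (\<lambda>n. of_nat (a (k + int n)) * of_nat CARD('q) powi (k + int n)) sums x"

definition padic_char :: "'q::prime_card padic \<Rightarrow> complex" where
  "padic_char x = (THE z. \<exists>k a. padic_expansion x k a \<and>
     z = exp (2 * of_real pi * \<i> * (\<Sum>j=k..-1. of_nat (a j) * of_nat CARD('q) powi j)))"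

lemma fractional_sum_integral:
  fixes a :: "int \<Rightarrow> nat"
  assumes q: "q > 1" and a: "\<And>j. a j < q"
  shows "\<exists>N < q ^ m. of_nat q ^ m * (\<Sum>j=- int m..-1. of_nat (a j) * of_nat q powi j) = (of_nat N :: rat)"
proof (induction m)
  case (Suc m)
  then obtain N where N: "N < q ^ m"
    "of_nat q ^ m * (\<Sum>j=- int m..-1. of_nat (a j) * of_nat q powi j) = (of_nat N :: rat)" by blast
  have "{- int (Suc m)..-1} = insert (- int (Suc m)) {- int m..-1}" by auto
  then have S: "(\<Sum>j=- int (Suc m)..-1. of_nat (a j) * of_nat q powi j)
      = of_nat (a (- int (Suc m))) * of_nat q powi (- int (Suc m))
        + (\<Sum>j=- int m..-1. of_nat (a j) * of_nat q powi j :: rat)"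
    by (simp only:) (subst sum.insert, simp_all)
  have c: "(of_nat q ^ Suc m :: rat) * of_nat q powi (- int (Suc m)) = 1"
    by (subst power_int_minus, subst power_int_of_nat, rule right_inverse) (use q in simp)
  have "of_nat q ^ Suc m * (\<Sum>j=- int (Suc m)..-1. of_nat (a j) * of_nat q powi j)
     = of_nat (a (- int (Suc m))) * (of_nat q ^ Suc m * of_nat q powi (- int (Suc m)))
       + of_nat q * (of_nat q ^ m * (\<Sum>j=- int m..-1. of_nat (a j) * of_nat q powi j :: rat))"
    unfolding S by (simp only: distrib_left power_Suc mult_ac)
  also have "\<dots> = of_nat (a (- int (Suc m)) + q * N)" unfolding c N(2) by simp
  finally have "of_nat q ^ Suc m * (\<Sum>j=- int (Suc m)..-1. of_nat (a j) * of_nat q powi j)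
      = (of_nat (a (- int (Suc m)) + q * N) :: rat)" .
  moreover have "a (- int (Suc m)) + q * N < q ^ Suc m"
  proof -
    have "a (- int (Suc m)) + q * N < q * (N + 1)" using a[of "- int (Suc m)"] by simp
    also have "\<dots> \<le> q * q ^ m" using N(1) by (intro mult_left_mono) simp_all
    finally show ?thesis by simp
  qed
  ultimately show ?case by blast
qed simp

text \<open>The fractional part of an expansion is determined by \<open>x\<close>: it is the only element of
  \<open>\<int>[1/q] \<inter> [0,1)\<close> at distance at most 1 from \<open>x\<close>.\<close>

lemma padic_expansion_fractional:
  fixes x :: "'q::prime_card padic"
  assumes "padic_expansion x k a"
  shows "padic_abs (x - of_rat (\<Sum>j=k..-1. of_nat (a j) * of_nat CARD('q) powi j)) \<le> 1"
proof -
  let ?q = "CARD('q)" and ?f = "\<lambda>j. of_nat (a j) * of_nat CARD('q) powi j :: 'q padic"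
  have lim: "(\<lambda>n. \<Sum>i<n. ?f (k + int i)) \<longlonglongrightarrow> x"
    using assms by (simp add: padic_expansion_def sums_def)
  from tendstoD[OF this, of 1] obtain M where M: "\<And>n. n \<ge> M \<Longrightarrow> dist (\<Sum>i<n. ?f (k + int i)) x < 1"
    by (auto simp: eventually_sequentially)
  define n where "n = max M (nat (- k))"
  have S: "(\<Sum>i<n. ?f (k + int i)) = sum ?f {k..<k + int n}"
  proof (rule sum.reindex_bij_witness[of _ "\<lambda>j. nat (j - k)" "\<lambda>i. k + int i"])
  qed auto
  have split: "{k..<k + int n} = {k..-1} \<union> {max 0 k..<k + int n}" "{k..-1} \<inter> {max 0 k..<k + int n} = {}"
    unfolding n_def by auto
  have s1: "sum ?f {k..<k + int n} = sum ?f {k..-1} + sum ?f {max 0 k..<k + int n}"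
    unfolding split(1) by (rule sum.union_disjoint) (use split(2) in auto)
  have s2: "sum ?f {k..-1} = of_rat (\<Sum>j=k..-1. of_nat (a j) * of_nat ?q powi j)"
  proof -
    have "of_rat (of_nat ?q powi j) = (of_nat ?q powi j :: 'q padic)" for j
      by (cases j rule: int_cases4) (simp_all add: power_int_minus of_rat_inverse of_rat_power)
    then show ?thesis by (simp add: of_rat_sum of_rat_mult)
  qed
  have fin: "padic_abs (sum ?f A) \<le> 1" if "finite A" "\<And>j. j \<in> A \<Longrightarrow> j \<ge> 0" for A
    using that
  proof (induction A rule: finite_induct)
    case (insert j A)
    have "?f j = of_int (int (a j * ?q ^ nat j))"
      using insert.prems[of j] by (simp add: power_int_def)
    then have "padic_abs (?f j) \<le> 1"
      by (simp only: padic_abs_of_int qadic_abs_of_int_le_1[OF prime_card])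
    moreover have "padic_abs (sum ?f A) \<le> 1" using insert by auto
    ultimately show ?case
      using padic_abs_ultra[of "?f j" "sum ?f A"] insert.hyps by simp
  qed simp
  have tail: "padic_abs (sum ?f {max 0 k..<k + int n}) \<le> 1" by (rule fin) auto
  have "padic_abs (x - (\<Sum>i<n. ?f (k + int i))) \<le> 1"
    using M[of n] by (simp add: n_def dist_padic_def padic_abs_minus_commute)
  then have near: "padic_abs (x - sum ?f {k..<k + int n}) \<le> 1" unfolding S .
  have "x - sum ?f {k..-1} = (x - sum ?f {k..<k + int n}) + sum ?f {max 0 k..<k + int n}"
    unfolding s1 by simp
  then have "padic_abs (x - sum ?f {k..-1}) \<le> 1"
    using near tail padic_abs_ultra[of "x - sum ?f {k..<k + int n}" "sum ?f {max 0 k..<k + int n}"]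
    by (simp only:)
  then show ?thesis unfolding s2 .
qed

lemma padic_expansion_fractional_unique:
  fixes x :: "'q::prime_card padic"
  assumes "padic_expansion x k a" "padic_expansion x k' a'"
  shows "(\<Sum>j=k..-1. of_nat (a j) * of_nat CARD('q) powi j)
           = (\<Sum>j=k'..-1. of_nat (a' j) * of_nat CARD('q) powi j :: rat)" (is "?S = ?S'")
proof -
  let ?q = "CARD('q)"
  note pq = prime_card[where 'a='q]
  have q: "?q > 1" using prime_gt_1_nat[OF pq] .
  have ext: "\<exists>N < ?q ^ m. of_nat ?q ^ m * (\<Sum>j=k..-1. of_nat (a j) * of_nat ?q powi j) = (of_nat N :: rat)"
    if e: "padic_expansion x k a" and m: "- int m \<le> k" for k a m
  proof -
    define b where "b j = (if j \<ge> k then a j else 0)" for j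
    have "b j < ?q" for j using e q by (auto simp: padic_expansion_def b_def)
    from fractional_sum_integral[OF q this, of m]
    show ?thesis
    proof -
      have "(\<Sum>j=- int m..-1. of_nat (b j) * of_nat ?q powi j)
          = (\<Sum>j=k..-1. of_nat (a j) * of_nat ?q powi j :: rat)"
        using m by (intro sum.mono_neutral_cong_right) (auto simp: b_def)
      then show ?thesis
        using \<open>\<exists>N<?q ^ m. of_nat ?q ^ m * (\<Sum>j=- int m..-1. of_nat (b j) * of_nat ?q powi j) = (of_nat N :: rat)\<close>
        by (simp only:)
    qed
  qed
  define m where "m = nat (max (- k) (- k'))"
  have "- int m \<le> k" "- int m \<le> k'" unfolding m_def by auto
  then obtain N N' where N: "N < ?q ^ m" "of_nat ?q ^ m * ?S = of_nat N"
    and N': "N' < ?q ^ m" "of_nat ?q ^ m * ?S' = of_nat N'"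
    using ext assms by meson
  have "padic_abs (of_rat ?S - of_rat ?S' :: 'q padic) \<le> 1"
    using padic_expansion_fractional[OF assms(1)] padic_expansion_fractional[OF assms(2)]
      padic_diff_le padic_abs_minus_commute by metis
  then have "padic_abs (of_rat (?S - ?S') :: 'q padic) \<le> 1" by (simp only: of_rat_diff)
  then have "qadic_abs ?q (?S - ?S') \<le> 1" by (simp only: padic_abs_of_rat)
  moreover have "of_int (int N - int N') = of_nat ?q ^ m * (?S - ?S')"
    by (simp only: right_diff_distrib N(2) N'(2) of_int_diff of_int_of_nat_eq)
  moreover have "qadic_abs ?q (of_nat ?q ^ m) \<le> real ?q powi (- int m)"
    using qadic_abs_of_int_le[OF pq, of "int ?q ^ m" m] by simp
  ultimately have "qadic_abs ?q (of_int (int N - int N')) \<le> real ?q powi (- int m)"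
    using mult_mono[of "qadic_abs ?q (of_nat ?q ^ m)" "real ?q powi (- int m)" "qadic_abs ?q (?S - ?S')" 1]
    by (simp only: qadic_abs_mult[OF pq]) (simp add: zero_le_power_int)
  then have "int ?q ^ m dvd int N - int N'" by (simp only: qadic_abs_of_int_le[OF pq])
  then have "int N mod int (?q ^ m) = int N' mod int (?q ^ m)"
    by (simp only: mod_eq_dvd_iff of_nat_power)
  moreover have "int N < int (?q ^ m)" "int N' < int (?q ^ m)"
    using N(1) N'(1) by (simp_all only: of_nat_less_iff)
  ultimately have "N = N'" by (simp only: mod_pos_pos_trivial of_nat_0_le_iff of_nat_eq_iff)
  then have "of_nat ?q ^ m * ?S = of_nat ?q ^ m * ?S'" using N(2) N'(2) by simp
  then show ?thesis using q by simp
qed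

lemma padic_expansion_exists: "\<exists>k a. padic_expansion (x :: 'q::prime_card padic) k a"
proof -
  let ?q = "CARD('q)"
  note pq = prime_card[where 'a='q]
  have q: "?q > 1" using prime_gt_1_nat[OF pq] .
  have q0: "(of_nat ?q :: 'q padic) \<noteq> 0" using q by simp
  obtain m :: nat where m: "padic_abs x \<le> real ?q ^ m"
    using real_arch_pow[of "real ?q" "padic_abs x"] q less_imp_le by auto
  define y where "y = of_nat ?q ^ m * x"
  have "padic_abs y = inverse (real ?q) ^ m * padic_abs x"
    by (simp add: y_def padic_abs_mult padic_abs_power padic_abs_q)
  also have "\<dots> \<le> 1" using m q by (simp add: power_inverse field_simps)
  finally have y: "padic_abs y \<le> 1" .
  obtain N where N: "\<And>n. N n < ?q ^ n" "\<And>n. padic_abs (y - of_nat (N n)) \<le> real ?q powi (- int n)"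
    using padic_integer_approx[OF y] by metis
  have step: "N (Suc n) mod ?q ^ n = N n" for n
  proof -
    have "real ?q powi (- int (Suc n)) \<le> real ?q powi (- int n)"
      using q by (subst powi_le_powi_iff) auto
    then have "padic_abs (y - of_nat (N (Suc n))) \<le> real ?q powi (- int n)"
      using N(2)[of "Suc n"] by linarith
    then have "padic_abs (of_nat (N (Suc n)) - of_nat (N n) :: 'q padic) \<le> real ?q powi (- int n)"
      using N(2)[of n] padic_diff_le padic_abs_minus_commute by metis
    then have "padic_abs (of_int (int (N (Suc n)) - int (N n)) :: 'q padic) \<le> real ?q powi (- int n)"
      by (simp only: of_int_diff of_int_of_nat_eq)
    then have "int ?q ^ n dvd int (N (Suc n)) - int (N n)"
      by (simp only: padic_abs_of_int qadic_abs_of_int_le[OF pq])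
    then have "int (N (Suc n)) mod int (?q ^ n) = int (N n) mod int (?q ^ n)"
      by (simp only: mod_eq_dvd_iff of_nat_power)
    then have "N (Suc n) mod ?q ^ n = N n mod ?q ^ n" by (simp only: zmod_int[symmetric] of_nat_eq_iff)
    then show ?thesis using N(1)[of n] by simp
  qed
  define d where "d n = N (Suc n) div ?q ^ n" for n
  have d: "d n < ?q" for n
    using N(1)[of "Suc n"] unfolding d_def by (intro less_mult_imp_div_less) simp
  have sum: "(\<Sum>i<n. of_nat (d i) * of_nat ?q ^ i) = (of_nat (N n) :: 'q padic)" for n
  proof (induction n)
    case 0
    then show ?case using N(1)[of 0] by simp
  next
    case (Suc n)
    have "N (Suc n) = N n + d n * ?q ^ n"
      using div_mult_mod_eq[of "N (Suc n)" "?q ^ n"] unfolding step d_def by simp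
    then show ?case using Suc.IH by simp
  qed
  have "(\<lambda>n. of_nat (N n)) \<longlonglongrightarrow> y"
  proof (rule metric_LIMSEQ_I)
    fix e :: real assume "e > 0"
    then obtain M where M: "real ?q powi (- int M) < e" using powi_small by blast
    have "dist (of_nat (N n)) y < e" if "n \<ge> M" for n
    proof -
      have "real ?q powi (- int n) \<le> real ?q powi (- int M)"
        using q that by (subst powi_le_powi_iff) auto
      then show ?thesis
        using N(2)[of n] M padic_abs_minus_commute[of y] by (simp add: dist_padic_def)
    qed
    then show "\<exists>M. \<forall>n\<ge>M. dist (of_nat (N n)) y < e" by blast
  qed
  define a where "a j = (if j \<ge> - int m then d (nat (j + int m)) else 0)" for j
  have "padic_expansion x (- int m) a"
    unfolding padic_expansion_def
  proof (intro conjI allI)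
    show "a j < ?q" for j using d q by (simp add: a_def)
    have eq: "(\<Sum>i<n. of_nat (a (- int m + int i)) * of_nat ?q powi (- int m + int i))
        = inverse (of_nat ?q ^ m) * (of_nat (N n) :: 'q padic)" for n
    proof -
      have pw: "(of_nat ?q :: 'q padic) powi (- int m + int i) = inverse (of_nat ?q ^ m) * of_nat ?q ^ i" for i
        by (subst power_int_add) (use q0 in \<open>simp_all add: power_int_minus\<close>)
      show ?thesis
        unfolding sum[symmetric] sum_distrib_left pw by (intro sum.cong) (auto simp: a_def)
    qed
    have "(\<lambda>n. inverse (of_nat ?q ^ m) * (of_nat (N n) :: 'q padic)) \<longlonglongrightarrow> inverse (of_nat ?q ^ m) * y"
    proof (rule metric_LIMSEQ_I)
      fix e :: real assume "e > 0"
      then have "e / real ?q ^ m > 0" using q by simp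
      from metric_LIMSEQ_D[OF \<open>(\<lambda>n. of_nat (N n)) \<longlonglongrightarrow> y\<close> this]
      obtain M where M: "\<And>n. n \<ge> M \<Longrightarrow> dist (of_nat (N n)) y < e / real ?q ^ m" by blast
      have "dist (inverse (of_nat ?q ^ m) * of_nat (N n)) (inverse (of_nat ?q ^ m) * y) < e"
        if "n \<ge> M" for n
      proof -
        have "dist (inverse (of_nat ?q ^ m) * of_nat (N n)) (inverse (of_nat ?q ^ m) * y)
            = real ?q ^ m * dist (of_nat (N n)) y"
          unfolding dist_padic_def right_diff_distrib[symmetric] padic_abs_mult padic_abs_inverse
            padic_abs_power padic_abs_q by (simp add: power_inverse)
        then show ?thesis using M[OF that] q by (simp add: pos_less_divide_eq mult.commute)
      qed
      then show "\<exists>M. \<forall>n\<ge>M. dist (inverse (of_nat ?q ^ m) * of_nat (N n)) (inverse (of_nat ?q ^ m) * y) < e"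
        by blast
    qed
    moreover have "inverse (of_nat ?q ^ m) * y = x" unfolding y_def using q0 by simp
    ultimately show "(\<lambda>n. of_nat (a (- int m + int n)) * of_nat ?q powi (- int m + int n)) sums x"
      unfolding sums_def eq by simp
  qed
  then show ?thesis by blast
qed

lemma padic_char_expansion:
  assumes "padic_expansion x k a"
  shows "padic_char (x :: 'q::prime_card padic)
           = exp (2 * of_real pi * \<i> * (\<Sum>j=k..-1. of_nat (a j) * of_nat CARD('q) powi j))"
  unfolding padic_char_def
proof (rule the_equality)
  have of_rat: "of_rat (\<Sum>j=k..-1. of_nat (a j) * of_nat CARD('q) powi j)
      = (\<Sum>j=k..-1. of_nat (a j) * of_nat CARD('q) powi j :: complex)" for k and a :: "int \<Rightarrow> nat"
  proof -
    have "of_rat (of_nat CARD('q) powi j) = (of_nat CARD('q) powi j :: complex)" for j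
      by (cases j rule: int_cases4) (simp_all add: power_int_minus of_rat_inverse of_rat_power)
    then show ?thesis by (simp add: of_rat_sum of_rat_mult)
  qed
  fix z assume "\<exists>k a. padic_expansion x k a \<and>
      z = exp (2 * of_real pi * \<i> * (\<Sum>j=k..-1. of_nat (a j) * of_nat CARD('q) powi j))"
  then obtain k' a' where e: "padic_expansion x k' a'"
    and z: "z = exp (2 * of_real pi * \<i> * (\<Sum>j=k'..-1. of_nat (a' j) * of_nat CARD('q) powi j))"
    by blast
  show "z = exp (2 * of_real pi * \<i> * (\<Sum>j=k..-1. of_nat (a j) * of_nat CARD('q) powi j))"
    unfolding z of_rat[symmetric] padic_expansion_fractional_unique[OF e assms] ..
qed (use assms in blast)

subsection \<open>Schwartz functions, Fourier transform and decoupling\<close>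

definition padic_partition :: "real \<Rightarrow> 'q::prime_card padic set set" where
  "padic_partition \<delta> = {J. padic_is_interval J \<and> J \<subseteq> padic_integers \<and> padic_length J = \<delta>}"

lemma padic_partition_eq:
  "padic_partition (real CARD('q) powi (- int n))
     = (\<lambda>N. padic_interval (of_nat N :: 'q::prime_card padic) (real CARD('q) powi (- int n))) ` {..<CARD('q) ^ n}"
    (is "_ = ?f ` _")
proof (intro set_eqI iffI)
  fix J :: "'q padic set" assume "J \<in> padic_partition (real CARD('q) powi (- int n))"
  then obtain a k where J: "J = padic_interval a (real CARD('q) powi k)" "J \<subseteq> padic_integers"
      "padic_length J = real CARD('q) powi (- int n)"
    by (auto simp: padic_partition_def padic_is_interval_def)
  have J': "J = padic_interval a (real CARD('q) powi (- int n))"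
    using J(1,3) by (simp add: padic_length_interval)
  then have "a \<in> J" by (simp add: padic_interval_def zero_le_power_int)
  then have "padic_abs a \<le> 1" using J(2) by (auto simp: padic_integers_def)
  then obtain N where "N < CARD('q) ^ n" "padic_abs (a - of_nat N) \<le> real CARD('q) powi (- int n)"
    using padic_integer_approx by blast
  then have "N \<in> {..<CARD('q) ^ n}" "of_nat N \<in> padic_interval a (real CARD('q) powi (- int n))"
    by (simp_all add: padic_interval_def padic_abs_minus_commute)
  then show "J \<in> ?f ` {..<CARD('q) ^ n}"
    using padic_interval_recenter[of "of_nat N" a] J' by blast
next
  fix J assume "J \<in> ?f ` {..<CARD('q) ^ n}"
  then obtain N where J: "J = ?f N" by blast
  have r: "real CARD('q) powi (- int n) \<le> 1"
    using CARD_gt_1(1)[where 'q='q] by (simp add: powi_le_1_iff)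
  have N1: "padic_abs (of_nat N :: 'q padic) \<le> 1"
    using qadic_abs_of_int_le_1[OF prime_card[where 'a='q], of "int N"] by (simp add: padic_abs_of_nat)
  have "J \<subseteq> padic_integers"
  proof (intro subsetI)
    fix x assume "x \<in> J"
    then have "padic_abs (x - of_nat N) \<le> 1" using r by (simp add: J padic_interval_def)
    then show "x \<in> padic_integers"
      using N1 padic_abs_ultra[of "x - of_nat N" "of_nat N"]
      by (simp add: padic_integers_def)
  qed
  then show "J \<in> padic_partition (real CARD('q) powi (- int n))"
    unfolding J padic_partition_def padic_is_interval_def by (auto simp: padic_length_interval)
qed

definition padic_theta :: "'q::prime_card padic set \<Rightarrow> ('q padic \<times> 'q padic) set" where
  "padic_theta J = {(\<xi>, \<eta>). \<xi> \<in> J \<and> padic_abs (\<eta> - \<xi>\<^sup>2) \<le> (padic_length J)\<^sup>2}"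

text \<open>Haar measure on \<open>\<rat>\<^sub>q\<^sup>2\<close>, giving \<open>\<int>\<^sub>q\<^sup>2\<close> measure 1.\<close>

definition padic_haar2 :: "('q::prime_card padic \<times> 'q padic) measure" where
  "padic_haar2 = padic_haar \<Otimes>\<^sub>M padic_haar"

definition padic_schwartz :: "('q::prime_card padic \<times> 'q padic \<Rightarrow> complex) \<Rightarrow> bool" where
  "padic_schwartz f \<longleftrightarrow> (\<exists>n (c :: nat \<Rightarrow> complex) a b k. f = (\<lambda>x. \<Sum>i<n. c i *
     indicator (padic_interval (a i) (real CARD('q) powi k i) \<times> padic_interval (b i) (real CARD('q) powi k i)) x))"

definition padic_fourier ::
  "('q::prime_card padic \<times> 'q padic \<Rightarrow> complex) \<Rightarrow> 'q padic \<times> 'q padic \<Rightarrow> complex" where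
  "padic_fourier f \<xi> = (\<integral>x. f x * padic_char (- (fst x * fst \<xi> + snd x * snd \<xi>)) \<partial>padic_haar2)"

text \<open>
  The function \<open>f\<^sub>J\<close> is the Schwartz function whose Fourier transform is that of \<open>f\<close> cut off to
  \<open>J \<times> \<rat>\<^sub>q\<close>; the Fourier transform is a bijection on Schwartz functions.
\<close>

definition padic_freq_restrict :: "'q::prime_card padic set \<Rightarrow>
    ('q padic \<times> 'q padic \<Rightarrow> complex) \<Rightarrow> 'q padic \<times> 'q padic \<Rightarrow> complex" where
  "padic_freq_restrict J f = (THE g. padic_schwartz g \<and>
     padic_fourier g = (\<lambda>\<xi>. padic_fourier f \<xi> * indicator (J \<times> UNIV) \<xi>))"

text \<open>
  Real-valued; meant for functions in \<open>L\<^sup>p\<close>, such as Schwartz functions.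
\<close>

definition padic_Lp_norm :: "ereal \<Rightarrow> ('q::prime_card padic \<times> 'q padic \<Rightarrow> complex) \<Rightarrow> real" where
  "padic_Lp_norm p f =
     (if p = \<infinity> then real_of_ereal (esssup padic_haar2 (\<lambda>x. ereal (cmod (f x))))
      else (\<integral>x. cmod (f x) powr real_of_ereal p \<partial>padic_haar2) powr (1 / real_of_ereal p))"

text \<open>
  The infimum, taken in \<open>[0, \<infinity>]\<close>, is attained when the set is nonempty, since the right-hand
  side of the inequality is a finite multiple of \<open>D\<close>.  The partition is finite by
  \<open>padic_partition_eq\<close>, so the sum is an honest one for \<open>\<delta> = q\<^sup>-\<^sup>n\<close>.
\<close>

definition padic_decoupling_constant :: "'q::prime_card itself \<Rightarrow> ereal \<Rightarrow> real \<Rightarrow> ennreal" where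
  "padic_decoupling_constant _ p \<delta> = Inf {D. \<forall>f :: 'q padic \<times> 'q padic \<Rightarrow> complex.
     padic_schwartz f \<longrightarrow> {\<xi>. padic_fourier f \<xi> \<noteq> 0} \<subseteq> (\<Union>K\<in>padic_partition \<delta>. padic_theta K) \<longrightarrow>
     ennreal (padic_Lp_norm p f)
       \<le> D * ennreal (sqrt (\<Sum>K\<in>padic_partition \<delta>. (padic_Lp_norm p (padic_freq_restrict K f))\<^sup>2))}"

end

theory Submission
  imports Defs
begin

text \<open>
  Since \<open>f\<^sub>K\<close> has frequencies in \<open>\<theta>\<^sub>K\<close>, it is, up to a character, invariant under translations by the
  dual parallelogram; in particular \<open>|f\<^sub>K|\<close> is exactly locally constant. Only this property and the
  translation invariance of Haar measure enter the estimates.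

  The heart is \<open>p = 6\<close>. For arcs \<open>U, V\<close> at distance comparable to the length \<open>\<rho>\<close> of the arc containing
  both, the weight \<open>|f\<^sub>V|\<^sup>4\<close> in \<open>\<integral> |f\<^sub>U|\<^sup>2 |f\<^sub>V|\<^sup>4\<close> is constant on parallelograms so large that the pieces of
  \<open>f\<^sub>U\<close> of length \<open>|V|\<^sup>2 / \<rho>\<close> are orthogonal. The Cauchy-Schwarz inequality then bounds each piece \<open>W\<close> by
  \<open>\<integral> |f\<^sub>V|\<^sup>2 |f\<^sub>W|\<^sup>4\<close>, where \<open>W\<close> is shorter, and \<open>\<integral> |f\<^sub>V|\<^sup>6\<close>, which decouples over fewer scales. Each such step
  improves a hypothetical bound \<open>C q\<^sup>\<mu>\<^sup>n\<close> (\<open>\<delta> = q\<^sup>-\<^sup>n\<close>) by a fixed factor, and enough of them beat the constant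
  in the broad-narrow reduction of \<open>\<integral> |f|\<^sup>6\<close> to bilinear integrals, so that \<open>C q\<^sup>\<mu>\<^sup>n\<close> follows for every
  \<open>\<mu> > 0\<close> by induction on \<open>n\<close>.

  The exponents 2 (orthogonality) and \<open>\<infinity>\<close> (Cauchy-Schwarz) are elementary. For the others, each \<open>f\<^sub>K\<close> is
  truncated at a height proportional to \<open>\<parallel>f\<^sub>K\<parallel>\<^sub>p\<close>, as in Marcinkiewicz interpolation; local constancy of
  \<open>|f\<^sub>K|\<close> keeps the frequencies of the truncations in \<open>\<theta>\<^sub>K\<close>.
\<close>

text \<open>The Cauchy-Schwarz step closes because the savings are linear in the scale. For a loss
  of \<open>\<beta> ^ 2\<close> per scale, an arc of relative length \<open>q ^ (-b)\<close> saves
  \<open>\<beta> ^ (2 * b)\<close>, and the exchanged integral, with \<open>b\<close> doubled, saves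
  \<open>\<beta> ^ (t * 2 * b)\<close>; the square root of the product is
  \<open>\<beta> ^ ((t + 1) * b)\<close>. So \<open>t\<close> steps from \<open>b = 1\<close> save
  \<open>\<beta> ^ t\<close> and need \<open>2 ^ t\<close> scales. However close \<beta> is to 1,
  some number \<open>s\<close> of steps suffices, and the finitely many \<open>n < 2 ^ s\<close>
  only enlarge the constant.

  The obstacle to interpolation is that the bound at 6 is an l2 sum of norms, while integration over
  the truncation height needs an expression linear in the integrals of the sixth powers. Hoelder's
  inequality with the squared \<open>p\<close>-norms as weights makes it linear. Heights
  proportional to these norms are then the ones for which each arc contributes its weight times a
  common factor, so that the sum over the arcs returns the l2 norm.\<close>

abbreviation (input) padic_le :: "'q::prime_card padic \<Rightarrow> int \<Rightarrow> bool" where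
  "padic_le x m \<equiv> padic_abs x \<le> real CARD('q) powi m"

type_synonym 'q padic_fun = "'q padic \<times> 'q padic \<Rightarrow> complex"

section \<open>The additive character\<close>

lemma CARD_powi_pos [simp]: "0 < real CARD('q::prime_card) powi k"
  by (intro zero_less_power_int CARD_gt_1)

lemma CARD_powi_nonneg [simp]: "0 \<le> real CARD('q::prime_card) powi k"
  using CARD_powi_pos less_imp_le by blast

lemma CARD_powi_le_iff [simp]:
  "real CARD('q::prime_card) powi m \<le> real CARD('q) powi n \<longleftrightarrow> m \<le> n"
  by (rule powi_le_powi_iff[OF CARD_gt_1(1)])

lemma CARD_powi_add:
  "real CARD('q::prime_card) powi (m + n) = real CARD('q) powi m * real CARD('q) powi n"
  using CARD_gt_1(2)[where 'q='q] by (simp add: power_int_add)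

lemma padic_abs_mult_le:
  fixes x y :: "'q::prime_card padic"
  assumes "padic_le x m" "padic_le y n" "m + n \<le> l"
  shows "padic_le (x * y) l"
proof -
  have "padic_abs (x * y) \<le> real CARD('q) powi m * real CARD('q) powi n"
    unfolding padic_abs_mult using assms by (intro mult_mono) auto
  also have "\<dots> = real CARD('q) powi (m + n)" by (rule CARD_powi_add[symmetric])
  also have "\<dots> \<le> real CARD('q) powi l" using assms by simp
  finally show ?thesis .
qed

lemma padic_abs_add_le:
  fixes x y :: "'q::prime_card padic"
  assumes "padic_abs x \<le> r" "padic_abs y \<le> r"
  shows "padic_abs (x + y) \<le> r"
  using padic_abs_ultra[of x y] assms by simp

lemma padic_abs_diff_le:
  fixes x y :: "'q::prime_card padic"
  assumes "padic_abs x \<le> r" "padic_abs y \<le> r"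
  shows "padic_abs (x - y) \<le> r"
  using padic_abs_add_le[of x r "- y"] assms by simp

lemma padic_abs_of_int_le_1 [simp]: "padic_abs (of_int a :: 'q::prime_card padic) \<le> 1"
  unfolding padic_abs_of_int by (rule qadic_abs_of_int_le_1[OF prime_card])

lemma padic_abs_of_nat_le_1 [simp]: "padic_abs (of_nat a :: 'q::prime_card padic) \<le> 1"
  using padic_abs_of_int_le_1[of "int a"] by simp

lemma padic_abs_not_le:
  fixes x :: "'q::prime_card padic"
  assumes "\<not> padic_le x m"
  obtains k where "k > m" "padic_abs x = real CARD('q) powi k"
proof (cases x rule: padic_abs_cases)
  case 1
  then show ?thesis using assms by simp
next
  case (2 k)
  then show ?thesis using assms that[of k] by simp
qed

lemma padic_abs_eq_powi:
  fixes x :: "'q::prime_card padic"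
  assumes "padic_le x m" "\<not> padic_le x (m - 1)"
  shows "padic_abs x = real CARD('q) powi m"
proof -
  obtain k where k: "k > m - 1" "padic_abs x = real CARD('q) powi k"
    using padic_abs_not_le[OF assms(2)] .
  then have "k = m" using assms(1) by simp
  then show ?thesis using k by simp
qed

text \<open>The digit sum over negative places is a fraction with denominator a power of
  \<open>q\<close>, at distance at most 1 from \<open>x\<close>. From here on the character is
  computed with such fractions instead of digits.\<close>

lemma padic_char_fraction:
  fixes x :: "'q::prime_card padic"
  obtains N m where "N < CARD('q) ^ m"
    "padic_abs (x - of_rat (of_nat N / of_nat CARD('q) ^ m)) \<le> 1"
    "padic_char x = exp (2 * of_real pi * \<i> * (of_nat N / of_nat CARD('q) ^ m))"
proof -
  let ?q = "CARD('q)"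
  have q: "?q > 1" using prime_gt_1_nat[OF prime_card[where 'a='q]] .
  obtain k a where e: "padic_expansion x k a" using padic_expansion_exists by blast
  define m where "m = nat (- k)"
  define b where "b j = (if j \<ge> k then a j else 0)" for j
  have "b j < ?q" for j using e q by (auto simp: padic_expansion_def b_def)
  then obtain N
    where N: "N < ?q ^ m" "of_nat ?q ^ m * (\<Sum>j=- int m..-1. of_nat (b j) * of_nat ?q powi j) = (of_nat N :: rat)"
    using fractional_sum_integral[of ?q b m] q by blast
  let ?S = "\<Sum>j=k..-1. of_nat (a j) * of_nat ?q powi j :: rat"
  have "(\<Sum>j=- int m..-1. of_nat (b j) * of_nat ?q powi j) = ?S"
    by (intro sum.mono_neutral_cong_right) (auto simp: b_def m_def)
  then have S: "?S = of_nat N / of_nat ?q ^ m" using N(2) q by (simp add: field_simps)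
  have of_rat: "of_rat (of_nat ?q powi j) = (of_nat ?q powi j :: complex)" for j
    by (cases j rule: int_cases4) (simp_all add: power_int_minus of_rat_inverse of_rat_power)
  have "(\<Sum>j=k..-1. of_nat (a j) * of_nat ?q powi j :: complex) = of_rat ?S"
    by (simp add: of_rat_sum of_rat_mult of_rat)
  also have "\<dots> = of_nat N / of_nat ?q ^ m"
    unfolding S by (simp add: of_rat_divide of_rat_power)
  finally have "padic_char x = exp (2 * of_real pi * \<i> * (of_nat N / of_nat ?q ^ m))"
    unfolding padic_char_expansion[OF e] by simp
  moreover have "padic_abs (x - of_rat (of_nat N / of_nat ?q ^ m)) \<le> 1"
    using padic_expansion_fractional[OF e] unfolding S .
  ultimately show ?thesis using that N(1) by blast
qed

text \<open>Two fractions whose denominators are powers of \<open>q\<close> and whose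
  \<open>q\<close>-adic distance is at most 1 differ by an integer, since \<open>q ^ (l + m)\<close>
  divides the numerator of their difference. Hence any such fraction near \<open>x\<close> may
  replace the digit sum.\<close>

lemma padic_char_eq:
  fixes x :: "'q::prime_card padic"
  assumes "padic_abs (x - of_rat (of_int M / of_nat CARD('q) ^ m)) \<le> 1"
  shows "padic_char x = exp (2 * of_real pi * \<i> * (of_int M / of_nat CARD('q) ^ m))"
proof -
  let ?q = "CARD('q)"
  have q: "?q > 1" using prime_gt_1_nat[OF prime_card[where 'a='q]] .
  obtain N l where N: "padic_abs (x - of_rat (of_nat N / of_nat ?q ^ l)) \<le> 1"
    "padic_char x = exp (2 * of_real pi * \<i> * (of_nat N / of_nat ?q ^ l))"
    by (rule padic_char_fraction)
  let ?d = "of_nat N / of_nat ?q ^ l - of_int M / of_nat ?q ^ m :: rat"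
  let ?L = "int N * int ?q ^ m - M * int ?q ^ l"
  have "padic_abs (of_rat (of_nat N / of_nat ?q ^ l) - of_rat (of_int M / of_nat ?q ^ m) :: 'q padic) \<le> 1"
    by (rule padic_diff_le[OF _ assms]) (use N(1) in \<open>simp add: padic_abs_minus_commute\<close>)
  then have d: "qadic_abs ?q ?d \<le> 1" by (simp only: of_rat_diff[symmetric] padic_abs_of_rat)
  have frac: "of_nat N / of_nat ?q ^ l - of_int M / of_nat ?q ^ m = (of_int ?L / of_nat ?q ^ (l + m) :: 'a::field_char_0)"
    using q by (simp add: diff_frac_eq power_add)
  have dL: "of_int ?L = of_nat ?q ^ (l + m) * ?d" using q unfolding frac by simp
  have "qadic_abs ?q (of_nat ?q ^ (l + m)) \<le> real ?q powi (- int (l + m))"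
    using qadic_abs_of_int_le[OF prime_card[where 'a='q], of "int ?q ^ (l + m)" "l + m"] by simp
  then have "qadic_abs ?q (of_int ?L) \<le> real ?q powi (- int (l + m))"
    unfolding dL using d
      mult_mono[of "qadic_abs ?q (of_nat ?q ^ (l + m))" "real ?q powi (- int (l + m))" "qadic_abs ?q ?d" 1]
    by (simp only: qadic_abs_mult[OF prime_card]) (simp add: zero_le_power_int)
  then have "int ?q ^ (l + m) dvd ?L" by (simp only: qadic_abs_of_int_le[OF prime_card])
  then obtain j where j: "?L = int ?q ^ (l + m) * j" by (elim dvdE)
  have "(of_int ?L :: complex) = of_nat ?q ^ (l + m) * of_int j" unfolding j by simp
  then have "(of_nat N / of_nat ?q ^ l - of_int M / of_nat ?q ^ m :: complex) = of_int j"
    unfolding frac using q by simp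
  then have "(of_nat N / of_nat ?q ^ l :: complex) = of_int M / of_nat ?q ^ m + of_int j"
    by (simp add: algebra_simps)
  then show ?thesis unfolding N(2) by (simp add: algebra_simps exp_add exp_integer_2pi)
qed

lemma padic_char_add: "padic_char (x + y) = padic_char x * padic_char (y :: 'q::prime_card padic)"
proof -
  let ?q = "CARD('q)"
  have q: "?q > 1" using prime_gt_1_nat[OF prime_card[where 'a='q]] .
  obtain N l where N: "padic_abs (x - of_rat (of_nat N / of_nat ?q ^ l)) \<le> 1"
    "padic_char x = exp (2 * of_real pi * \<i> * (of_nat N / of_nat ?q ^ l))"
    by (rule padic_char_fraction)
  obtain M m where M: "padic_abs (y - of_rat (of_nat M / of_nat ?q ^ m)) \<le> 1"
    "padic_char y = exp (2 * of_real pi * \<i> * (of_nat M / of_nat ?q ^ m))"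
    by (rule padic_char_fraction)
  let ?L = "int N * int ?q ^ m + int M * int ?q ^ l"
  have eq: "of_int ?L / of_nat ?q ^ (l + m) = of_nat N / of_nat ?q ^ l + (of_nat M / of_nat ?q ^ m :: 'a::field_char_0)"
    using q by (simp add: add_frac_eq power_add)
  have "x + y - of_rat (of_int ?L / of_nat ?q ^ (l + m))
      = (x - of_rat (of_nat N / of_nat ?q ^ l)) + (y - of_rat (of_nat M / of_nat ?q ^ m))"
    unfolding eq of_rat_add by simp
  then have "padic_abs (x + y - of_rat (of_int ?L / of_nat ?q ^ (l + m))) \<le> 1"
    using padic_abs_add_le[OF N(1) M(1)] by (simp only:)
  from padic_char_eq[OF this] show ?thesis
    unfolding eq N(2) M(2) by (simp add: algebra_simps exp_add)
qed

lemma padic_char_integer: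
  assumes "padic_abs x \<le> 1" shows "padic_char (x :: 'q::prime_card padic) = 1"
  using padic_char_eq[of x 0 0] assms by simp

lemma padic_char_0 [simp]: "padic_char (0 :: 'q::prime_card padic) = 1"
  by (rule padic_char_integer) simp

lemma padic_char_minus: "padic_char (- x :: 'q::prime_card padic) = inverse (padic_char x)"
proof -
  have "padic_char x * padic_char (- x) = 1" using padic_char_add[of x "- x"] by simp
  then show ?thesis by (metis inverse_unique)
qed

lemma padic_char_diff: "padic_char (x - y :: 'q::prime_card padic) = padic_char x / padic_char y"
  using padic_char_add[of x "- y"] by (simp add: padic_char_minus divide_inverse)

lemma cmod_padic_char [simp]: "cmod (padic_char (x :: 'q::prime_card padic)) = 1"
proof -
  obtain N m where "padic_char x = exp (2 * of_real pi * \<i> * (of_nat N / of_nat CARD('q) ^ m))"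
    by (rule padic_char_fraction)
  moreover have "2 * of_real pi * \<i> * (of_nat N / of_nat CARD('q) ^ m)
      = \<i> * of_real (2 * pi * (real N / real CARD('q) ^ m))" by simp
  ultimately show ?thesis by (simp only: norm_exp_i_times)
qed

lemma padic_char_nonzero [simp]: "padic_char (x :: 'q::prime_card padic) \<noteq> 0"
  using cmod_padic_char[of x] by (metis norm_zero zero_neq_one)

lemma cnj_padic_char: "cnj (padic_char (x :: 'q::prime_card padic)) = padic_char (- x)"
proof -
  have "padic_char x * cnj (padic_char x) = 1"
    using complex_norm_square[of "padic_char x"] by simp
  then show ?thesis unfolding padic_char_minus by (metis inverse_unique)
qed

text \<open>The representing fraction \<open>N / q ^ m\<close> lies in \<open>[0, 1)\<close>, so its
  exponential is 1 only for \<open>N = 0\<close>. This nontriviality outside the integers is the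
  source of all orthogonality.\<close>

lemma padic_char_eq_1_iff: "padic_char (x :: 'q::prime_card padic) = 1 \<longleftrightarrow> padic_abs x \<le> 1"
proof
  let ?q = "CARD('q)"
  have q: "?q > 1" using prime_gt_1_nat[OF prime_card[where 'a='q]] .
  assume 1: "padic_char x = 1"
  obtain N m where N: "N < ?q ^ m" "padic_abs (x - of_rat (of_nat N / of_nat ?q ^ m)) \<le> 1"
    "padic_char x = exp (2 * of_real pi * \<i> * (of_nat N / of_nat ?q ^ m))"
    by (rule padic_char_fraction)
  have "exp (2 * of_real pi * \<i> * (of_nat N / of_nat ?q ^ m)) = 1" using 1 N(3) by simp
  then obtain j :: int where "Im (2 * of_real pi * \<i> * (of_nat N / of_nat ?q ^ m)) = of_int (2 * j) * pi"
    unfolding exp_eq_1 by blast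
  moreover have "Im (2 * of_real pi * \<i> * (of_nat N / of_nat ?q ^ m)) = 2 * pi * (real N / real ?q ^ m)"
  proof -
    have "2 * of_real pi * \<i> * (of_nat N / of_nat ?q ^ m) = \<i> * of_real (2 * pi * (real N / real ?q ^ m))"
      by simp
    then show ?thesis by (simp only: Im_i_times Re_complex_of_real)
  qed
  ultimately have "2 * pi * (real N / real ?q ^ m) = 2 * pi * of_int j"
    by (simp only: of_int_mult of_int_numeral mult_ac)
  then have j: "real N / real ?q ^ m = of_int j" by (simp only: mult_cancel_left) simp
  have "real N < real ?q ^ m" using N(1) by (metis of_nat_less_iff of_nat_power)
  then have "real N / real ?q ^ m < 1" "real N / real ?q ^ m \<ge> 0" using q by simp_all
  then have "j = 0" unfolding j by simp
  then have "N = 0" using j q by simp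
  then show "padic_abs x \<le> 1" using N(2) by simp
qed (rule padic_char_integer)

lemma padic_char_power: "padic_char (of_nat n * x :: 'q::prime_card padic) = padic_char x ^ n"
  by (induction n) (simp_all add: padic_char_add distrib_right)

text \<open>\<open>padic_char z\<close> is an \<open>M\<close>-th root of unity. The finite
  geometric sum does the work of an integral of the character, both in the injectivity of the
  Fourier transform and in the frequency cutoff.\<close>

lemma padic_char_sum:
  fixes z :: "'q::prime_card padic"
  assumes "padic_abs (of_nat M * z) \<le> 1"
  shows "(\<Sum>n<M. padic_char (of_nat n * z)) = (if padic_abs z \<le> 1 then of_nat M else 0)"
proof (cases "padic_abs z \<le> 1")
  case True
  then show ?thesis by (simp add: padic_char_power padic_char_integer)
next
  case False
  then have "padic_char z \<noteq> 1" by (simp add: padic_char_eq_1_iff)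
  then have "(\<Sum>n<M. padic_char z ^ n) = (padic_char z ^ M - 1) / (padic_char z - 1)"
    by (rule geometric_sum)
  also have "padic_char z ^ M = 1"
    using padic_char_integer[OF assms] by (simp add: padic_char_power)
  finally show ?thesis using False by (simp add: padic_char_power)
qed

section \<open>Integration on the plane\<close>

lemma sets_padic_haar [measurable_cong, simp]: "sets (padic_haar :: 'q::prime_card padic measure) = sets borel"
  using padic_haar[where 'a='q] by (simp add: padic_is_haar_def)

lemma space_padic_haar [simp]: "space (padic_haar :: 'q::prime_card padic measure) = UNIV"
  using sets_eq_imp_space_eq[OF sets_padic_haar] by simp

lemma padic_interval_measurable [measurable, simp]:
  "0 < r \<Longrightarrow> padic_interval (a :: 'q::prime_card padic) r \<in> sets borel"
  by (intro borel_open open_padic_interval)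

text \<open>The known measure formula concerns lengths at most 1. A longer interval is covered by
  \<open>q ^ n\<close> unit intervals, whose length is written \<open>powi (- int 0)\<close> to fit
  that formula.\<close>

lemma emeasure_padic_interval_finite:
  "emeasure padic_haar (padic_interval (a :: 'q::prime_card padic) (real CARD('q) powi k)) < \<infinity>"
proof -
  let ?q = "of_nat CARD('q) :: 'q padic"
  define n where "n = nat k"
  have q: "?q \<noteq> 0" using prime_gt_0_nat[OF prime_card[where 'a='q]] by simp
  have "padic_interval a (real CARD('q) powi k)
      \<subseteq> (\<Union>N<CARD('q) ^ n. padic_interval (a + of_nat N * ?q powi (- int n)) (real CARD('q) powi (- int 0)))"
  proof
    fix x assume "x \<in> padic_interval a (real CARD('q) powi k)"
    moreover have "real CARD('q) powi k \<le> real CARD('q) powi int n" unfolding CARD_powi_le_iff n_def by simp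
    ultimately have x: "padic_le (x - a) (int n)" by (simp add: padic_interval_def)
    have "padic_le ((x - a) * ?q powi int n) 0"
      by (rule padic_abs_mult_le[OF x, of _ "- int n"]) (simp_all only: padic_abs_q_powi)
    then have "padic_abs ((x - a) * ?q powi int n) \<le> 1" by simp
    then obtain N where N: "N < CARD('q) ^ n"
      "padic_le ((x - a) * ?q powi int n - of_nat N) (- int n)"
      using padic_integer_approx by blast
    have "x - (a + of_nat N * ?q powi (- int n)) = ((x - a) * ?q powi int n - of_nat N) * ?q powi (- int n)"
      using q by (simp add: algebra_simps power_int_minus)
    moreover have "padic_le (((x - a) * ?q powi int n - of_nat N) * ?q powi (- int n)) (- int 0)"
      by (rule padic_abs_mult_le[OF N(2), of _ "int n"]) (simp_all only: padic_abs_q_powi, simp_all)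
    ultimately show "x \<in> (\<Union>N<CARD('q) ^ n. padic_interval (a + of_nat N * ?q powi (- int n)) (real CARD('q) powi (- int 0)))"
      using N(1) unfolding padic_interval_def by (intro UN_I[of N]) (simp_all only: lessThan_iff mem_Collect_eq)
  qed
  then have "emeasure padic_haar (padic_interval a (real CARD('q) powi k)) \<le>
      emeasure padic_haar (\<Union>N<CARD('q) ^ n. padic_interval (a + of_nat N * ?q powi (- int n)) (real CARD('q) powi (- int 0)))"
    by (intro emeasure_mono) auto
  also have "\<dots> \<le> (\<Sum>N<CARD('q) ^ n. emeasure padic_haar
      (padic_interval (a + of_nat N * ?q powi (- int n)) (real CARD('q) powi (- int 0))))"
    by (intro emeasure_subadditive_finite) auto
  also have "\<dots> < \<infinity>"
    unfolding emeasure_padic_haar_small[OF padic_haar] by (simp add: of_nat_less_top ennreal_mult_less_top power_less_top_ennreal)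
  finally show ?thesis .
qed

lemma sigma_finite_padic_haar: "sigma_finite_measure (padic_haar :: 'q::prime_card padic measure)"
proof
  let ?A = "range (\<lambda>c. padic_interval (of_rat c :: 'q padic) (real CARD('q) powi 0))"
  have "\<Union> ?A = UNIV"
  proof (intro UNIV_eq_I[symmetric])
    fix x :: "'q padic"
    obtain c where "padic_abs (x - of_rat c) \<le> 1" using padic_approx_rat[of 1 x] by auto
    then show "x \<in> \<Union> ?A" by (auto simp: padic_interval_def)
  qed
  then show "\<exists>A. countable A \<and> A \<subseteq> sets (padic_haar :: 'q padic measure) \<and> \<Union> A = space padic_haar
      \<and> (\<forall>a\<in>A. emeasure padic_haar a \<noteq> \<infinity>)"
    using emeasure_padic_interval_finite[where 'q='q] less_irrefl
    by (intro exI[of _ ?A]) (auto simp: less_top[symmetric] simp del: power_int_0_right)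
qed

interpretation padic_haar: sigma_finite_measure "padic_haar :: 'q::prime_card padic measure"
  by (rule sigma_finite_padic_haar)

interpretation padic_haar_pair: pair_sigma_finite "padic_haar :: 'q::prime_card padic measure"
  "padic_haar :: 'q::prime_card padic measure" ..

interpretation padic_haar2: sigma_finite_measure "padic_haar2 :: ('q::prime_card padic \<times> 'q padic) measure"
  unfolding padic_haar2_def by (rule padic_haar_pair.sigma_finite_measure_axioms)

lemma space_padic_haar2 [simp]: "space (padic_haar2 :: ('q::prime_card padic \<times> 'q padic) measure) = UNIV"
  by (simp add: padic_haar2_def space_pair_measure)

lemma sets_padic_haar2 [measurable_cong]:
  "sets (padic_haar2 :: ('q::prime_card padic \<times> 'q padic) measure) = sets (borel \<Otimes>\<^sub>M borel)"
  unfolding padic_haar2_def by (intro sets_pair_measure_cong) simp_all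

lemma distr_padic_haar_translate:
  "distr padic_haar padic_haar (\<lambda>x. s + x) = (padic_haar :: 'q::prime_card padic measure)"
proof -
  have "distr padic_haar padic_haar (\<lambda>x. s + x) = distr padic_haar borel (\<lambda>x :: 'q padic. s + x)"
    by (intro distr_cong) simp_all
  then show ?thesis using padic_haar[where 'a='q] by (simp add: padic_is_haar_def)
qed

lemma padic_translate2_measurable [measurable]:
  "(\<lambda>x. (fst x + s, snd x + t)) \<in> measurable padic_haar2 (padic_haar2 :: ('q::prime_card padic \<times> 'q padic) measure)"
proof -
  have [measurable]: "(\<lambda>x. x + s) \<in> measurable borel (borel :: 'q padic measure)" for s
    using padic_translate_measurable[of s] by (simp add: add.commute)
  show ?thesis by measurable
qed

lemma distr_padic_haar2_translate:
  "distr padic_haar2 padic_haar2 (\<lambda>x. (fst x + s, snd x + t)) = (padic_haar2 :: ('q::prime_card padic \<times> 'q padic) measure)"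
proof -
  have m: "(\<lambda>x. s + x) \<in> measurable padic_haar (padic_haar :: 'q padic measure)" for s
    using padic_translate_measurable[of s]
      measurable_cong_sets[OF sets_padic_haar sets_padic_haar] by blast
  have sf: "sigma_finite_measure (distr padic_haar padic_haar (\<lambda>x. t + x :: 'q padic))"
    unfolding distr_padic_haar_translate by (rule sigma_finite_padic_haar)
  have "padic_haar2 = distr padic_haar padic_haar (\<lambda>x. s + x) \<Otimes>\<^sub>M distr padic_haar padic_haar (\<lambda>x. t + x :: 'q padic)"
    unfolding distr_padic_haar_translate padic_haar2_def ..
  also have "\<dots> = distr padic_haar2 padic_haar2 (\<lambda>(x, y). (s + x, t + y))"
    unfolding padic_haar2_def by (rule pair_measure_distr[OF m m sf])
  also have "\<dots> = distr padic_haar2 padic_haar2 (\<lambda>x. (fst x + s, snd x + t))"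
    by (intro distr_cong) (auto simp: add.commute)
  finally show ?thesis ..
qed

lemma integral_padic_translate:
  fixes f :: "'q::prime_card padic \<times> 'q padic \<Rightarrow> 'b::{banach, second_countable_topology}"
  assumes "f \<in> borel_measurable padic_haar2"
  shows "(\<integral>x. f (fst x + s, snd x + t) \<partial>padic_haar2) = (\<integral>x. f x \<partial>padic_haar2)"
  using integral_distr[OF padic_translate2_measurable assms, of s t]
  unfolding distr_padic_haar2_translate by simp

subsection \<open>Bounded functions supported on sets of finite measure\<close>

text \<open>Integrability in the estimates is drawn from this class, which contains the Schwartz
  functions and is stable under sums, products, powers of the norm and truncations.\<close>

definition bounded_finsupp :: "'a measure \<Rightarrow> ('a \<Rightarrow> 'b::real_normed_vector) \<Rightarrow> bool" where
  "bounded_finsupp M f \<longleftrightarrow> f \<in> borel_measurable M \<and> (\<exists>B. \<forall>x. norm (f x) \<le> B)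
     \<and> (\<exists>S\<in>sets M. emeasure M S < \<infinity> \<and> (\<forall>x. x \<notin> S \<longrightarrow> f x = 0))"

lemma bounded_finsupp_measurable [measurable_dest]: "bounded_finsupp M f \<Longrightarrow> f \<in> borel_measurable M"
  by (simp add: bounded_finsupp_def)

lemma bounded_finsupp_integrable:
  fixes f :: "'a \<Rightarrow> 'b::{banach, second_countable_topology}"
  assumes "bounded_finsupp M f" shows "integrable M f"
proof -
  obtain B S where f: "f \<in> borel_measurable M" "\<And>x. norm (f x) \<le> B" "S \<in> sets M" "emeasure M S < \<infinity>"
    "\<And>x. x \<notin> S \<Longrightarrow> f x = 0"
    using assms by (auto simp: bounded_finsupp_def)
  show ?thesis by (rule integrableI_bounded_set[OF f(3,1,4)]) (use f in auto)
qed

lemma bounded_finsupp_zero [simp]: "bounded_finsupp M (\<lambda>_. 0)"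
  by (auto simp: bounded_finsupp_def intro!: bexI[of _ "{}"])

lemma bounded_finsupp_add:
  fixes f g :: "'a \<Rightarrow> 'b::{real_normed_vector, second_countable_topology}"
  assumes f: "bounded_finsupp M f" and g: "bounded_finsupp M g" shows "bounded_finsupp M (\<lambda>x. f x + g x)"
proof -
  obtain B S where f': "f \<in> borel_measurable M" "\<And>x. norm (f x) \<le> B" "S \<in> sets M" "emeasure M S < \<infinity>"
    "\<And>x. x \<notin> S \<Longrightarrow> f x = 0" using f by (auto simp: bounded_finsupp_def)
  obtain C T where g': "g \<in> borel_measurable M" "\<And>x. norm (g x) \<le> C" "T \<in> sets M" "emeasure M T < \<infinity>"
    "\<And>x. x \<notin> T \<Longrightarrow> g x = 0" using g by (auto simp: bounded_finsupp_def)
  have "norm (f x + g x) \<le> B + C" for x by (rule norm_triangle_mono[OF f'(2) g'(2)])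
  moreover have "emeasure M (S \<union> T) < \<infinity>"
    using emeasure_subadditive[OF f'(3) g'(3)] f'(4) g'(4)
    by (metis ennreal_add_less_top infinity_ennreal_def order_le_less_trans)
  ultimately show ?thesis using f' g' unfolding bounded_finsupp_def
    by (intro conjI exI[of _ "B + C"] bexI[of _ "S \<union> T"]) auto
qed

lemma bounded_finsupp_sum:
  fixes f :: "'i \<Rightarrow> 'a \<Rightarrow> 'b::{real_normed_vector, second_countable_topology}"
  assumes "\<And>i. i \<in> I \<Longrightarrow> bounded_finsupp M (f i)" shows "bounded_finsupp M (\<lambda>x. \<Sum>i\<in>I. f i x)"
  using assms by (induction I rule: infinite_finite_induct) (auto intro: bounded_finsupp_add)

lemma bounded_finsupp_mult:
  fixes f g :: "'a \<Rightarrow> 'b::{real_normed_algebra, second_countable_topology}"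
  assumes f: "bounded_finsupp M f" and g: "g \<in> borel_measurable M" "\<And>x. norm (g x) \<le> C"
  shows "bounded_finsupp M (\<lambda>x. f x * g x)"
proof -
  obtain B S where f': "f \<in> borel_measurable M" "\<And>x. norm (f x) \<le> B" "S \<in> sets M" "emeasure M S < \<infinity>"
    "\<And>x. x \<notin> S \<Longrightarrow> f x = 0" using f by (auto simp: bounded_finsupp_def)
  have "norm (f x * g x) \<le> B * C" for x
  proof -
    have "norm (f x * g x) \<le> norm (f x) * norm (g x)" by (rule norm_mult_ineq)
    also have "\<dots> \<le> B * C" by (intro mult_mono f'(2) g(2) order_trans[OF norm_ge_zero f'(2)] norm_ge_zero)
    finally show ?thesis .
  qed
  then show ?thesis using f' g unfolding bounded_finsupp_def
    by (intro conjI exI[of _ "B * C"] bexI[of _ S]) auto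
qed

lemma bounded_finsupp_times:
  fixes f g :: "'a \<Rightarrow> 'b::{real_normed_algebra, second_countable_topology}"
  assumes f: "bounded_finsupp M f" and g: "bounded_finsupp M g"
  shows "bounded_finsupp M (\<lambda>x. f x * g x)"
proof -
  obtain B where "\<And>x. norm (g x) \<le> B" using g by (auto simp: bounded_finsupp_def)
  then show ?thesis using bounded_finsupp_mult[OF f] g by (auto simp: bounded_finsupp_def)
qed

lemma bounded_finsupp_norm_powr:
  fixes f :: "'a \<Rightarrow> 'b::{real_normed_vector, second_countable_topology}"
  assumes f: "bounded_finsupp M f" and p: "0 \<le> p" shows "bounded_finsupp M (\<lambda>x. norm (f x) powr p)"
proof -
  obtain B S where f': "f \<in> borel_measurable M" "\<And>x. norm (f x) \<le> B" "S \<in> sets M" "emeasure M S < \<infinity>"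
    "\<And>x. x \<notin> S \<Longrightarrow> f x = 0" using f by (auto simp: bounded_finsupp_def)
  have "norm (norm (f x) powr p) \<le> B powr p" for x
    using powr_mono2[OF p norm_ge_zero f'(2)] by simp
  then show ?thesis using f' unfolding bounded_finsupp_def
    by (intro conjI exI[of _ "B powr p"] bexI[of _ S]) auto
qed

lemma bounded_finsupp_norm_power:
  fixes f :: "'a \<Rightarrow> 'b::{real_normed_vector, second_countable_topology}"
  assumes f: "bounded_finsupp M f" and n: "0 < n" shows "bounded_finsupp M (\<lambda>x. norm (f x) ^ n)"
proof -
  have "(\<lambda>x. norm (f x) ^ n) = (\<lambda>x. norm (f x) powr real n)"
    using n by (intro ext) (auto simp: powr_realpow')
  then show ?thesis using bounded_finsupp_norm_powr[OF f, of "real n"] by simp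
qed

section \<open>Schwartz functions and the Fourier transform\<close>

text \<open>Local constancy: moving \<open>x\<close> by less than
  \<open>1 / (padic_abs c + 1)\<close> changes \<open>c * x\<close> by an integer. The summand 1
  covers \<open>c = 0\<close>.\<close>

lemma padic_char_measurable [measurable]:
  "(\<lambda>x. padic_char (c * x)) \<in> borel_measurable (borel :: 'q::prime_card padic measure)"
proof (rule borel_measurable_continuous_onI)
  have "\<exists>d>0. \<forall>y. dist y x < d \<longrightarrow> padic_char (c * y) = padic_char (c * x)" for x :: "'q padic"
  proof (intro exI conjI allI impI)
    show "0 < 1 / (padic_abs c + 1)" by (simp add: add_nonneg_pos)
    fix y assume "dist y x < 1 / (padic_abs c + 1)"
    then have "padic_abs (y - x) * (padic_abs c + 1) \<le> 1"
      by (simp add: dist_padic_def pos_less_divide_eq add_nonneg_pos)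
    moreover have "padic_abs (c * (y - x)) \<le> padic_abs (y - x) * (padic_abs c + 1)"
      by (simp only: padic_abs_mult) (simp add: algebra_simps)
    ultimately have "padic_char (c * (y - x)) = 1" by (intro padic_char_integer) simp
    then show "padic_char (c * y) = padic_char (c * x)"
      using padic_char_add[of "c * (y - x)" "c * x"] by (simp add: algebra_simps)
  qed
  then show "continuous_on UNIV (\<lambda>x. padic_char (c * x))"
    unfolding continuous_on_iff by (metis dist_self UNIV_I)
qed

lemma padic_char_dot_measurable [measurable]:
  "(\<lambda>x. padic_char (- (fst x * a + snd x * b))) \<in> borel_measurable (padic_haar2 :: ('q::prime_card padic \<times> 'q padic) measure)"
proof -
  have "(\<lambda>x. padic_char (- (fst x * a + snd x * b))) = (\<lambda>x. padic_char (- a * fst x) * padic_char (- b * snd x))"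
    by (simp add: padic_char_add[symmetric] algebra_simps)
  moreover have "(\<lambda>x. padic_char (- a * fst x) * padic_char (- b * snd x)) \<in> borel_measurable padic_haar2"
    by measurable
  ultimately show ?thesis by (simp only:)
qed

subsection \<open>Schwartz functions\<close>

lemma padic_schwartz_term:
  "padic_schwartz (\<lambda>x :: 'q::prime_card padic \<times> 'q padic. c * indicator (padic_interval a (real CARD('q) powi k)
      \<times> padic_interval b (real CARD('q) powi k)) x)"
  unfolding padic_schwartz_def
  by (intro exI[of _ "Suc 0"] exI[of _ "\<lambda>_. c"] exI[of _ "\<lambda>_. a"] exI[of _ "\<lambda>_. b"] exI[of _ "\<lambda>_. k"]) simp

lemma padic_schwartz_zero: "padic_schwartz (\<lambda>x :: 'q::prime_card padic \<times> 'q padic. 0)"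
  using padic_schwartz_term[of 0] by simp

lemma padic_schwartz_add:
  fixes f g :: "'q::prime_card padic_fun"
  assumes "padic_schwartz f" "padic_schwartz g" shows "padic_schwartz (\<lambda>x. f x + g x)"
proof -
  let ?R = "\<lambda>a b k x. indicator (padic_interval a (real CARD('q) powi k)
     \<times> padic_interval b (real CARD('q) powi k)) x :: complex"
  obtain m and c :: "nat \<Rightarrow> complex" and a b k where f: "f = (\<lambda>x. \<Sum>i<m. c i * ?R (a i) (b i) (k i) x)"
    using assms(1) unfolding padic_schwartz_def by blast
  obtain n and c' :: "nat \<Rightarrow> complex" and a' b' k' where g: "g = (\<lambda>x. \<Sum>i<n. c' i * ?R (a' i) (b' i) (k' i) x)"
    using assms(2) unfolding padic_schwartz_def by blast
  let ?j = "\<lambda>u v i. if i < m then u i else v (i - m)"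
  have split: "(\<Sum>i<m + n. h i) = (\<Sum>i<m. h i) + (\<Sum>i<n. h (i + m))" for h :: "nat \<Rightarrow> complex"
    by (induction n) (simp_all add: add_ac)
  have "(\<lambda>x. f x + g x) = (\<lambda>x. \<Sum>i<m + n. ?j c c' i * ?R (?j a a' i) (?j b b' i) (?j k k' i) x)"
    unfolding f g split by simp
  then show ?thesis unfolding padic_schwartz_def
    by (intro exI[of _ "m + n"] exI[of _ "?j c c'"] exI[of _ "?j a a'"] exI[of _ "?j b b'"] exI[of _ "?j k k'"])
qed

lemma padic_schwartz_sum:
  fixes f :: "'i \<Rightarrow> 'q::prime_card padic_fun"
  assumes "\<And>i. i \<in> I \<Longrightarrow> padic_schwartz (f i)" shows "padic_schwartz (\<lambda>x. \<Sum>i\<in>I. f i x)"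
  using assms
  by (induction I rule: infinite_finite_induct) (auto intro: padic_schwartz_add padic_schwartz_zero)

lemma padic_schwartz_induct [consumes 1, case_names zero add box]:
  fixes f :: "'q::prime_card padic_fun"
  assumes "padic_schwartz f" and "P (\<lambda>_. 0)"
    and "\<And>f g. padic_schwartz f \<Longrightarrow> padic_schwartz g \<Longrightarrow> P f \<Longrightarrow> P g \<Longrightarrow> P (\<lambda>x. f x + g x)"
    and "\<And>c a b k. P (\<lambda>x. c * indicator (padic_interval a (real CARD('q) powi k)
      \<times> padic_interval b (real CARD('q) powi k)) x)"
  shows "P f"
proof -
  let ?R = "\<lambda>a b k x. indicator (padic_interval a (real CARD('q) powi k)
     \<times> padic_interval b (real CARD('q) powi k)) x :: complex"
  obtain n and c :: "nat \<Rightarrow> complex" and a b k where f: "f = (\<lambda>x. \<Sum>i<n. c i * ?R (a i) (b i) (k i) x)"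
    using assms(1) unfolding padic_schwartz_def by blast
  have "P (\<lambda>x. \<Sum>i<n. c i * ?R (a i) (b i) (k i) x)"
  proof (induction n)
    case 0
    then show ?case using assms(2) by simp
  next
    case (Suc n)
    then show ?case unfolding sum.lessThan_Suc
      by (intro assms(3,4) padic_schwartz_sum padic_schwartz_term)
  qed
  then show ?thesis by (simp only: f)
qed

lemma padic_schwartz_cmult:
  fixes f :: "'q::prime_card padic_fun"
  assumes "padic_schwartz f" shows "padic_schwartz (\<lambda>x. c * f x)"
  using assms
proof (induction rule: padic_schwartz_induct)
  case (add f g)
  then show ?case using padic_schwartz_add[OF add.IH] by (simp add: distrib_left)
next
  case (box d a b k)
  then show ?case using padic_schwartz_term[of "c * d" a k b] by (simp add: mult.assoc)
qed (simp add: padic_schwartz_zero)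

lemma padic_schwartz_diff:
  fixes f g :: "'q::prime_card padic_fun"
  assumes "padic_schwartz f" "padic_schwartz g" shows "padic_schwartz (\<lambda>x. f x - g x)"
  using padic_schwartz_add[OF assms(1) padic_schwartz_cmult[OF assms(2), of "- 1"]] by simp

lemma padic_schwartz_translate:
  fixes f :: "'q::prime_card padic_fun"
  assumes "padic_schwartz f" shows "padic_schwartz (\<lambda>x. f (fst x + s, snd x + t))"
  using assms
proof (induction rule: padic_schwartz_induct)
  case (box c a b k)
  have "(\<lambda>x. c * indicator (padic_interval a (real CARD('q) powi k) \<times> padic_interval b (real CARD('q) powi k))
          (fst x + s, snd x + t))
      = (\<lambda>x. c * indicator (padic_interval (a - s) (real CARD('q) powi k)
          \<times> padic_interval (b - t) (real CARD('q) powi k)) x)"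
    by (auto simp: padic_interval_def indicator_def algebra_simps fun_eq_iff)
  then show ?case using padic_schwartz_term[of c "a - s" k "b - t"] by simp
qed (simp_all add: padic_schwartz_zero padic_schwartz_add)

lemma padic_schwartz_bounded_finsupp:
  fixes f :: "'q::prime_card padic_fun"
  assumes "padic_schwartz f" shows "bounded_finsupp padic_haar2 f"
  using assms
proof (induction rule: padic_schwartz_induct)
  case (box c a b k)
  let ?I = "padic_interval a (real CARD('q) powi k)" and ?J = "padic_interval b (real CARD('q) powi k)"
  have S: "?I \<times> ?J \<in> sets padic_haar2" unfolding padic_haar2_def by (intro pair_measureI) simp_all
  have "emeasure padic_haar2 (?I \<times> ?J) = emeasure padic_haar ?I * emeasure padic_haar ?J"
    unfolding padic_haar2_def by (intro padic_haar.emeasure_pair_measure_Times) simp_all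
  also have "\<dots> < \<infinity>"
    using emeasure_padic_interval_finite[of a k] emeasure_padic_interval_finite[of b k]
    by (simp add: ennreal_mult_less_top)
  finally have *: "emeasure padic_haar2 (?I \<times> ?J) < \<infinity>" .
  have "(\<lambda>x. c * indicator (?I \<times> ?J) x) \<in> borel_measurable padic_haar2" using S by measurable
  then show ?case unfolding bounded_finsupp_def using S *
    by (intro conjI exI[of _ "cmod c"] bexI[of _ "?I \<times> ?J"]) (auto simp: indicator_def)
qed (simp_all add: bounded_finsupp_add)

lemma padic_schwartz_locally_constant:
  fixes f :: "'q::prime_card padic_fun"
  assumes "padic_schwartz f"
  shows "\<exists>m::nat. \<forall>x s t. padic_le s (- int m) \<longrightarrow>
    padic_le t (- int m) \<longrightarrow> f (fst x + s, snd x + t) = f x"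
  using assms
proof (induction rule: padic_schwartz_induct)
  case (add f g)
  then obtain m n :: nat where
    m: "\<forall>x s t. padic_le s (- int m) \<longrightarrow>
    padic_le t (- int m) \<longrightarrow> f (fst x + s, snd x + t) = f x" and
    n: "\<forall>x s t. padic_le s (- int n) \<longrightarrow>
    padic_le t (- int n) \<longrightarrow> g (fst x + s, snd x + t) = g x" by blast
  have "real CARD('q) powi (- int (max m n)) \<le> real CARD('q) powi (- int m)"
    "real CARD('q) powi (- int (max m n)) \<le> real CARD('q) powi (- int n)"
    unfolding CARD_powi_le_iff by simp_all
  then have le: "r \<le> real CARD('q) powi (- int (max m n)) \<Longrightarrow> r \<le> real CARD('q) powi (- int m)"
    "r \<le> real CARD('q) powi (- int (max m n)) \<Longrightarrow> r \<le> real CARD('q) powi (- int n)" for r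
    by - (erule order_trans, assumption)+
  show ?case using m n by (intro exI[of _ "max m n"] allI impI) (simp only: le)
next
  case (box c a b k)
  have le: "real CARD('q) powi (- int (nat (- k))) \<le> real CARD('q) powi k"
    unfolding CARD_powi_le_iff by simp
  have "x + s \<in> padic_interval a (real CARD('q) powi k) \<longleftrightarrow> x \<in> padic_interval a (real CARD('q) powi k)"
    if "padic_le s (- int (nat (- k)))" for x s a :: "'q padic"
  proof -
    have s: "padic_le s k" using that le by linarith
    show ?thesis unfolding padic_interval_def mem_Collect_eq
      using padic_abs_add_le[of "x - a" "real CARD('q) powi k" s, OF _ s]
        padic_abs_diff_le[of "x + s - a" "real CARD('q) powi k" s, OF _ s] by (auto simp: algebra_simps)
  qed
  then show ?case by (intro exI[of _ "nat (- k)"]) (auto simp: indicator_def)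
qed simp

lemma padic_schwartz_compact_support:
  fixes f :: "'q::prime_card padic_fun"
  assumes "padic_schwartz f"
  shows "\<exists>m::nat. \<forall>x. f x \<noteq> 0 \<longrightarrow> padic_le (fst x) (int m) \<and> padic_le (snd x) (int m)"
  using assms
proof (induction rule: padic_schwartz_induct)
  case (add f g)
  then obtain m n :: nat where
    m: "\<forall>x. f x \<noteq> 0 \<longrightarrow> padic_le (fst x) (int m) \<and> padic_le (snd x) (int m)" and
    n: "\<forall>x. g x \<noteq> 0 \<longrightarrow> padic_le (fst x) (int n) \<and> padic_le (snd x) (int n)"
    by blast
  have "real CARD('q) powi (int m) \<le> real CARD('q) powi (int (max m n))"
    "real CARD('q) powi (int n) \<le> real CARD('q) powi (int (max m n))"
    unfolding CARD_powi_le_iff by simp_all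
  then have le: "r \<le> real CARD('q) powi (int m) \<Longrightarrow> r \<le> real CARD('q) powi (int (max m n))"
    "r \<le> real CARD('q) powi (int n) \<Longrightarrow> r \<le> real CARD('q) powi (int (max m n))" for r
    by - (erule order_trans, assumption)+
  have "f x + g x \<noteq> 0 \<Longrightarrow> f x \<noteq> 0 \<or> g x \<noteq> 0" for x by auto
  then show ?case using m n le by (intro exI[of _ "max m n"]) blast
next
  case (box c a b k)
  obtain m :: nat where m: "max (real CARD('q) powi k) (max (padic_abs a) (padic_abs b)) \<le> real CARD('q) ^ m"
    using real_arch_pow[OF CARD_gt_1(1)] less_imp_le by blast
  have "padic_le x (int m)"
    if "x \<in> padic_interval c (real CARD('q) powi k)" "padic_abs c \<le> real CARD('q) ^ m" for x c :: "'q padic"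
    using padic_abs_add_le[of "x - c" "real CARD('q) ^ m" c] that m by (simp add: padic_interval_def)
  then show ?case using m by (intro exI[of _ m]) (auto simp: indicator_def)
qed simp

subsection \<open>The Fourier transform\<close>

lemma padic_fourier_integrand:
  fixes f :: "'q::prime_card padic_fun"
  assumes "padic_schwartz f"
  shows "bounded_finsupp padic_haar2 (\<lambda>x. f x * padic_char (- (fst x * a + snd x * b)))"
  by (rule bounded_finsupp_mult[OF padic_schwartz_bounded_finsupp[OF assms] padic_char_dot_measurable, where C=1]) simp

lemma padic_fourier_cmult:
  "padic_fourier (\<lambda>x. c * f x) \<xi> = c * padic_fourier f (\<xi> :: 'q::prime_card padic \<times> 'q padic)"
  by (simp add: padic_fourier_def mult.assoc)

lemma padic_fourier_sum:
  fixes f :: "'i \<Rightarrow> 'q::prime_card padic_fun"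
  assumes "\<And>i. i \<in> I \<Longrightarrow> padic_schwartz (f i)"
  shows "padic_fourier (\<lambda>x. \<Sum>i\<in>I. f i x) \<xi> = (\<Sum>i\<in>I. padic_fourier (f i) \<xi>)"
  unfolding padic_fourier_def sum_distrib_right
  by (rule Bochner_Integration.integral_sum) (intro bounded_finsupp_integrable padic_fourier_integrand assms)

lemma padic_fourier_diff:
  fixes f g :: "'q::prime_card padic_fun"
  assumes "padic_schwartz f" "padic_schwartz g"
  shows "padic_fourier (\<lambda>x. f x - g x) \<xi> = padic_fourier f \<xi> - padic_fourier g \<xi>"
  unfolding padic_fourier_def left_diff_distrib
  by (rule Bochner_Integration.integral_diff) (intro bounded_finsupp_integrable padic_fourier_integrand assms)+

lemma padic_fourier_translate:
  fixes f :: "'q::prime_card padic_fun"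
  assumes "padic_schwartz f"
  shows "padic_fourier (\<lambda>x. f (fst x + s, snd x + t)) \<xi> = padic_char (s * fst \<xi> + t * snd \<xi>) * padic_fourier f \<xi>"
proof -
  let ?h = "\<lambda>x. f x * padic_char (- (fst x * fst \<xi> + snd x * snd \<xi>))"
  have "?h \<in> borel_measurable padic_haar2"
    using padic_fourier_integrand[OF assms] by (rule bounded_finsupp_measurable)
  from integral_padic_translate[OF this, of s t]
  have "padic_fourier f \<xi> = (\<integral>x. f (fst x + s, snd x + t) * padic_char (- ((fst x + s) * fst \<xi> + (snd x + t) * snd \<xi>)) \<partial>padic_haar2)"
    by (simp add: padic_fourier_def)
  also have "\<dots> = (\<integral>x. padic_char (- (s * fst \<xi> + t * snd \<xi>)) *
      (f (fst x + s, snd x + t) * padic_char (- (fst x * fst \<xi> + snd x * snd \<xi>))) \<partial>padic_haar2)"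
  proof (intro Bochner_Integration.integral_cong refl)
    fix x :: "'q padic \<times> 'q padic"
    have "- ((fst x + s) * fst \<xi> + (snd x + t) * snd \<xi>)
        = - (s * fst \<xi> + t * snd \<xi>) + - (fst x * fst \<xi> + snd x * snd \<xi>)" by (simp add: algebra_simps)
    then show "f (fst x + s, snd x + t) * padic_char (- ((fst x + s) * fst \<xi> + (snd x + t) * snd \<xi>))
      = padic_char (- (s * fst \<xi> + t * snd \<xi>)) *
      (f (fst x + s, snd x + t) * padic_char (- (fst x * fst \<xi> + snd x * snd \<xi>)))"
      by (simp only: padic_char_add mult_ac)
  qed
  also have "\<dots> = padic_char (- (s * fst \<xi> + t * snd \<xi>)) * padic_fourier (\<lambda>x. f (fst x + s, snd x + t)) \<xi>"
    by (simp add: padic_fourier_def)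
  finally show ?thesis unfolding padic_char_minus by simp
qed

text \<open>Fourier inversion with the frequency integral replaced by a finite sum: for \<open>x\<close> and \<open>y\<close> in
  a ball of radius \<open>q\<^sup>l\<close>, summing \<open>\<chi>((y - x) \<cdot> \<xi>)\<close> over representatives \<open>\<xi>\<close> of the ball of
  radius \<open>q\<^sup>m\<close> modulo the ball of radius \<open>q\<^sup>-\<^sup>l\<close> gives a multiple of the indicator of
  \<open>|y - x| \<le> q\<^sup>-\<^sup>m\<close>.\<close>

lemma padic_fourier_eq_0_imp:
  fixes f :: "'q::prime_card padic_fun"
  assumes f: "padic_schwartz f" and 0: "\<And>\<xi>. padic_fourier f \<xi> = 0"
  shows "f y = 0"
proof -
  let ?q = "of_nat CARD('q) :: 'q padic"
  obtain m :: nat where m: "\<And>x s t. padic_le s (- int m) \<Longrightarrow>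
    padic_le t (- int m) \<Longrightarrow> f (fst x + s, snd x + t) = f x"
    using padic_schwartz_locally_constant[OF f] by blast
  obtain l :: nat where l: "\<And>x. f x \<noteq> 0 \<Longrightarrow> padic_le (fst x) (int l) \<and> padic_le (snd x) (int l)"
    using padic_schwartz_compact_support[OF f] by blast
  show ?thesis
  proof (rule ccontr)
    assume fy: "f y \<noteq> 0"
    \<comment> \<open>\<open>L\<close> is the index of the ball of radius \<open>q ^ (-l)\<close> in
      the ball of radius \<open>q ^ m\<close>, and the points \<open>?e i\<close> with
      \<open>i < L\<close> represent the cosets.\<close>
    define L where "L = CARD('q) ^ (l + m)"
    let ?I = "\<lambda>a. padic_interval a (real CARD('q) powi (- int m))"
    let ?S = "?I (fst y) \<times> ?I (snd y)"
    let ?e = "\<lambda>i. of_nat i * ?q powi (- int m)"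
    have S: "?S \<in> sets padic_haar2" unfolding padic_haar2_def by (intro pair_measureI) simp_all
    have emS: "emeasure padic_haar2 ?S = ennreal (real CARD('q) powi (- int m) * real CARD('q) powi (- int m))"
      unfolding padic_haar2_def
      by (subst padic_haar.emeasure_pair_measure_Times)
         (simp_all only: sets_padic_haar padic_interval_measurable CARD_powi_pos emeasure_padic_haar_small[OF padic_haar]
           ennreal_mult CARD_powi_nonneg)
    have char_sum: "(\<Sum>i<L. padic_char ((b - a) * ?e i)) = of_nat L * indicator (?I b) a"
      if "padic_le a (int l)" "padic_le b (int l)" for a b :: "'q padic"
    proof -
      let ?z = "(b - a) * ?q powi (- int m)"
      have ba: "padic_le (b - a) (int l)" using padic_abs_diff_le[OF that(2,1)] .
      have z: "padic_le ?z (int l + int m)"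
        by (rule padic_abs_mult_le[OF ba, of _ "int m"]) (simp_all only: padic_abs_q_powi, simp)
      have qq: "padic_le (of_nat L :: 'q padic) (- (int l + int m))"
      proof -
        have "(of_nat L :: 'q padic) = ?q powi int (l + m)" unfolding L_def power_int_of_nat by simp
        then show ?thesis by (simp only: padic_abs_q_powi of_nat_add order_refl)
      qed
      have "padic_le (of_nat L * ?z) 0"
        by (rule padic_abs_mult_le[OF qq z]) simp
      then have "padic_abs (of_nat L * ?z) \<le> 1" by simp
      from padic_char_sum[OF this]
      have "(\<Sum>i<L. padic_char ((b - a) * ?e i)) = (if padic_abs ?z \<le> 1 then of_nat L else 0)"
        by (simp only: mult_ac)
      moreover have "padic_abs ?z \<le> 1 \<longleftrightarrow> a \<in> ?I b"
        unfolding padic_abs_mult padic_abs_q_powi padic_interval_def mem_Collect_eq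
        using CARD_gt_1(2)[where 'q='q]
        by (simp add: power_int_minus field_simps padic_abs_minus_commute[of a b])
      ultimately show ?thesis by (simp add: indicator_def)
    qed
    let ?c = "\<lambda>i j x. padic_char (- (fst x * ?e i + snd x * ?e j))"
    \<comment> \<open>All values of the transform vanish, whereas interchanging sum and integral
      leaves a nonzero multiple of \<open>f y\<close> times the measure of \<open>?S\<close>,
      because \<open>f\<close> is constant on \<open>?S\<close>.\<close>
    have "0 = (\<Sum>i<L. \<Sum>j<L. padic_char (fst y * ?e i + snd y * ?e j) * padic_fourier f (?e i, ?e j))"
      by (simp add: 0)
    also have "\<dots> = (\<integral>x. (\<Sum>i<L. \<Sum>j<L. padic_char (fst y * ?e i + snd y * ?e j) * (f x * ?c i j x)) \<partial>padic_haar2)"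
      unfolding padic_fourier_def
      by (subst Bochner_Integration.integral_sum Bochner_Integration.integral_mult_right_zero[symmetric],
          intro Bochner_Integration.integrable_sum integrable_mult_right bounded_finsupp_integrable padic_fourier_integrand f)+ simp
    also have "\<dots> = (\<integral>x. of_nat L * of_nat L * f y * indicator ?S x \<partial>padic_haar2)"
    proof (intro Bochner_Integration.integral_cong refl)
      fix x :: "'q padic \<times> 'q padic"
      show "(\<Sum>i<L. \<Sum>j<L. padic_char (fst y * ?e i + snd y * ?e j) * (f x * ?c i j x))
          = of_nat L * of_nat L * f y * indicator ?S x"
      proof (cases "f x = 0")
        case True
        have "x \<notin> ?S"
        proof
          assume "x \<in> ?S"
          then have "f (fst y + (fst x - fst y), snd y + (snd x - snd y)) = f y"
            by (intro m) (auto simp: padic_interval_def)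
          then show False using True fy by simp
        qed
        then show ?thesis using True by simp
      next
        case False
        have eq: "padic_char (fst y * ?e i + snd y * ?e j) * (f x * ?c i j x)
            = f x * (padic_char ((fst y - fst x) * ?e i) * padic_char ((snd y - snd x) * ?e j))" for i j
        proof -
          have "padic_char (fst y * ?e i + snd y * ?e j) * ?c i j x
              = padic_char ((fst y - fst x) * ?e i) * padic_char ((snd y - snd x) * ?e j)"
            unfolding padic_char_add[symmetric] by (simp add: algebra_simps)
          then show ?thesis by (subst mult.left_commute) (simp only:)
        qed
        have "(\<Sum>i<L. \<Sum>j<L. padic_char (fst y * ?e i + snd y * ?e j) * (f x * ?c i j x))
            = f x * ((\<Sum>i<L. padic_char ((fst y - fst x) * ?e i)) * (\<Sum>j<L. padic_char ((snd y - snd x) * ?e j)))"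
          unfolding eq sum_product by (simp only: sum_distrib_left)
        also have "\<dots> = of_nat L * of_nat L * f x * indicator ?S x"
          using l[OF False] l[OF fy] by (simp add: char_sum indicator_times)
        also have "\<dots> = of_nat L * of_nat L * f y * indicator ?S x"
        proof (cases "x \<in> ?S")
          case True
          then have "f (fst y + (fst x - fst y), snd y + (snd x - snd y)) = f y"
            by (intro m) (auto simp: padic_interval_def)
          then show ?thesis by simp
        qed simp
        finally show ?thesis .
      qed
    qed
    also have "\<dots> = (\<integral>x. indicator ?S x *\<^sub>R (of_nat L * of_nat L * f y) \<partial>padic_haar2)"
      by (intro Bochner_Integration.integral_cong refl) (simp add: indicator_def)
    also have "\<dots> = measure padic_haar2 ?S *\<^sub>R (of_nat L * of_nat L * f y)"
      using S emS by (subst integral_scaleR_left) (auto simp: less_top[symmetric])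
    finally have "measure padic_haar2 ?S = 0" using fy prime_gt_0_nat[OF prime_card[where 'a='q]] by (simp add: L_def)
    moreover have "measure padic_haar2 ?S = real CARD('q) powi (- int m) * real CARD('q) powi (- int m)"
      unfolding measure_def emS by simp
    ultimately show False using CARD_powi_pos[where 'q='q and k="- int m"] by simp
  qed
qed

text \<open>Takes the place of the inversion formula: Schwartz functions are constructed explicitly
  and then identified by their transforms.\<close>

lemma padic_fourier_inject:
  fixes f g :: "'q::prime_card padic_fun"
  assumes "padic_schwartz f" "padic_schwartz g" "\<And>\<xi>. padic_fourier f \<xi> = padic_fourier g \<xi>"
  shows "f = g"
proof
  fix y
  have "f y - g y = 0"
    by (rule padic_fourier_eq_0_imp[of "\<lambda>x. f x - g x"])
       (simp_all add: padic_schwartz_diff padic_fourier_diff assms)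
  then show "f y = g y" by simp
qed

section \<open>Wave packets\<close>

text \<open>For Schwartz functions \<open>padic_wave a k f\<close> means that \<open>f\<close> has its Fourier transform supported
  in \<open>\<theta>\<^sub>I\<close> for \<open>I = I(a, q\<^sup>-\<^sup>k)\<close>: up to the character \<open>\<chi>(x \<cdot> (a, a\<^sup>2))\<close>, the function is invariant under
  translations by the parallelogram dual to \<open>\<theta>\<^sub>I - \<theta>\<^sub>I\<close>.\<close>

definition padic_wave :: "'q::prime_card padic \<Rightarrow> int \<Rightarrow> ('q padic_fun) \<Rightarrow> bool" where
  "padic_wave a k f \<longleftrightarrow> (\<forall>x t u. padic_le (t + 2 * a * u) k \<longrightarrow>
     padic_le u (2 * k) \<longrightarrow>
     f (fst x + t, snd x + u) = padic_char (t * a + u * a\<^sup>2) * f x)"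

lemma padic_waveD:
  assumes "padic_wave a k f" "padic_abs (t + 2 * a * u) \<le> real CARD('q::prime_card) powi k"
    "padic_le u (2 * k)"
  shows "f (fst x + t, snd x + u :: 'q padic) = padic_char (t * a + u * a\<^sup>2) * f x"
  using assms by (simp add: padic_wave_def)

lemma padic_abs_power2_le:
  "padic_le (x :: 'q::prime_card padic) m \<Longrightarrow> padic_le (x\<^sup>2) (2 * m)"
  using padic_abs_mult_le[of x m x m "2 * m"] by (simp add: power2_eq_square)

lemma padic_char_eqI:
  "padic_abs (x - y) \<le> 1 \<Longrightarrow> padic_char x = padic_char (y :: 'q::prime_card padic)"
  using padic_char_integer[of "x - y"] by (simp add: padic_char_diff)

text \<open>Translation by \<open>(t, u)\<close> multiplies the transform by the character of
  \<open>t * \<xi> + u * \<eta>\<close>. Expanded at the point \<open>(a, a\<^sup>2)\<close> of the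
  parabola, this phase differs from \<open>t * a + u * a\<^sup>2\<close> by \<open>(\<xi> - a) * (t
  + 2 * a * u) + u * (\<eta> - \<xi>\<^sup>2) + u * (\<xi> - a)\<^sup>2\<close>, and each of the
  three terms is integral on the support.\<close>

lemma padic_wave_fourier:
  fixes f :: "'q::prime_card padic_fun"
  assumes f: "padic_schwartz f"
    and supp: "\<And>\<xi> \<eta>. padic_fourier f (\<xi>, \<eta>) \<noteq> 0 \<Longrightarrow>
      padic_le (\<xi> - a) (- k) \<and> padic_le (\<eta> - \<xi>\<^sup>2) (- 2 * k)"
  shows "padic_wave a k f"
  unfolding padic_wave_def
proof (intro allI impI)
  fix x t u
  assume t: "padic_le (t + 2 * a * u) k" and u: "padic_le u (2 * k)"
  have "(\<lambda>x. f (fst x + t, snd x + u)) = (\<lambda>x. padic_char (t * a + u * a\<^sup>2) * f x)"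
  proof (rule padic_fourier_inject)
    fix \<xi> :: "'q padic \<times> 'q padic"
    obtain \<xi>1 \<xi>2 where \<xi>: "\<xi> = (\<xi>1, \<xi>2)" by (cases \<xi>)
    show "padic_fourier (\<lambda>x. f (fst x + t, snd x + u)) \<xi> = padic_fourier (\<lambda>x. padic_char (t * a + u * a\<^sup>2) * f x) \<xi>"
      unfolding padic_fourier_translate[OF f] padic_fourier_cmult
    proof (cases "padic_fourier f \<xi> = 0")
      case False
      then have s: "padic_le (\<xi>1 - a) (- k)"
        "padic_le (\<xi>2 - \<xi>1\<^sup>2) (- 2 * k)" using supp[of \<xi>1 \<xi>2] \<xi> by auto
      have "padic_le ((\<xi>1 - a) * (t + 2 * a * u)) 0"
        "padic_le (u * (\<xi>2 - \<xi>1\<^sup>2)) 0"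
        "padic_le (u * (\<xi>1 - a)\<^sup>2) 0"
        by (rule padic_abs_mult_le[OF s(1) t], simp, rule padic_abs_mult_le[OF u s(2)], simp,
            rule padic_abs_mult_le[OF u padic_abs_power2_le[OF s(1)]], simp)
      then have "padic_abs ((\<xi>1 - a) * (t + 2 * a * u) + u * (\<xi>2 - \<xi>1\<^sup>2) + u * (\<xi>1 - a)\<^sup>2) \<le> 1"
        by (intro padic_abs_add_le) simp_all
      moreover have "(\<xi>1 - a) * (t + 2 * a * u) + u * (\<xi>2 - \<xi>1\<^sup>2) + u * (\<xi>1 - a)\<^sup>2
          = t * fst \<xi> + u * snd \<xi> - (t * a + u * a\<^sup>2)"
        unfolding \<xi> by (simp add: algebra_simps power2_eq_square)
      ultimately have "padic_char (t * fst \<xi> + u * snd \<xi>) = padic_char (t * a + u * a\<^sup>2)"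
        by (intro padic_char_eqI) simp
      then show "padic_char (t * fst \<xi> + u * snd \<xi>) * padic_fourier f \<xi> = padic_char (t * a + u * a\<^sup>2) * padic_fourier f \<xi>"
        by simp
    qed simp
  qed (intro padic_schwartz_translate padic_schwartz_cmult f)+
  then show "f (fst x + t, snd x + u) = padic_char (t * a + u * a\<^sup>2) * f x" by (rule fun_cong)
qed

text \<open>On the frequency side this is the inclusion of a short cap in a longer one. It is read
  off from the translations directly, since \<open>f\<close> may be any function with the
  invariance, for instance a truncated one.\<close>

lemma padic_wave_coarsen:
  fixes f :: "'q::prime_card padic_fun"
  assumes f: "padic_wave a k f" and ab: "padic_le (a - b) (- j)" and "j \<le> k"
  shows "padic_wave b j f"
  unfolding padic_wave_def
proof (intro allI impI)
  fix x t u
  assume t: "padic_le (t + 2 * b * u) j" and u: "padic_le u (2 * j)"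
  have "padic_le (2 * (a - b) * u) j"
  proof (rule padic_abs_mult_le[OF _ u])
    show "padic_le (2 * (a - b)) (- j)"
      by (rule padic_abs_mult_le[OF _ ab, of _ 0]) (use padic_abs_of_nat_le_1[of 2] in simp_all)
  qed simp
  then have "padic_le (t + 2 * b * u + 2 * (a - b) * u) j"
    by (rule padic_abs_add_le[OF t])
  moreover have "t + 2 * b * u + 2 * (a - b) * u = t + 2 * a * u" by (simp add: algebra_simps)
  ultimately have "padic_le (t + 2 * a * u) j" by (simp only:)
  also have "\<dots> \<le> real CARD('q) powi k" using \<open>j \<le> k\<close> by simp
  finally have "padic_le (t + 2 * a * u) k" .
  moreover have "padic_le u (2 * k)"
    using u \<open>j \<le> k\<close> by (intro order_trans[OF u]) simp
  ultimately have "f (fst x + t, snd x + u) = padic_char (t * a + u * a\<^sup>2) * f x"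
    by (rule padic_waveD[OF f])
  also have "padic_char (t * a + u * a\<^sup>2) = padic_char (t * b + u * b\<^sup>2)"
  proof (rule padic_char_eqI)
    have "padic_le ((a - b) * (t + 2 * b * u)) 0"
      "padic_le (u * (a - b)\<^sup>2) 0"
      by (rule padic_abs_mult_le[OF ab t], simp, rule padic_abs_mult_le[OF u padic_abs_power2_le[OF ab]], simp)
    then have "padic_abs ((a - b) * (t + 2 * b * u) + u * (a - b)\<^sup>2) \<le> 1"
      by (intro padic_abs_add_le) simp_all
    moreover have "(a - b) * (t + 2 * b * u) + u * (a - b)\<^sup>2 = t * a + u * a\<^sup>2 - (t * b + u * b\<^sup>2)"
      by (simp add: algebra_simps power2_eq_square)
    ultimately show "padic_abs (t * a + u * a\<^sup>2 - (t * b + u * b\<^sup>2)) \<le> 1" by simp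
  qed
  finally show "f (fst x + t, snd x + u) = padic_char (t * b + u * b\<^sup>2) * f x" .
qed

lemma padic_wave_sum:
  fixes f :: "'i \<Rightarrow> 'q::prime_card padic_fun"
  assumes "\<And>i. i \<in> I \<Longrightarrow> padic_wave a k (f i)" shows "padic_wave a k (\<lambda>x. \<Sum>i\<in>I. f i x)"
  using assms unfolding padic_wave_def by (simp add: sum_distrib_left)

lemma padic_wave_cmod:
  fixes f :: "'q::prime_card padic_fun"
  assumes "padic_wave a k f" "padic_le (t + 2 * a * u) k"
    "padic_le u (2 * k)"
  shows "cmod (f (fst x + t, snd x + u)) = cmod (f x)"
  using padic_waveD[OF assms, of x] by (simp add: norm_mult)

lemma padic_wave_truncate:
  fixes f :: "'q::prime_card padic_fun"
  assumes "padic_wave a k f" shows "padic_wave a k (\<lambda>x. f x * \<phi> (cmod (f x)))"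
  unfolding padic_wave_def
proof (intro allI impI)
  fix x t u
  assume tu: "padic_le (t + 2 * a * u) k" "padic_le u (2 * k)"
  show "f (fst x + t, snd x + u) * \<phi> (cmod (f (fst x + t, snd x + u))) = padic_char (t * a + u * a\<^sup>2) * (f x * \<phi> (cmod (f x)))"
    using padic_waveD[OF assms tu, of x] padic_wave_cmod[OF assms tu, of x] by simp
qed

subsection \<open>Orthogonality\<close>

text \<open>Translation invariance shows that the integral equals \<open>z\<close> times itself.
  This replaces Plancherel's theorem: orthogonality amounts to finding a translation that multiplies
  the integrand by a nontrivial value of the character.\<close>

lemma integral_padic_modulated_eq_0:
  fixes h :: "'q::prime_card padic_fun"
  assumes h: "h \<in> borel_measurable padic_haar2" and eq: "\<And>x. h (fst x + t, snd x + u) = z * h x" and "z \<noteq> 1"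
  shows "(\<integral>x. h x \<partial>padic_haar2) = 0"
proof -
  have "(\<integral>x. h x \<partial>padic_haar2) = z * (\<integral>x. h x \<partial>padic_haar2)"
    using integral_padic_translate[OF h, of t u] unfolding eq by simp
  then show ?thesis using \<open>z \<noteq> 1\<close> by (metis mult_cancel_right1)
qed

lemma padic_char_inverse_q: "padic_char (inverse (of_nat CARD('q)) :: 'q::prime_card padic) \<noteq> 1"
  unfolding padic_char_eq_1_iff padic_abs_inverse padic_abs_q using CARD_gt_1(1)[where 'q='q] by simp

lemma padic_abs_inverse_le:
  fixes x :: "'q::prime_card padic"
  assumes "\<not> padic_le x (m - 1)"
  shows "padic_le (inverse x) (- m)"
proof -
  obtain k where k: "k > m - 1" "padic_abs x = real CARD('q) powi k"
    using padic_abs_not_le[OF assms] .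
  then show ?thesis by (simp add: padic_abs_inverse power_int_minus[symmetric])
qed

lemma borel_measurable_cnj [measurable (raw)]:
  "f \<in> borel_measurable M \<Longrightarrow> (\<lambda>x. cnj (f x)) \<in> borel_measurable M"
  by (rule measurable_compose[OF _ borel_measurable_continuous_onI[OF continuous_on_cnj[OF continuous_on_id]]])

lemma padic_wave_orthogonal:
  fixes f g :: "'q::prime_card padic_fun"
  assumes f: "padic_wave a k f" "f \<in> borel_measurable padic_haar2"
    and g: "padic_wave b k g" "g \<in> borel_measurable padic_haar2"
    and ab: "\<not> padic_le (a - b) (- k)"
  shows "(\<integral>x. f x * cnj (g x) \<partial>padic_haar2) = 0"
proof -
  have nz: "a - b \<noteq> 0" using ab by auto
  \<comment> \<open>Chosen so that \<open>t * (a - b)\<close> is \<open>1 / q\<close>, where the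
    character is not 1. The separation of \<open>a\<close> and \<open>b\<close> is just enough to
    make \<open>t\<close> an admissible translation at scale \<open>k\<close>.\<close>
  define t where "t = inverse (of_nat CARD('q)) * inverse (a - b)"
  have "padic_le (inverse (a - b)) (k - 1)"
    using padic_abs_inverse_le[of "a - b" "1 - k"] ab by simp
  then have t: "padic_le t k"
    unfolding t_def by (intro padic_abs_mult_le[of _ 1 _ "k - 1"]) (simp_all add: padic_abs_inverse padic_abs_q)
  have ta: "t * a - t * b = inverse (of_nat CARD('q))" unfolding t_def right_diff_distrib[symmetric] mult.assoc left_inverse[OF nz] by simp
  show ?thesis
  proof (rule integral_padic_modulated_eq_0[where t=t and u=0 and z="padic_char (t * a - t * b)"])
    fix x
    have "f (fst x + t, snd x + 0) = padic_char (t * a + 0 * a\<^sup>2) * f x"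
      "g (fst x + t, snd x + 0) = padic_char (t * b + 0 * b\<^sup>2) * g x"
      using t by (intro padic_waveD[OF f(1)] padic_waveD[OF g(1)]; simp)+
    then show "f (fst x + t, snd x + 0) * cnj (g (fst x + t, snd x + 0))
        = padic_char (t * a - t * b) * (f x * cnj (g x))"
      by (simp add: cnj_padic_char padic_char_minus padic_char_diff divide_inverse)
  qed (use f g ta padic_char_inverse_q[where 'q='q] in auto)
qed

lemma padic_abs_2: "odd CARD('q) \<Longrightarrow> padic_abs (2 :: 'q::prime_card padic) = 1"
proof -
  assume "odd CARD('q)"
  then have "\<not> int CARD('q) dvd 2"
    using prime_gt_1_nat[OF prime_card[where 'a='q]] zdvd_imp_le[of "int CARD('q)" 2] by (cases "CARD('q) = 2") auto
  then show ?thesis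
    using padic_abs_of_int[of 2, where 'q='q] qadic_abs_of_int[OF prime_card[where 'a='q], of 2]
    by (simp add: not_dvd_imp_multiplicity_0)
qed

text \<open>Here oddness of \<open>q\<close> is used: \<open>|a + b - 2c| = |2(a - c) + (b - a)| = q\<^sup>r\<close>, so that the two
  frequencies are separated in the direction normal to the parabola at \<open>c\<close>.\<close>

lemma padic_wave_transversal_orthogonal:
  fixes f g :: "'q::prime_card padic_fun" and w :: "'q padic \<times> 'q padic \<Rightarrow> real"
  assumes odd: "odd CARD('q)"
    and f: "padic_wave a j f" "f \<in> borel_measurable padic_haar2"
    and g: "padic_wave b j g" "g \<in> borel_measurable padic_haar2"
    and w: "\<And>x t u. padic_le (t + 2 * c * u) l \<Longrightarrow>
      padic_le u (2 * l) \<Longrightarrow> w (fst x + t, snd x + u) = w x"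
    and wm: "w \<in> borel_measurable padic_haar2"
    and ac: "padic_abs (a - c) = real CARD('q) powi r" and bc: "padic_abs (b - c) = real CARD('q) powi r"
    and ab: "padic_le (a - b) (r - 1)" "\<not> padic_le (a - b) (- j)"
    and j: "j = 2 * l + r" "0 \<le> l + r"
  shows "(\<integral>x. f x * cnj (g x) * complex_of_real (w x) \<partial>padic_haar2) = 0"
proof -
  let ?D = "(a - b) * (a + b - 2 * c)"
  have nz: "a - b \<noteq> 0" using ab(2) by auto
  have ac2: "padic_abs (2 * (a - c)) = real CARD('q) powi r"
    by (simp only: padic_abs_mult padic_abs_2[OF odd] ac mult_1)
  have "\<not> padic_le (a + b - 2 * c) (r - 1)"
  proof
    assume "padic_le (a + b - 2 * c) (r - 1)"
    then have "padic_le ((a + b - 2 * c) + (a - b)) (r - 1)"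
      using ab(1) by (rule padic_abs_add_le)
    moreover have "(a + b - 2 * c) + (a - b) = 2 * (a - c)" by simp
    ultimately show False using ac2 by simp
  qed
  note s = this
  then have nz2: "a + b - 2 * c \<noteq> 0" by auto
  \<comment> \<open>Chosen so that \<open>u * ?D\<close> is \<open>1 / q\<close>; along the line
    fixed next, \<open>u * ?D\<close> is the difference of the phases at \<open>a\<close> and
    \<open>b\<close>.\<close>
  define u where "u = inverse (of_nat CARD('q)) * (inverse (a - b) * inverse (a + b - 2 * c))"
  have "padic_le (inverse (a - b)) (j - 1)"
    using padic_abs_inverse_le[of "a - b" "1 - j"] ab by simp
  moreover have "padic_le (inverse (a + b - 2 * c)) (- r)"
    by (rule padic_abs_inverse_le[OF s])
  ultimately have iv: "padic_le (inverse (a - b) * inverse (a + b - 2 * c)) (2 * l - 1)"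
    using j by (intro padic_abs_mult_le) auto
  have qi: "padic_le (inverse (of_nat CARD('q)) :: 'q padic) 1"
    by (simp add: padic_abs_inverse padic_abs_q)
  have u: "padic_le u (2 * l)"
    unfolding u_def by (rule padic_abs_mult_le[OF qi iv]) simp
  \<comment> \<open>On this line \<open>t + 2 * c * u\<close> vanishes, so that the weight is
    invariant for all \<open>u\<close> of size at most \<open>q ^ (2 * l)\<close>.\<close>
  define t where "t = - 2 * c * u"
  have D: "u * ?D = inverse (of_nat CARD('q))"
  proof -
    have "e * (inverse x * inverse y) * (x * y) = e" if "x \<noteq> 0" "y \<noteq> 0" for e x y :: "'q padic"
      using that by (simp add: field_simps)
    then show ?thesis unfolding u_def using nz nz2 .
  qed
  have uj: "padic_le u (2 * j)"
    by (rule order_trans[OF u]) (use j in simp)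
  \<comment> \<open>Here \<open>t + 2 * d * u = 2 * (d - c) * u\<close> has size at most
    \<open>q ^ (2 * l + r)\<close>. This is what determines \<open>j\<close>: at that scale the
    translation is still admissible for both packets.\<close>
  have small: "padic_le (t + 2 * d * u) j" if "padic_abs (d - c) = real CARD('q) powi r" for d
  proof -
    have "padic_le (2 * (d - c)) r" by (simp only: padic_abs_mult padic_abs_2[OF odd] that mult_1 order_refl)
    then have "padic_le (2 * (d - c) * u) j"
      by (rule padic_abs_mult_le[OF _ u]) (use j in simp)
    moreover have "2 * (d - c) * u = t + 2 * d * u" by (simp add: t_def algebra_simps)
    ultimately show ?thesis by simp
  qed
  have char: "t * a + u * a\<^sup>2 - (t * b + u * b\<^sup>2) = inverse (of_nat CARD('q))"
    unfolding D[symmetric] t_def by (simp add: algebra_simps power2_eq_square)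
  then have mod_char: "padic_char (t * a + u * a\<^sup>2) * cnj (padic_char (t * b + u * b\<^sup>2))
      = padic_char (inverse (of_nat CARD('q)) :: 'q padic)"
    by (simp only: cnj_padic_char padic_char_add[symmetric] diff_conv_add_uminus)
  show ?thesis
  proof (rule integral_padic_modulated_eq_0[where t=t and u=u and z="padic_char (inverse (of_nat CARD('q)) :: 'q padic)"])
    fix x
    have "w (fst x + t, snd x + u) = w x" using u by (intro w) (simp_all add: t_def)
    moreover have "f (fst x + t, snd x + u) = padic_char (t * a + u * a\<^sup>2) * f x"
      by (rule padic_waveD[OF f(1) small[OF ac] uj])
    moreover have "g (fst x + t, snd x + u) = padic_char (t * b + u * b\<^sup>2) * g x"
      by (rule padic_waveD[OF g(1) small[OF bc] uj])
    ultimately show "f (fst x + t, snd x + u) * cnj (g (fst x + t, snd x + u)) * complex_of_real (w (fst x + t, snd x + u))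
        = padic_char (inverse (of_nat CARD('q)) :: 'q padic) * (f x * cnj (g x) * complex_of_real (w x))"
      by (simp only: complex_cnj_mult mod_char[symmetric] mult_ac)
  qed (use f g wm padic_char_inverse_q[where 'q='q] in auto)
qed

text \<open>The square is expanded and only the diagonal survives. The weight will be 1 for the
  estimate at exponent 2, and the fourth power of the other arc in the bilinear integral.\<close>

lemma padic_wave_sum_orthogonal:
  fixes h :: "'i \<Rightarrow> 'q::prime_card padic_fun" and w :: "'q padic \<times> 'q padic \<Rightarrow> real"
  assumes I: "finite I"
    and h: "\<And>i. i \<in> I \<Longrightarrow> bounded_finsupp padic_haar2 (h i)"
    and w: "w \<in> borel_measurable padic_haar2" "\<And>x. \<bar>w x\<bar> \<le> B"
    and orth: "\<And>i j. i \<in> I \<Longrightarrow> j \<in> I \<Longrightarrow> i \<noteq> j \<Longrightarrow> (\<integral>x. h i x * cnj (h j x) * complex_of_real (w x) \<partial>padic_haar2) = 0"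
  shows "(\<integral>x. (cmod (\<Sum>i\<in>I. h i x))\<^sup>2 * w x \<partial>padic_haar2) = (\<Sum>i\<in>I. \<integral>x. (cmod (h i x))\<^sup>2 * w x \<partial>padic_haar2)"
proof -
  have bm: "bounded_finsupp padic_haar2 (\<lambda>x. h i x * cnj (h j x) * complex_of_real (w x))" if ij: "i \<in> I" "j \<in> I" for i j
  proof -
    obtain C where "\<And>x. cmod (h j x) \<le> C" using h[OF ij(2)] by (auto simp: bounded_finsupp_def)
    then have "bounded_finsupp padic_haar2 (\<lambda>x. h i x * cnj (h j x))"
      using h[OF ij(2)] by (intro bounded_finsupp_mult[OF h[OF ij(1)]]) (auto simp: bounded_finsupp_def)
    then show ?thesis using w by (rule_tac bounded_finsupp_mult[where C=B]) auto
  qed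
  have "complex_of_real (\<integral>x. (cmod (\<Sum>i\<in>I. h i x))\<^sup>2 * w x \<partial>padic_haar2)
      = (\<integral>x. complex_of_real ((cmod (\<Sum>i\<in>I. h i x))\<^sup>2 * w x) \<partial>padic_haar2)"
    by (rule integral_complex_of_real[symmetric])
  also have "\<dots> = (\<integral>x. (\<Sum>i\<in>I. \<Sum>j\<in>I. h i x * cnj (h j x) * complex_of_real (w x)) \<partial>padic_haar2)"
    by (intro Bochner_Integration.integral_cong refl)
       (simp only: of_real_mult complex_norm_square cnj_sum sum_product, simp only: sum_distrib_right)
  also have "\<dots> = (\<Sum>i\<in>I. \<Sum>j\<in>I. \<integral>x. h i x * cnj (h j x) * complex_of_real (w x) \<partial>padic_haar2)"
    by (subst Bochner_Integration.integral_sum, intro Bochner_Integration.integrable_sum bounded_finsupp_integrable bm,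
        assumption, assumption, intro sum.cong refl, subst Bochner_Integration.integral_sum)
       (auto intro!: bounded_finsupp_integrable bm)
  also have "\<dots> = (\<Sum>i\<in>I. \<Sum>j\<in>I. if i = j then complex_of_real (\<integral>x. (cmod (h i x))\<^sup>2 * w x \<partial>padic_haar2) else 0)"
  proof (intro sum.cong refl)
    fix i j assume ij: "i \<in> I" "j \<in> I"
    have "(\<integral>x. h i x * cnj (h i x) * complex_of_real (w x) \<partial>padic_haar2)
        = complex_of_real (\<integral>x. (cmod (h i x))\<^sup>2 * w x \<partial>padic_haar2)"
      by (subst integral_complex_of_real[symmetric]) (simp only: of_real_mult complex_norm_square)
    then show "(\<integral>x. h i x * cnj (h j x) * complex_of_real (w x) \<partial>padic_haar2)
      = (if i = j then complex_of_real (\<integral>x. (cmod (h i x))\<^sup>2 * w x \<partial>padic_haar2) else 0)"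
      using orth[OF ij] by auto
  qed
  also have "\<dots> = complex_of_real (\<Sum>i\<in>I. \<integral>x. (cmod (h i x))\<^sup>2 * w x \<partial>padic_haar2)"
    using I by (simp add: sum.delta)
  finally show ?thesis by (simp only: of_real_eq_iff)
qed

subsection \<open>Separated sets of frequencies\<close>

text \<open>Translated and rescaled into the integers, separated points have distinct residues
  modulo \<open>q ^ n\<close>.\<close>

lemma card_padic_separated:
  fixes A :: "'q::prime_card padic set"
  assumes A: "finite A" and diam: "\<And>a b. a \<in> A \<Longrightarrow> b \<in> A \<Longrightarrow> padic_le (a - b) (- i)"
    and sep: "\<And>a b. a \<in> A \<Longrightarrow> b \<in> A \<Longrightarrow> padic_le (a - b) (- i - int n) \<Longrightarrow> a = b"
  shows "card A \<le> CARD('q) ^ n"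
proof (cases "A = {}")
  case False
  then obtain c where c: "c \<in> A" by blast
  let ?q = "of_nat CARD('q) :: 'q padic"
  have q: "?q \<noteq> 0" using prime_gt_0_nat[OF prime_card[where 'a='q]] by simp
  have "\<exists>N<CARD('q) ^ n. padic_le ((a - c) * ?q powi (- i) - of_nat N) (- int n)" if "a \<in> A" for a
  proof (rule padic_integer_approx)
    have "padic_le ((a - c) * ?q powi (- i)) 0"
      by (rule padic_abs_mult_le[OF diam[OF that c], of _ i]) (simp_all only: padic_abs_q_powi, simp_all)
    then show "padic_abs ((a - c) * ?q powi (- i)) \<le> 1" by simp
  qed
  then obtain N where N: "\<And>a. a \<in> A \<Longrightarrow> N a < CARD('q) ^ n"
    "\<And>a. a \<in> A \<Longrightarrow> padic_le ((a - c) * ?q powi (- i) - of_nat (N a)) (- int n)" by metis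
  have "inj_on N A"
  proof (rule inj_onI)
    fix a b assume ab: "a \<in> A" "b \<in> A" "N a = N b"
    have "padic_le ((a - c) * ?q powi (- i) - (b - c) * ?q powi (- i)) (- int n)"
      by (rule padic_diff_le[OF N(2)[OF ab(1)]])
         (subst padic_abs_minus_commute, simp only: N(2)[OF ab(2)] ab(3))
    then have "padic_le ((a - b) * ?q powi (- i)) (- int n)"
      by (simp add: left_diff_distrib)
    then have "padic_le ((a - b) * ?q powi (- i) * ?q powi i) (- i - int n)"
      by (rule padic_abs_mult_le[of _ _ _ "- i"]) (simp only: padic_abs_q_powi order_refl | simp)+
    then show "a = b" using q by (intro sep ab) (simp add: power_int_minus mult.assoc)
  qed
  moreover have "N ` A \<subseteq> {..<CARD('q) ^ n}" using N(1) by auto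
  ultimately show ?thesis using card_inj_on_le[of N A "{..<CARD('q) ^ n}"] by simp
qed simp

section \<open>Decoupling at the critical exponent\<close>

subsection \<open>Inequalities\<close>

lemma convex_on_power: "convex_on {0::real..} (\<lambda>x. x ^ n)"
  by (cases "even n") (auto intro: convex_power_odd convex_on_subset[OF convex_power_even])

text \<open>Jensen's inequality for \<open>x ^ Suc m\<close> with the weights divided by their sum.
  Weights 1 give Hoelder's inequality with the cardinality; other weights later linearize the cube
  of a sum.\<close>

lemma weighted_power_mean:
  fixes w y :: "'a \<Rightarrow> real"
  assumes A: "finite A" and w: "\<And>i. i \<in> A \<Longrightarrow> 0 \<le> w i" and y: "\<And>i. i \<in> A \<Longrightarrow> 0 \<le> y i"
  shows "(\<Sum>i\<in>A. w i * y i) ^ Suc m \<le> (\<Sum>i\<in>A. w i) ^ m * (\<Sum>i\<in>A. w i * y i ^ Suc m)"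
proof (cases "(\<Sum>i\<in>A. w i) = 0")
  case True
  then have "\<forall>i\<in>A. w i = 0" using A w by (simp add: sum_nonneg_eq_0_iff)
  then show ?thesis by simp
next
  case False
  let ?W = "\<Sum>i\<in>A. w i"
  have W: "?W > 0" using False sum_nonneg[OF w] by force
  have "(\<Sum>i\<in>A. (w i / ?W) *\<^sub>R y i) ^ Suc m \<le> (\<Sum>i\<in>A. w i / ?W * y i ^ Suc m)"
    using A False w y W
    by (intro convex_on_sum[OF _ _ convex_on_power]) (auto simp: sum_divide_distrib[symmetric])
  then have "((\<Sum>i\<in>A. w i * y i) / ?W) ^ Suc m \<le> (\<Sum>i\<in>A. w i * y i ^ Suc m) / ?W"
    by (simp only: real_scaleR_def times_divide_eq_left sum_divide_distrib[symmetric])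
  then have "(\<Sum>i\<in>A. w i * y i) ^ Suc m \<le> (\<Sum>i\<in>A. w i * y i ^ Suc m) / ?W * ?W ^ Suc m"
    using W by (simp only: power_divide pos_divide_le_eq zero_less_power)
  also have "\<dots> = ?W ^ m * (\<Sum>i\<in>A. w i * y i ^ Suc m)" using W by simp
  finally show ?thesis .
qed

lemma sum_power_le_card:
  fixes y :: "'a \<Rightarrow> real"
  assumes "finite A" "\<And>i. i \<in> A \<Longrightarrow> 0 \<le> y i"
  shows "(\<Sum>i\<in>A. y i) ^ Suc m \<le> real (card A) ^ m * (\<Sum>i\<in>A. y i ^ Suc m)"
  using weighted_power_mean[of A "\<lambda>_. 1" y m] assms by simp

lemma sum_power_le_power_sum:
  fixes y :: "'a \<Rightarrow> real"
  assumes "finite A" "\<And>i. i \<in> A \<Longrightarrow> 0 \<le> y i"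
  shows "(\<Sum>i\<in>A. y i ^ Suc m) \<le> (\<Sum>i\<in>A. y i) ^ Suc m"
proof -
  have "y i \<le> (\<Sum>i\<in>A. y i)" if "i \<in> A" for i using assms that by (intro member_le_sum) auto
  then have "(\<Sum>i\<in>A. y i ^ Suc m) \<le> (\<Sum>i\<in>A. y i * (\<Sum>i\<in>A. y i) ^ m)"
    using assms by (auto intro!: sum_mono mult_left_mono power_mono)
  then show ?thesis by (simp add: sum_distrib_right)
qed

text \<open>Either \<open>v\<close> is small relative to \<open>u\<close> and the factor
  \<open>(1 + \<kappa>) ^ 6\<close> suffices, or \<open>u\<close> is at most a multiple of
  \<open>v\<close>. The coefficient of \<open>u ^ 6\<close> has to be as close to 1 as desired
  because it is incurred anew at every scale.\<close>

lemma power_add_le_near: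
  fixes \<eta> :: real assumes "\<eta> > 0"
  shows "\<exists>C\<ge>0. \<forall>u\<ge>0. \<forall>v\<ge>0. (u + v) ^ 6 \<le> (1 + \<eta>) * u ^ 6 + C * v ^ 6"
proof -
  define \<kappa> where "\<kappa> = root 6 (1 + \<eta>) - 1"
  have \<kappa>: "\<kappa> > 0" "(1 + \<kappa>) ^ 6 = 1 + \<eta>" using assms by (auto simp: \<kappa>_def real_root_gt_1_iff)
  show ?thesis
  proof (intro exI[of _ "(1 + 1 / \<kappa>) ^ 6"] conjI allI impI)
    fix u v :: real assume uv: "0 \<le> u" "0 \<le> v"
    show "(u + v) ^ 6 \<le> (1 + \<eta>) * u ^ 6 + (1 + 1 / \<kappa>) ^ 6 * v ^ 6"
    proof (cases "v \<le> \<kappa> * u")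
      case True
      then have "(u + v) ^ 6 \<le> ((1 + \<kappa>) * u) ^ 6" using uv by (intro power_mono) (auto simp: algebra_simps)
      also have "\<dots> = (1 + \<eta>) * u ^ 6" by (simp add: power_mult_distrib \<kappa>)
      finally show ?thesis using \<kappa> uv by (simp add: add_increasing2)
    next
      case False
      then have "u \<le> v / \<kappa>" using \<kappa> by (simp add: field_simps)
      then have "(u + v) ^ 6 \<le> ((1 + 1 / \<kappa>) * v) ^ 6" using uv \<kappa> by (intro power_mono) (auto simp: algebra_simps)
      also have "\<dots> = (1 + 1 / \<kappa>) ^ 6 * v ^ 6" by (simp only: power_mult_distrib)
      finally show ?thesis using assms uv by (simp add: add_increasing)
    qed
  qed (use \<kappa> in simp)
qed

text \<open>The largest term \<open>z m\<close> is the narrow part. Any other term satisfies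
  \<open>cmod (z l) ^ 6 \<le> cmod (z m) ^ 2 * cmod (z l) ^ 4\<close> and so is controlled by the
  bilinear part. Only the constant \<open>K\<close> of the bilinear part is large, and it depends on
  \<eta> and \<open>N\<close> alone.\<close>

lemma broad_narrow:
  fixes \<eta> :: real assumes "\<eta> > 0"
  shows "\<exists>K\<ge>0. \<forall>(J :: 'a set) (z :: 'a \<Rightarrow> complex). finite J \<longrightarrow> card J \<le> N \<longrightarrow>
    cmod (\<Sum>j\<in>J. z j) ^ 6 \<le> (1 + \<eta>) * (\<Sum>j\<in>J. cmod (z j) ^ 6)
      + K * (\<Sum>j\<in>J. \<Sum>l\<in>J - {j}. cmod (z j) ^ 2 * cmod (z l) ^ 4)"
proof -
  obtain C where C: "C \<ge> 0" "\<And>u v. u \<ge> 0 \<Longrightarrow> v \<ge> 0 \<Longrightarrow> (u + v) ^ 6 \<le> (1 + \<eta>) * u ^ 6 + C * v ^ 6"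
    using power_add_le_near[OF assms] by blast
  show ?thesis
  proof (intro exI[of _ "C * real N ^ 5"] conjI allI impI)
    fix J :: "'a set" and z :: "'a \<Rightarrow> complex" assume J: "finite J" "card J \<le> N"
    show "cmod (\<Sum>j\<in>J. z j) ^ 6 \<le> (1 + \<eta>) * (\<Sum>j\<in>J. cmod (z j) ^ 6)
      + C * real N ^ 5 * (\<Sum>j\<in>J. \<Sum>l\<in>J - {j}. cmod (z j) ^ 2 * cmod (z l) ^ 4)"
    proof (cases "J = {}")
      case False
      have fin: "finite ((\<lambda>j. cmod (z j)) ` J)" "(\<lambda>j. cmod (z j)) ` J \<noteq> {}" using J False by auto
      from Max_in[OF fin] obtain m where m1: "m \<in> J" "Max ((\<lambda>j. cmod (z j)) ` J) = cmod (z m)"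
        by (elim imageE)
      have m: "m \<in> J" "\<And>l. l \<in> J \<Longrightarrow> cmod (z l) \<le> cmod (z m)"
        unfolding m1(2)[symmetric] using m1(1) by (auto intro: Max_ge[OF fin(1)])
      let ?v = "\<Sum>l\<in>J - {m}. cmod (z l)"
      have "cmod (\<Sum>j\<in>J. z j) \<le> cmod (z m) + ?v"
        using norm_triangle_mono[OF order_refl norm_sum, of "z m" "z" "J - {m}"] J m(1)
        by (simp add: sum.remove[of J m])
      then have "cmod (\<Sum>j\<in>J. z j) ^ 6 \<le> (cmod (z m) + ?v) ^ 6" by (intro power_mono) auto
      also have "\<dots> \<le> (1 + \<eta>) * cmod (z m) ^ 6 + C * ?v ^ 6" by (intro C sum_nonneg) auto
      also have "cmod (z m) ^ 6 \<le> (\<Sum>j\<in>J. cmod (z j) ^ 6)" using J m(1) by (intro member_le_sum) auto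
      also have "?v ^ 6 \<le> real N ^ 5 * (\<Sum>j\<in>J. \<Sum>l\<in>J - {j}. cmod (z j) ^ 2 * cmod (z l) ^ 4)"
      proof -
        have "?v ^ 6 \<le> real (card (J - {m})) ^ 5 * (\<Sum>l\<in>J - {m}. cmod (z l) ^ 6)"
          using sum_power_le_card[of "J - {m}" "\<lambda>l. cmod (z l)" 5] J by simp
        also have "\<dots> \<le> real N ^ 5 * (\<Sum>l\<in>J - {m}. cmod (z l) ^ 6)"
          using J card_Diff1_le[of J m] by (intro mult_right_mono power_mono sum_nonneg) auto
        also have "(\<Sum>l\<in>J - {m}. cmod (z l) ^ 6) \<le> (\<Sum>l\<in>J - {m}. cmod (z m) ^ 2 * cmod (z l) ^ 4)"
        proof (rule sum_mono)
          fix l assume "l \<in> J - {m}"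
          then have "cmod (z l) ^ 2 * cmod (z l) ^ 4 \<le> cmod (z m) ^ 2 * cmod (z l) ^ 4"
            using m(2) by (intro mult_right_mono power_mono) auto
          then show "cmod (z l) ^ 6 \<le> cmod (z m) ^ 2 * cmod (z l) ^ 4" by (simp add: power_add[symmetric])
        qed
        also have "\<dots> \<le> (\<Sum>j\<in>J. \<Sum>l\<in>J - {j}. cmod (z j) ^ 2 * cmod (z l) ^ 4)"
          using J m(1) by (intro member_le_sum[of m J "\<lambda>j. \<Sum>l\<in>J - {j}. cmod (z j) ^ 2 * cmod (z l) ^ 4"] sum_nonneg) auto
        finally show ?thesis by (simp add: mult_left_mono)
      qed
      finally show ?thesis using assms C(1) by (simp add: mult_left_mono mult.assoc)
    qed simp
  qed (use C in simp)
qed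

lemma integral_Cauchy_Schwarz:
  fixes u v :: "'a \<Rightarrow> real"
  assumes u: "bounded_finsupp M u" and v: "bounded_finsupp M v"
  shows "(\<integral>x. u x * v x \<partial>M)\<^sup>2 \<le> (\<integral>x. (u x)\<^sup>2 \<partial>M) * (\<integral>x. (v x)\<^sup>2 \<partial>M)"
proof -
  have int: "integrable M (\<lambda>x. (u x)\<^sup>2)" "integrable M (\<lambda>x. (v x)\<^sup>2)" "integrable M (\<lambda>x. u x * v x)"
    unfolding power2_eq_square by (intro bounded_finsupp_integrable bounded_finsupp_times u v)+
  let ?U = "\<integral>x. (u x)\<^sup>2 \<partial>M" and ?V = "\<integral>x. (v x)\<^sup>2 \<partial>M" and ?X = "\<integral>x. u x * v x \<partial>M"
  have quad: "0 \<le> ?U * s\<^sup>2 + 2 * ?X * s + ?V" for s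
  proof -
    have "0 \<le> (\<integral>x. (s * u x + v x)\<^sup>2 \<partial>M)" by (intro Bochner_Integration.integral_nonneg) simp
    also have "(\<lambda>x. (s * u x + v x)\<^sup>2) = (\<lambda>x. s\<^sup>2 * (u x)\<^sup>2 + 2 * s * (u x * v x) + (v x)\<^sup>2)"
      by (simp add: power2_eq_square algebra_simps)
    also have "(\<integral>x. s\<^sup>2 * (u x)\<^sup>2 + 2 * s * (u x * v x) + (v x)\<^sup>2 \<partial>M) = s\<^sup>2 * ?U + 2 * s * ?X + ?V"
      using int by simp
    finally show ?thesis by (simp add: algebra_simps)
  qed
  have UV: "?U \<ge> 0" "?V \<ge> 0" by (intro Bochner_Integration.integral_nonneg; simp)+
  show ?thesis
  proof (cases "?U = 0")
    case False
    have U: "?U > 0" by (rule le_neq_trans[OF UV(1) False[symmetric]])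
    have "0 \<le> ?U * (?U * (- ?X / ?U)\<^sup>2 + 2 * ?X * (- ?X / ?U) + ?V)" using quad UV by (intro mult_nonneg_nonneg)
    also have "\<dots> = ?U * ?V - ?X\<^sup>2" using U by (simp add: power2_eq_square field_simps)
    finally show ?thesis by simp
  next
    case True
    have "?X = 0"
    proof (rule ccontr)
      assume X: "?X \<noteq> 0"
      \<comment> \<open>For \<open>?U = 0\<close> the quadratic form is affine in \<open>s\<close>;
        this argument gives it the value -1.\<close>
      have "0 \<le> 2 * ?X * (- (?V + 1) / (2 * ?X)) + ?V" using quad[of "- (?V + 1) / (2 * ?X)"] True by simp
      also have "2 * ?X * (- (?V + 1) / (2 * ?X)) = - (?V + 1)" using X by simp
      finally show False by simp
    qed
    then show ?thesis using UV by simp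
  qed
qed

lemma bounded_finsupp_mult_powers:
  fixes f g :: "'a \<Rightarrow> complex"
  assumes "bounded_finsupp M f" "bounded_finsupp M g" "0 < m \<or> 0 < n"
  shows "bounded_finsupp M (\<lambda>x. cmod (f x) ^ m * cmod (g x) ^ n)"
proof (cases "m = 0 \<or> n = 0")
  case True
  then show ?thesis using assms bounded_finsupp_norm_power[of M f m] bounded_finsupp_norm_power[of M g n] by auto
next
  case False
  then show ?thesis using assms by (intro bounded_finsupp_times bounded_finsupp_norm_power) auto
qed

text \<open>The integrand is the product of \<open>|f| ^ 2 * |g|\<close> and \<open>|g| ^ 3\<close>.
  The square of the first factor is the same integrand with \<open>f\<close> and \<open>g\<close>
  exchanged: this is how the two arcs swap roles.\<close>

lemma integral_24_Cauchy_Schwarz: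
  fixes f g :: "'a \<Rightarrow> complex"
  assumes f: "bounded_finsupp M f" and g: "bounded_finsupp M g"
  shows "(\<integral>x. cmod (f x) ^ 2 * cmod (g x) ^ 4 \<partial>M)\<^sup>2
    \<le> (\<integral>x. cmod (g x) ^ 2 * cmod (f x) ^ 4 \<partial>M) * (\<integral>x. cmod (g x) ^ 6 \<partial>M)"
proof -
  have "bounded_finsupp M (\<lambda>x. cmod (f x) ^ 2 * cmod (g x) ^ 1)" "bounded_finsupp M (\<lambda>x. cmod (g x) ^ 3)"
    using bounded_finsupp_mult_powers[OF f g, of 2 1] bounded_finsupp_norm_power[OF g, of 3] by simp_all
  from integral_Cauchy_Schwarz[OF this] show ?thesis
    by (simp add: power_mult_distrib power_mult[symmetric] mult.assoc mult.commute[of "cmod (g _) ^ 2"]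
        flip: power_Suc)
qed

text \<open>Exchanging the functions twice by the preceding inequality gives
  \<open>?X ^ 4 \<le> ?X * ?F * ?G ^ 2\<close>, and one factor \<open>?X\<close> cancels.\<close>

lemma integral_24_Hoelder:
  fixes f g :: "'a \<Rightarrow> complex"
  assumes f: "bounded_finsupp M f" and g: "bounded_finsupp M g"
  shows "(\<integral>x. cmod (f x) ^ 2 * cmod (g x) ^ 4 \<partial>M) ^ 3 \<le> (\<integral>x. cmod (f x) ^ 6 \<partial>M) * (\<integral>x. cmod (g x) ^ 6 \<partial>M)\<^sup>2"
proof -
  let ?X = "\<integral>x. cmod (f x) ^ 2 * cmod (g x) ^ 4 \<partial>M" and ?Y = "\<integral>x. cmod (g x) ^ 2 * cmod (f x) ^ 4 \<partial>M"
  let ?F = "\<integral>x. cmod (f x) ^ 6 \<partial>M" and ?G = "\<integral>x. cmod (g x) ^ 6 \<partial>M"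
  have nn: "?X \<ge> 0" "?Y \<ge> 0" "?F \<ge> 0" "?G \<ge> 0" by (intro Bochner_Integration.integral_nonneg; simp)+
  have "(?X\<^sup>2)\<^sup>2 \<le> (?Y * ?G)\<^sup>2"
    by (intro power_mono integral_24_Cauchy_Schwarz f g) simp
  also have "\<dots> = ?Y\<^sup>2 * ?G\<^sup>2" by (simp add: power_mult_distrib)
  also have "\<dots> \<le> (?X * ?F) * ?G\<^sup>2"
    by (intro mult_right_mono integral_24_Cauchy_Schwarz f g) simp
  finally have "?X * ?X ^ 3 \<le> ?X * (?F * ?G\<^sup>2)" by (simp add: power2_eq_square power3_eq_cube mult_ac)
  then show ?thesis using nn by (cases "?X = 0") (auto simp: mult_le_cancel_left)
qed

subsection \<open>Families of wave packets\<close>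

definition wave_family ::
  "int \<Rightarrow> 'q::prime_card padic set \<Rightarrow> ('q padic \<Rightarrow> 'q padic_fun) \<Rightarrow> bool" where
  "wave_family k A g \<longleftrightarrow> finite A \<and> (\<forall>a\<in>A. bounded_finsupp padic_haar2 (g a) \<and> padic_wave a k (g a)) \<and>
     (\<forall>a\<in>A. \<forall>b\<in>A. padic_le (a - b) (- k) \<longrightarrow> a = b)"

definition padic_diam_le :: "'q::prime_card padic set \<Rightarrow> int \<Rightarrow> bool" where
  "padic_diam_le A i \<longleftrightarrow> (\<forall>a\<in>A. \<forall>b\<in>A. padic_le (a - b) (- i))"

text \<open>By the ultrametric inequality these are the classes of an equivalence relation: the
  nonempty parts of \<open>A\<close> in intervals of length \<open>q ^ (-j)\<close>.\<close>

definition padic_classes :: "int \<Rightarrow> 'q::prime_card padic set \<Rightarrow> 'q padic set set" where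
  "padic_classes j A = (\<lambda>a. {b \<in> A. padic_le (b - a) (- j)}) ` A"

text \<open>The cube root of the integral is the squared norm in \<open>L^6\<close>, so this is the
  square of the l2 norm in the decoupling inequality, and its cube is compared with an integral of
  sixth powers. In this form it is additive over a partition of \<open>A\<close>.\<close>

definition norm6_sum ::
  "('q::prime_card padic \<Rightarrow> 'q padic_fun) \<Rightarrow> 'q padic set \<Rightarrow> real" where
  "norm6_sum g A = (\<Sum>a\<in>A. root 3 (\<integral>x. cmod (g a x) ^ 6 \<partial>padic_haar2))"

text \<open>Here \<open>n\<close> counts the scales between the separation \<open>q\<^sup>-\<^sup>k\<close> of \<open>A\<close> and its diameter \<open>q\<^sup>n\<^sup>-\<^sup>k\<close>. Quantifying over
  all \<open>k\<close> and all \<open>A \<subseteq> \<rat>\<^sub>q\<close> replaces parabolic rescaling.\<close>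

definition decoupling6 :: "'q::prime_card itself \<Rightarrow> nat \<Rightarrow> real \<Rightarrow> bool" where
  "decoupling6 _ n D \<longleftrightarrow> (\<forall>k (A :: 'q padic set) g. wave_family k A g \<longrightarrow> padic_diam_le A (k - int n) \<longrightarrow>
     (\<integral>x. cmod (\<Sum>a\<in>A. g a x) ^ 6 \<partial>padic_haar2) \<le> D * norm6_sum g A ^ 3)"

lemma wave_family_finite: "wave_family k A g \<Longrightarrow> finite A"
  by (simp add: wave_family_def)

lemma wave_family_subset: "wave_family k A g \<Longrightarrow> U \<subseteq> A \<Longrightarrow> wave_family k U g"
  unfolding wave_family_def by (meson finite_subset subsetD)

lemma padic_diam_le_subset: "padic_diam_le A i \<Longrightarrow> U \<subseteq> A \<Longrightarrow> padic_diam_le U i"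
  unfolding padic_diam_le_def by (meson subsetD)

lemma wave_family_bounded_finsupp:
  "wave_family k A g \<Longrightarrow> bounded_finsupp padic_haar2 (\<lambda>x. \<Sum>a\<in>A. g a x)"
  unfolding wave_family_def by (intro bounded_finsupp_sum) simp

lemma wave_family_wave_sum:
  fixes A :: "'q::prime_card padic set"
  assumes "wave_family k A g" "padic_diam_le A j" "c \<in> A" "j \<le> k"
  shows "padic_wave c j (\<lambda>x. \<Sum>a\<in>A. g a x)"
proof (rule padic_wave_sum)
  fix a assume "a \<in> A"
  show "padic_wave c j (g a)"
    by (rule padic_wave_coarsen[of a k]) (use \<open>a \<in> A\<close> assms in \<open>simp_all add: wave_family_def padic_diam_le_def\<close>)
qed

lemma norm6_sum_nonneg [simp]: "0 \<le> norm6_sum g A"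
  unfolding norm6_sum_def by (intro sum_nonneg) simp

lemma padic_classesD:
  fixes A :: "'q::prime_card padic set"
  assumes "U \<in> padic_classes j A"
  shows "U \<subseteq> A" "padic_diam_le U j" "U \<noteq> {}"
proof -
  obtain a where a: "a \<in> A" "U = {b \<in> A. padic_le (b - a) (- j)}"
    using assms by (auto simp: padic_classes_def)
  then show "U \<subseteq> A" "U \<noteq> {}" by auto
  show "padic_diam_le U j" unfolding padic_diam_le_def
  proof (intro ballI)
    fix x y assume "x \<in> U" "y \<in> U"
    then have "padic_le (x - a) (- j)" "padic_le (a - y) (- j)"
      using a(2) by (auto simp: padic_abs_minus_commute[of a])
    then show "padic_le (x - y) (- j)" by (rule padic_diff_le)
  qed
qed

lemma padic_classes_separated:
  fixes A :: "'q::prime_card padic set"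
  assumes "U \<in> padic_classes j A" "V \<in> padic_classes j A" "U \<noteq> V" "a \<in> U" "b \<in> V"
  shows "\<not> padic_le (a - b) (- j)"
proof
  let ?r = "real CARD('q) powi (- j)"
  assume ab: "padic_abs (a - b) \<le> ?r"
  obtain c where c: "U = {b \<in> A. padic_abs (b - c) \<le> ?r}" using assms by (auto simp: padic_classes_def)
  obtain d where d: "V = {b \<in> A. padic_abs (b - d) \<le> ?r}" using assms by (auto simp: padic_classes_def)
  have ac: "padic_abs (a - c) \<le> ?r" and bd: "padic_abs (b - d) \<le> ?r" using assms c d by auto
  have cd: "padic_abs (c - d) \<le> ?r"
    by (rule padic_diff_le[OF _ padic_diff_le[OF ab bd]]) (use ac in \<open>simp add: padic_abs_minus_commute\<close>)
  then have dc: "padic_abs (d - c) \<le> ?r" by (simp add: padic_abs_minus_commute)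
  have "U = V" unfolding c d using padic_diff_le[OF _ cd] padic_diff_le[OF _ dc] by blast
  then show False using assms by simp
qed

lemma finite_padic_classes: "finite A \<Longrightarrow> finite (padic_classes j A)"
  by (simp add: padic_classes_def)

lemma sum_padic_classes:
  fixes A :: "'q::prime_card padic set"
  assumes "finite A" shows "sum h A = (\<Sum>U\<in>padic_classes j A. sum h U)"
proof -
  have "\<Union> (padic_classes j A) = A" by (auto simp: padic_classes_def)
  moreover have "sum h (\<Union> (padic_classes j A)) = (sum \<circ> sum) h (padic_classes j A)"
  proof (rule sum.Union_disjoint)
    show "\<forall>U\<in>padic_classes j A. finite U"
      using finite_subset[OF padic_classesD(1) assms] by (intro ballI)
    show "\<forall>U\<in>padic_classes j A. \<forall>V\<in>padic_classes j A. U \<noteq> V \<longrightarrow> U \<inter> V = {}"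
    proof (intro ballI impI equals0I)
      fix U V x assume "U \<in> padic_classes j A" "V \<in> padic_classes j A" "U \<noteq> V" "x \<in> U \<inter> V"
      then have "\<not> padic_le (x - x) (- j)"
        by (intro padic_classes_separated) auto
      then show False by simp
    qed
  qed
  ultimately show ?thesis by simp
qed

lemma card_padic_classes:
  fixes A :: "'q::prime_card padic set"
  assumes A: "finite A" "padic_diam_le A i"
  shows "card (padic_classes (i + 1) A) \<le> CARD('q)"
proof -
  let ?r = "\<lambda>U :: 'q padic set. SOME a. a \<in> U"
  let ?C = "padic_classes (i + 1) A"
  have r: "?r U \<in> U" if "U \<in> ?C" for U using padic_classesD(3)[OF that] by (simp add: some_in_eq)
  have rA: "?r U \<in> A" if "U \<in> ?C" for U using r[OF that] padic_classesD(1)[OF that] by blast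
  have sep: "U = V" if "U \<in> ?C" "V \<in> ?C" "padic_le (?r U - ?r V) (- (i + 1))" for U V
    using padic_classes_separated[OF that(1,2) _ r r] that by blast
  have "card (?r ` ?C) \<le> CARD('q) ^ 1"
  proof (rule card_padic_separated[where i=i])
    show "finite (?r ` ?C)" using A finite_padic_classes by blast
    fix a b assume "a \<in> ?r ` ?C" "b \<in> ?r ` ?C"
    then obtain U V where ab: "a = ?r U" "b = ?r V" "U \<in> ?C" "V \<in> ?C" by blast
    show "padic_le (a - b) (- i)"
      using A(2) rA[OF ab(3)] rA[OF ab(4)] unfolding ab(1,2) padic_diam_le_def by blast
    assume "padic_le (a - b) (- i - int 1)"
    moreover have "- i - int 1 = - (i + 1)" by simp
    ultimately have "U = V" using sep[OF ab(3,4)] unfolding ab(1,2) by (simp only:)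
    then show "a = b" using ab by simp
  qed
  moreover have "inj_on ?r ?C"
  proof (rule inj_onI)
    fix U V assume UV: "U \<in> ?C" "V \<in> ?C" "?r U = ?r V"
    show "U = V" by (rule sep[OF UV(1,2)]) (unfold UV(3), simp)
  qed
  ultimately show ?thesis by (simp add: card_image)
qed

lemma decoupling6D:
  fixes A :: "'q::prime_card padic set"
  assumes "decoupling6 TYPE('q) m D" "wave_family k A g" "padic_diam_le A j" "int m = k - j"
  shows "(\<integral>x. cmod (\<Sum>a\<in>A. g a x) ^ 6 \<partial>padic_haar2) \<le> D * norm6_sum g A ^ 3"
proof -
  have "k - int m = j" using assms(4) by simp
  then show ?thesis using assms(1,2,3) unfolding decoupling6_def by metis
qed

subsection \<open>The bilinear estimate\<close>

text \<open>For \<open>V\<close> of length \<open>q ^ (-(i + b))\<close> at distance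
  \<open>q ^ (-i)\<close> from \<open>U\<close>, the weight lives at scale \<open>l = i + b\<close>
  and \<open>r = -i\<close>, so the orthogonal pieces have scale
  \<open>2 * l + r = i + 2 * b\<close>. The bound on the diameter of \<open>U\<close> keeps its
  points closer to each other than to \<open>V\<close>, as transversality requires.\<close>

lemma wave_family_transversal_split:
  fixes U V :: "'q::prime_card padic set"
  assumes odd: "odd CARD('q)" and U: "wave_family k U g" and V: "wave_family k V g"
    and i: "i + 2 * b \<le> k" "0 \<le> b"
    and dU: "padic_diam_le U (i + 1)" and dV: "padic_diam_le V (i + b)"
    and UV: "\<And>u v. u \<in> U \<Longrightarrow> v \<in> V \<Longrightarrow> padic_abs (u - v) = real CARD('q) powi (- i)"
  shows "(\<integral>x. cmod (\<Sum>a\<in>U. g a x) ^ 2 * cmod (\<Sum>a\<in>V. g a x) ^ 4 \<partial>padic_haar2)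
    = (\<Sum>W\<in>padic_classes (i + 2 * b) U. \<integral>x. cmod (\<Sum>a\<in>W. g a x) ^ 2 * cmod (\<Sum>a\<in>V. g a x) ^ 4 \<partial>padic_haar2)"
proof (cases "V = {}")
  case False
  then obtain c where c: "c \<in> V" by blast
  let ?C = "padic_classes (i + 2 * b) U" and ?f = "\<lambda>W x. \<Sum>a\<in>W. g a x"
  have fin: "finite U" using U by (rule wave_family_finite)
  have W: "wave_family k W g" if "W \<in> ?C" for W
    by (rule wave_family_subset[OF U padic_classesD(1)[OF that]])
  have wave: "padic_wave c (i + b) (?f V)"
    using wave_family_wave_sum[OF V dV c] i by simp
  have bV: "bounded_finsupp padic_haar2 (?f V)" by (rule wave_family_bounded_finsupp[OF V])
  have "(\<lambda>x. cmod (?f V x) ^ 4) \<in> borel_measurable padic_haar2"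
    using bounded_finsupp_norm_power[OF bV, of 4] by (intro bounded_finsupp_measurable) simp
  note wm = this
  obtain B where B: "\<And>x. \<bar>cmod (?f V x) ^ 4\<bar> \<le> B"
    using bounded_finsupp_norm_power[OF bV, of 4] by (auto simp: bounded_finsupp_def)
  have "(\<integral>x. cmod (\<Sum>W\<in>?C. ?f W x) ^ 2 * cmod (?f V x) ^ 4 \<partial>padic_haar2)
      = (\<Sum>W\<in>?C. \<integral>x. cmod (?f W x) ^ 2 * cmod (?f V x) ^ 4 \<partial>padic_haar2)"
  proof (rule padic_wave_sum_orthogonal[OF finite_padic_classes[OF fin] _ wm B])
    show "bounded_finsupp padic_haar2 (?f W)" if "W \<in> ?C" for W
      using W[OF that] by (rule wave_family_bounded_finsupp)
    fix W W' assume WW: "W \<in> ?C" "W' \<in> ?C" "W \<noteq> W'"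
    obtain w w' where w: "w \<in> W" "w' \<in> W'" using padic_classesD(3) WW by blast
    then have wU: "w \<in> U" "w' \<in> U" using padic_classesD(1) WW by blast+
    show "(\<integral>x. ?f W x * cnj (?f W' x) * complex_of_real (cmod (?f V x) ^ 4) \<partial>padic_haar2) = 0"
    proof (rule padic_wave_transversal_orthogonal[OF odd, where j="i + 2 * b" and l="i + b" and r="- i" and c=c])
      show "padic_wave w (i + 2 * b) (?f W)"
        by (rule wave_family_wave_sum[OF W[OF WW(1)] padic_classesD(2)[OF WW(1)] w(1) i(1)])
      show "padic_wave w' (i + 2 * b) (?f W')"
        by (rule wave_family_wave_sum[OF W[OF WW(2)] padic_classesD(2)[OF WW(2)] w(2) i(1)])
      show "?f W \<in> borel_measurable padic_haar2" "?f W' \<in> borel_measurable padic_haar2"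
        by (rule bounded_finsupp_measurable, rule wave_family_bounded_finsupp, rule W, rule WW)+
      show "cmod (?f V (fst x + t, snd x + u)) ^ 4 = cmod (?f V x) ^ 4"
        if "padic_le (t + 2 * c * u) (i + b)" "padic_le u (2 * (i + b))"
        for x t u using padic_wave_cmod[OF wave that, of x] by simp
      show "padic_abs (w - c) = real CARD('q) powi (- i)" "padic_abs (w' - c) = real CARD('q) powi (- i)"
        using UV wU c by auto
      have "- i - 1 = - (i + 1)" by simp
      then show "padic_le (w - w') (- i - 1)"
        using dU wU unfolding padic_diam_le_def by (simp only:)
      show "\<not> padic_le (w - w') (- (i + 2 * b))"
        by (rule padic_classes_separated[OF WW w])
    qed (use wm i in auto)
  qed
  moreover have "(\<Sum>W\<in>?C. ?f W x) = ?f U x" for x using sum_padic_classes[OF fin, of "\<lambda>a. g a x"] by simp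
  ultimately show ?thesis by (simp only:)
qed simp

text \<open>The step from \<open>t\<close> to \<open>t + 1\<close> applies the case \<open>t\<close> to \<open>V\<close> and the pieces of \<open>U\<close> of relative length
  \<open>q\<^sup>-\<^sup>2\<^sup>b\<close>, with the roles of the two arcs exchanged and \<open>b\<close> doubled; it gains the factor \<open>\<beta>\<^sup>b\<close> because
  \<open>\<integral> |f\<^sub>V|\<^sup>6\<close> only involves \<open>n - b\<close> scales.\<close>

lemma bilinear_decoupling6:
  fixes U V :: "'q::prime_card padic set"
  assumes odd: "odd CARD('q)" and C: "0 \<le> C" and \<beta>: "1 < \<beta>" and n: "int n = k - i"
    and D: "\<And>m. m < n \<Longrightarrow> decoupling6 TYPE('q) m (C * \<beta> ^ (2 * m))"
    and U: "wave_family k U g" and V: "wave_family k V g"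
    and ab: "1 \<le> a" "1 \<le> b" "a \<le> n" "2 ^ t * b \<le> n"
    and dU: "padic_diam_le U (i + int a)" and dV: "padic_diam_le V (i + int b)"
    and UV: "\<And>u v. u \<in> U \<Longrightarrow> v \<in> V \<Longrightarrow> padic_abs (u - v) = real CARD('q) powi (- i)"
  shows "(\<integral>x. cmod (\<Sum>a\<in>U. g a x) ^ 2 * cmod (\<Sum>a\<in>V. g a x) ^ 4 \<partial>padic_haar2)
    \<le> C * \<beta> ^ (2 * n) / \<beta> ^ (t * b) * norm6_sum g U * norm6_sum g V ^ 2"
  using U V ab dU dV UV
proof (induction t arbitrary: U V a b)
  case 0
  let ?U = "\<lambda>x. \<Sum>a\<in>U. g a x" and ?V = "\<lambda>x. \<Sum>a\<in>V. g a x"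
  \<comment> \<open>No saving is claimed for \<open>t = 0\<close>: since \<open>1 \<le> a\<close>
    and \<open>1 \<le> b\<close>, both arcs span fewer than \<open>n\<close> scales, where
    \<open>D\<close> is available, and its bound is enlarged to \<open>n\<close> scales.\<close>
  have le: "C * \<beta> ^ (2 * m) * norm6_sum g W ^ 3 \<le> C * \<beta> ^ (2 * n) * norm6_sum g W ^ 3"
    if "m < n" for m and W :: "'q padic set"
    using C \<beta> that by (intro mult_right_mono mult_left_mono power_increasing) auto
  have ba: "b \<le> n" using 0 by simp
  have bU: "bounded_finsupp padic_haar2 ?U" and bV: "bounded_finsupp padic_haar2 ?V"
    using 0 by (auto intro: wave_family_bounded_finsupp)
  have FU: "(\<integral>x. cmod (?U x) ^ 6 \<partial>padic_haar2) \<le> C * \<beta> ^ (2 * n) * norm6_sum g U ^ 3"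
    by (rule order_trans[OF decoupling6D[OF D[of "n - a"] 0(1) 0(7)] le]) (use 0 n in \<open>auto simp: of_nat_diff\<close>)
  have FV: "(\<integral>x. cmod (?V x) ^ 6 \<partial>padic_haar2) \<le> C * \<beta> ^ (2 * n) * norm6_sum g V ^ 3"
    by (rule order_trans[OF decoupling6D[OF D[of "n - b"] 0(2) 0(8)] le]) (use 0 n ba in \<open>auto simp: of_nat_diff\<close>)
  have "(\<integral>x. cmod (?U x) ^ 2 * cmod (?V x) ^ 4 \<partial>padic_haar2) ^ 3
      \<le> (\<integral>x. cmod (?U x) ^ 6 \<partial>padic_haar2) * (\<integral>x. cmod (?V x) ^ 6 \<partial>padic_haar2)\<^sup>2"
    by (rule integral_24_Hoelder[OF bU bV])
  also have "\<dots> \<le> (C * \<beta> ^ (2 * n) * norm6_sum g U ^ 3) * (C * \<beta> ^ (2 * n) * norm6_sum g V ^ 3)\<^sup>2"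
    using C \<beta> by (intro mult_mono power_mono FU FV Bochner_Integration.integral_nonneg) auto
  also have "\<dots> = (C * \<beta> ^ (2 * n) / \<beta> ^ (0 * b) * norm6_sum g U * norm6_sum g V ^ 2) ^ 3"
  proof -
    have "(C * y * u ^ 3) * (C * y * v ^ 3)\<^sup>2 = (C * y * u * v ^ 2) ^ 3" for y u v :: real
      by (simp add: power2_eq_square power3_eq_cube mult_ac)
    then show ?thesis by simp
  qed
  finally show ?case
    by (rule power_mono_iff[THEN iffD1, rotated 3])
       (use C \<beta> in \<open>auto intro!: Bochner_Integration.integral_nonneg mult_nonneg_nonneg\<close>)
next
  case (Suc t)
  have b2: "2 * b \<le> n" "b < n" using Suc.prems(4,6) order_trans[of "2 * b" "2 ^ Suc t * b" n] by auto
  let ?f = "\<lambda>W x. \<Sum>a\<in>W. g a x" and ?C = "padic_classes (i + 2 * int b) U"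
  let ?X = "\<lambda>W V. \<integral>x. cmod (?f W x) ^ 2 * cmod (?f V x) ^ 4 \<partial>padic_haar2" and ?S = "norm6_sum g"
  let ?K = "C * \<beta> ^ (2 * n) / \<beta> ^ (Suc t * b)"
  have fV: "(\<integral>x. cmod (?f V x) ^ 6 \<partial>padic_haar2) \<le> C * \<beta> ^ (2 * (n - b)) * ?S V ^ 3"
    by (rule decoupling6D[OF D[of "n - b"] Suc.prems(2) Suc.prems(8)]) (use Suc.prems n b2 in \<open>auto simp: of_nat_diff\<close>)
  have piece: "?X W V \<le> ?K * ?S W * ?S V ^ 2"
    if W: "W \<in> ?C" for W
  proof -
    note WU = padic_classesD[OF W]
    have fW: "wave_family k W g" by (rule wave_family_subset[OF Suc.prems(1) WU(1)])
    have IH: "?X V W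
        \<le> C * \<beta> ^ (2 * n) / \<beta> ^ (t * (2 * b)) * ?S V * ?S W ^ 2"
    proof (rule Suc.IH[OF Suc.prems(2) fW Suc.prems(4) _ _ _ Suc.prems(8)])
      show "1 \<le> 2 * b" "b \<le> n" "2 ^ t * (2 * b) \<le> n" using Suc.prems b2 by (auto simp: mult_ac)
      show "padic_diam_le W (i + int (2 * b))" using WU(2) by simp
      show "padic_abs (u - v) = real CARD('q) powi (- i)" if "u \<in> V" "v \<in> W" for u v
        using Suc.prems(9)[of v u] that WU(1) padic_abs_minus_commute[of u v] by auto
    qed
    have "(?X W V)\<^sup>2
        \<le> ?X V W * (\<integral>x. cmod (?f V x) ^ 6 \<partial>padic_haar2)"
      by (intro integral_24_Cauchy_Schwarz wave_family_bounded_finsupp[OF fW] wave_family_bounded_finsupp[OF Suc.prems(2)])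
    also have "\<dots> \<le> (C * \<beta> ^ (2 * n) / \<beta> ^ (t * (2 * b)) * ?S V * ?S W ^ 2)
        * (C * \<beta> ^ (2 * (n - b)) * ?S V ^ 3)"
      using C \<beta> by (intro mult_mono IH fV Bochner_Integration.integral_nonneg) auto
    \<comment> \<open>The exchanged integral saves \<open>\<beta> ^ (2 * t * b)\<close> and the
      \<open>n - b\<close> scales of \<open>V\<close> save \<open>\<beta> ^ (2 * b)\<close>.
      Together they are the square of \<open>\<beta> ^ (Suc t * b)\<close>, so the form of the bound
      reproduces itself.\<close>
    also have "\<dots> = (?K * ?S W * ?S V ^ 2)\<^sup>2"
    proof -
      have "\<beta> ^ (2 * n) = \<beta> ^ (2 * (n - b)) * (\<beta> ^ b)\<^sup>2"
        using b2 by (simp add: power_mult[symmetric] power_add[symmetric] algebra_simps)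
      then have "\<beta> ^ (2 * (n - b)) = \<beta> ^ (2 * n) / (\<beta> ^ b)\<^sup>2" using \<beta> by simp
      moreover have "\<beta> ^ (Suc t * b) = \<beta> ^ b * \<beta> ^ (t * b)" "\<beta> ^ (t * (2 * b)) = (\<beta> ^ (t * b))\<^sup>2"
        by (simp_all add: power_add power_mult[symmetric] algebra_simps)
      ultimately show ?thesis
        by (simp add: power_mult_distrib power_divide power2_eq_square power3_eq_cube mult_ac)
    qed
    finally show ?thesis
      by (rule power2_le_imp_le) (use C \<beta> in simp)
  qed
  have "?X U V
      = (\<Sum>W\<in>?C. ?X W V)"
  proof (rule wave_family_transversal_split[OF odd Suc.prems(1,2) _ _ _ Suc.prems(8,9)])
    show "padic_diam_le U (i + 1)"
      using Suc.prems(3,7) order_trans[of _ "real CARD('q) powi (- (i + int a))" "real CARD('q) powi (- (i + 1))"]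
      by (auto simp: padic_diam_le_def)
  qed (use n b2 in auto)
  also have "\<dots> \<le> (\<Sum>W\<in>?C. ?K * ?S W * ?S V ^ 2)" by (intro sum_mono piece)
  \<comment> \<open>Additivity of \<open>norm6_sum\<close> over the pieces: cutting \<open>U\<close>
    costs no constant.\<close>
  also have "\<dots> = ?K * ?S U * ?S V ^ 2"
    using sum_padic_classes[OF wave_family_finite[OF Suc.prems(1)], of "\<lambda>a. root 3 (\<integral>x. cmod (g a x) ^ 6 \<partial>padic_haar2)" "i + 2 * int b"]
    by (simp add: norm6_sum_def sum_distrib_left sum_distrib_right)
  finally show ?case .
qed

subsection \<open>Induction on scales\<close>

lemma root_3_cubed [simp]: "root 3 x ^ 3 = x"
  by (rule odd_real_root_pow) simp

lemma card_wave_family: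
  fixes A :: "'q::prime_card padic set"
  assumes A: "wave_family k A g" "padic_diam_le A (k - int n)"
  shows "card A \<le> CARD('q) ^ n"
proof (rule card_padic_separated[where i="k - int n"])
  show "finite A" using A(1) by (rule wave_family_finite)
  fix a b assume ab: "a \<in> A" "b \<in> A"
  then show "padic_le (a - b) (- (k - int n))"
    using A(2) by (simp add: padic_diam_le_def)
  assume "padic_le (a - b) (- (k - int n) - int n)"
  then show "a = b" using A(1) ab by (simp add: wave_family_def)
qed

text \<open>Hoelder's inequality over at most \<open>q ^ n\<close> arcs. The loss is exponential in
  \<open>n\<close>, which is harmless because the bound serves only a bounded range of
  \<open>n\<close>.\<close>

lemma decoupling6_trivial: "decoupling6 TYPE('q::prime_card) n (real CARD('q) ^ (5 * n))"
  unfolding decoupling6_def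
proof (intro allI impI)
  fix k and A :: "'q padic set" and g
  assume A: "wave_family k A g" "padic_diam_le A (k - int n)"
  have fin: "finite A" using A(1) by (rule wave_family_finite)
  have card: "card A \<le> CARD('q) ^ n" by (rule card_wave_family[OF A])
  have bf: "bounded_finsupp padic_haar2 (\<lambda>x. cmod (g a x) ^ 6)" if "a \<in> A" for a
    using A(1) that by (intro bounded_finsupp_norm_power) (auto simp: wave_family_def)
  have "(\<integral>x. cmod (\<Sum>a\<in>A. g a x) ^ 6 \<partial>padic_haar2)
      \<le> (\<integral>x. real (card A) ^ 5 * (\<Sum>a\<in>A. cmod (g a x) ^ 6) \<partial>padic_haar2)"
  proof (rule integral_mono)
    show "integrable padic_haar2 (\<lambda>x. cmod (\<Sum>a\<in>A. g a x) ^ 6)"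
      by (intro bounded_finsupp_integrable bounded_finsupp_norm_power wave_family_bounded_finsupp[OF A(1)]) simp
    show "integrable padic_haar2 (\<lambda>x. real (card A) ^ 5 * (\<Sum>a\<in>A. cmod (g a x) ^ 6))"
      by (intro integrable_mult_right Bochner_Integration.integrable_sum bounded_finsupp_integrable bf)
    fix x
    have "cmod (\<Sum>a\<in>A. g a x) ^ 6 \<le> (\<Sum>a\<in>A. cmod (g a x)) ^ 6" by (intro power_mono norm_sum) simp
    also have "\<dots> \<le> real (card A) ^ 5 * (\<Sum>a\<in>A. cmod (g a x) ^ 6)"
      using sum_power_le_card[OF fin, of "\<lambda>a. cmod (g a x)" 5] by simp
    finally show "cmod (\<Sum>a\<in>A. g a x) ^ 6 \<le> real (card A) ^ 5 * (\<Sum>a\<in>A. cmod (g a x) ^ 6)" .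
  qed
  also have "\<dots> = real (card A) ^ 5 * (\<Sum>a\<in>A. root 3 (\<integral>x. cmod (g a x) ^ 6 \<partial>padic_haar2) ^ Suc 2)"
    using bf by (simp add: bounded_finsupp_integrable numeral_3_eq_3[symmetric])
  also have "\<dots> \<le> (real CARD('q) ^ n) ^ 5 * norm6_sum g A ^ Suc 2"
    unfolding norm6_sum_def
  proof (intro mult_mono power_mono sum_power_le_power_sum fin)
    show "real (card A) \<le> real CARD('q) ^ n" using card by (metis of_nat_le_iff of_nat_power)
  qed (auto intro!: sum_nonneg)
  finally show "(\<integral>x. cmod (\<Sum>a\<in>A. g a x) ^ 6 \<partial>padic_haar2) \<le> real CARD('q) ^ (5 * n) * norm6_sum g A ^ 3"
    by (simp add: power_mult[symmetric] mult.commute numeral_3_eq_3)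
qed

text \<open>One scale is split off. A narrow arc spans \<open>n - 1\<close> scales and gains
  \<open>\<beta>\<^sup>2\<close>; a pair of distinct arcs falls under the bilinear estimate with
  \<open>a = b = 1\<close> and \<open>t = s\<close>, which needs \<open>2 ^ s \<le> n\<close> and
  gains \<open>\<beta> ^ s\<close>. The assumption \<open>small\<close> says that these gains pay
  for \<open>1 + \<eta>\<close> and \<open>K\<close>.\<close>

lemma decoupling6_step:
  assumes odd: "odd CARD('q::prime_card)" and C: "0 \<le> C" and \<beta>: "1 < \<beta>" and n: "2 ^ s \<le> n"
    and D: "\<And>m. m < n \<Longrightarrow> decoupling6 TYPE('q) m (C * \<beta> ^ (2 * m))"
    and \<eta>: "0 < \<eta>" and K: "0 \<le> K"
    and broad_narrow: "\<And>(J :: 'q padic set set) z. finite J \<Longrightarrow> card J \<le> CARD('q) \<Longrightarrow>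
      cmod (\<Sum>j\<in>J. z j) ^ 6 \<le> (1 + \<eta>) * (\<Sum>j\<in>J. cmod (z j) ^ 6)
      + K * (\<Sum>j\<in>J. \<Sum>l\<in>J - {j}. cmod (z j) ^ 2 * cmod (z l) ^ 4)"
    and small: "(1 + \<eta>) / \<beta>\<^sup>2 + K / \<beta> ^ s \<le> 1"
  shows "decoupling6 TYPE('q) n (C * \<beta> ^ (2 * n))"
  unfolding decoupling6_def
proof (intro allI impI)
  fix k and A :: "'q padic set" and g
  assume A: "wave_family k A g" and dA: "padic_diam_le A (k - int n)"
  let ?i = "k - int n" and ?f = "\<lambda>W x. \<Sum>a\<in>W. g a x"
  let ?C = "padic_classes (?i + 1) A" and ?S = "norm6_sum g"
  let ?I = "\<lambda>W. \<integral>x. cmod (?f W x) ^ 6 \<partial>padic_haar2" and ?b = "C * \<beta> ^ (2 * n)"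
  let ?X = "\<lambda>W V. \<integral>x. cmod (?f W x) ^ 2 * cmod (?f V x) ^ 4 \<partial>padic_haar2"
  let ?F = "\<lambda>x. \<Sum>W\<in>?C. cmod (?f W x) ^ 6"
  let ?G = "\<lambda>x. \<Sum>W\<in>?C. \<Sum>V\<in>?C - {W}. cmod (?f W x) ^ 2 * cmod (?f V x) ^ 4"
  have n1: "1 \<le> n" using n by (metis le_trans one_le_numeral one_le_power)
  have fin: "finite A" using A by (rule wave_family_finite)
  have finC: "finite ?C" using fin by (rule finite_padic_classes)
  have fW: "wave_family k W g" if "W \<in> ?C" for W by (rule wave_family_subset[OF A padic_classesD(1)[OF that]])
  have bW: "bounded_finsupp padic_haar2 (?f W)" if "W \<in> ?C" for W
    by (rule wave_family_bounded_finsupp[OF fW[OF that]])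
  have split: "(\<Sum>W\<in>?C. ?f W x) = ?f A x" for x using sum_padic_classes[OF fin, of "\<lambda>a. g a x"] by simp
  have S: "(\<Sum>W\<in>?C. ?S W) = ?S A" unfolding norm6_sum_def by (rule sum_padic_classes[OF fin, symmetric])
  have i6: "integrable padic_haar2 (\<lambda>x. cmod (?f W x) ^ 6)" if "W \<in> ?C" for W
    by (rule bounded_finsupp_integrable[OF bounded_finsupp_norm_power[OF bW[OF that]]]) simp
  have i24: "integrable padic_haar2 (\<lambda>x. cmod (?f W x) ^ 2 * cmod (?f V x) ^ 4)" if "W \<in> ?C" "V \<in> ?C" for W V
    by (rule bounded_finsupp_integrable[OF bounded_finsupp_mult_powers[OF bW[OF that(1)] bW[OF that(2)]]]) simp
  have narrow: "?I W \<le> ?b / \<beta>\<^sup>2 * ?S W ^ 3" if "W \<in> ?C" for W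
  proof -
    have "?I W \<le> C * \<beta> ^ (2 * (n - 1)) * ?S W ^ 3"
      by (rule decoupling6D[OF D[of "n - 1"] fW[OF that] padic_classesD(2)[OF that]])
         (use n1 in \<open>auto simp: of_nat_diff\<close>)
    moreover have "\<beta> ^ (2 * n) = \<beta> ^ (2 * (n - 1)) * \<beta>\<^sup>2"
      using n1 by (cases n) (simp_all add: power2_eq_square)
    ultimately show ?thesis using \<beta> by simp
  qed
  have broad: "?X W V \<le> ?b / \<beta> ^ s * ?S W * ?S V ^ 2"
    if W: "W \<in> ?C" and V: "V \<in> ?C - {W}" for W V
  proof -
    have V': "V \<in> ?C" "V \<noteq> W" using V by auto
    have "?X W V
        \<le> ?b / \<beta> ^ (s * 1) * ?S W * ?S V ^ 2"
    proof (rule bilinear_decoupling6[OF odd C \<beta> _ D fW[OF W] fW[OF V'(1)], where i="?i" and a=1])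
      show "padic_diam_le W (?i + int 1)" "padic_diam_le V (?i + int 1)"
        using padic_classesD(2)[OF W] padic_classesD(2)[OF V'(1)] by simp_all
      fix u v assume uv: "u \<in> W" "v \<in> V"
      \<comment> \<open>Absolute values are powers of \<open>q\<close>, so points of different
        classes within the diameter \<open>q ^ (- ?i)\<close> are at exactly this distance.\<close>
      have "\<not> padic_le (u - v) (- (?i + 1))"
        by (rule padic_classes_separated[OF W V'(1) V'(2)[symmetric] uv])
      moreover have "- (?i + 1) = - ?i - 1" by simp
      ultimately have "\<not> padic_le (u - v) (- ?i - 1)" by (simp only: not_False_eq_True)
      moreover have "padic_le (u - v) (- ?i)"
        using dA uv padic_classesD(1)[OF W] padic_classesD(1)[OF V'(1)] unfolding padic_diam_le_def
        by (meson subsetD)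
      ultimately show "padic_abs (u - v) = real CARD('q) powi (- ?i)" by (intro padic_abs_eq_powi)
    qed (use n n1 in auto)
    then show ?thesis by simp
  qed
  have "?I A
      \<le> (\<integral>x. (1 + \<eta>) * ?F x
        + K * ?G x \<partial>padic_haar2)"
  proof (rule integral_mono)
    show "integrable padic_haar2 (\<lambda>x. cmod (?f A x) ^ 6)"
      by (intro bounded_finsupp_integrable bounded_finsupp_norm_power wave_family_bounded_finsupp[OF A]) simp
    show "integrable padic_haar2 (\<lambda>x. (1 + \<eta>) * ?F x
        + K * ?G x)"
      by (intro Bochner_Integration.integrable_add integrable_mult_right Bochner_Integration.integrable_sum i6 i24) auto
    show "cmod (?f A x) ^ 6 \<le> (1 + \<eta>) * ?F x
        + K * ?G x" for x
      using broad_narrow[OF finC card_padic_classes[OF fin dA], of "\<lambda>W. ?f W x"] by (simp only: split)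
  qed
  also have "\<dots> = (1 + \<eta>) * (\<Sum>W\<in>?C. ?I W)
      + K * (\<Sum>W\<in>?C. \<Sum>V\<in>?C - {W}. ?X W V)"
  proof -
    have I6: "integrable padic_haar2 (\<lambda>x. \<Sum>W\<in>?C. cmod (?f W x) ^ 6)"
      by (intro Bochner_Integration.integrable_sum i6)
    have I24: "integrable padic_haar2 (\<lambda>x. \<Sum>V\<in>?C - {W}. cmod (?f W x) ^ 2 * cmod (?f V x) ^ 4)" if "W \<in> ?C" for W
      using that by (intro Bochner_Integration.integrable_sum i24) auto
    have "integrable padic_haar2 (\<lambda>x. \<Sum>W\<in>?C. \<Sum>V\<in>?C - {W}. cmod (?f W x) ^ 2 * cmod (?f V x) ^ 4)"
      by (intro Bochner_Integration.integrable_sum I24)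
    note I = I6 this
    have "(\<integral>x. (\<Sum>V\<in>?C - {W}. cmod (?f W x) ^ 2 * cmod (?f V x) ^ 4) \<partial>padic_haar2)
        = (\<Sum>V\<in>?C - {W}. ?X W V)" if "W \<in> ?C" for W
      using that by (intro Bochner_Integration.integral_sum i24) auto
    then have "(\<integral>x. ?G x \<partial>padic_haar2)
        = (\<Sum>W\<in>?C. \<Sum>V\<in>?C - {W}. ?X W V)"
      by (subst Bochner_Integration.integral_sum[OF I24]) simp_all
    moreover have "(\<integral>x. ?F x \<partial>padic_haar2)
        = (\<Sum>W\<in>?C. ?I W)"
      by (intro Bochner_Integration.integral_sum i6)
    ultimately show ?thesis using I by simp
  qed
  also have "\<dots> \<le> (1 + \<eta>) * (\<Sum>W\<in>?C. ?b / \<beta>\<^sup>2 * ?S W ^ 3)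
      + K * (\<Sum>W\<in>?C. \<Sum>V\<in>?C - {W}. ?b / \<beta> ^ s * ?S W * ?S V ^ 2)"
    using \<eta> K by (intro add_mono mult_left_mono sum_mono narrow broad) auto
  also have "\<dots> = (1 + \<eta>) * (?b / \<beta>\<^sup>2 * (\<Sum>W\<in>?C. ?S W ^ 3))
      + K * (?b / \<beta> ^ s * (\<Sum>W\<in>?C. \<Sum>V\<in>?C - {W}. ?S W * ?S V ^ 2))"
    by (simp only: sum_distrib_left mult.assoc)
  also have "\<dots> \<le> (1 + \<eta>) * (?b / \<beta>\<^sup>2 * ?S A ^ 3) + K * (?b / \<beta> ^ s * ?S A ^ 3)"
  proof -
    \<comment> \<open>The powers are summed with constant 1, by the inclusion of l1 in l2 and l3. A
      factor here would recur at every scale and destroy the induction.\<close>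
    have S3: "(\<Sum>W\<in>?C. ?S W ^ Suc m) \<le> ?S A ^ Suc m" for m
      using sum_power_le_power_sum[OF finC, of ?S m] unfolding S by simp
    have "(\<Sum>W\<in>?C. \<Sum>V\<in>?C - {W}. ?S W * ?S V ^ 2) \<le> (\<Sum>W\<in>?C. \<Sum>V\<in>?C. ?S W * ?S V ^ 2)"
      using finC by (intro sum_mono sum_mono2) auto
    also have "\<dots> = (\<Sum>W\<in>?C. ?S W) * (\<Sum>V\<in>?C. ?S V ^ 2)" by (simp only: sum_product)
    also have "\<dots> \<le> ?S A * ?S A ^ 2" unfolding S using S3[of 1] by (intro mult_left_mono) (simp_all add: numeral_2_eq_2)
    also have "\<dots> = ?S A ^ 3" by (simp add: power2_eq_square power3_eq_cube)
    finally show ?thesis using \<eta> K C \<beta> S3[of 2]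
      by (intro add_mono mult_left_mono mult_nonneg_nonneg divide_nonneg_nonneg) (simp_all add: numeral_3_eq_3)
  qed
  also have "\<dots> = ?b * ?S A ^ 3 * ((1 + \<eta>) / \<beta>\<^sup>2 + K / \<beta> ^ s)"
    by (simp add: algebra_simps)
  also have "\<dots> \<le> ?b * ?S A ^ 3 * 1"
    using C \<beta> by (intro mult_left_mono small mult_nonneg_nonneg) auto
  finally show "?I A \<le> ?b * ?S A ^ 3" by simp
qed

text \<open>The constants are chosen in the order \<beta>, \<eta>, \<open>K\<close>,
  \<open>s\<close>, \<open>C\<close>. As \<open>K\<close> depends on \<eta> and \<open>q\<close> but
  not on \<open>s\<close>, the number of steps can be taken large enough to absorb it. Values of
  \<beta> near 1 make \<open>\<beta> ^ (2 * n)\<close> an arbitrarily small power of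
  \<open>q ^ n\<close>.\<close>

theorem decoupling6_critical:
  assumes odd: "odd CARD('q::prime_card)" and \<beta>: "1 < \<beta>"
  shows "\<exists>C>0. \<forall>n. decoupling6 TYPE('q) n (C * \<beta> ^ (2 * n))"
proof -
  \<comment> \<open>\<open>1 + \<eta>\<close> is the midpoint of 1 and
    \<open>\<beta>\<^sup>2\<close>: the narrow part then leaves room for the bilinear part.\<close>
  define \<eta> where "\<eta> = (\<beta>\<^sup>2 - 1) / 2"
  have \<beta>2: "\<beta>\<^sup>2 > 1" using \<beta> by (simp add: one_less_power)
  then have \<eta>: "\<eta> > 0" by (simp add: \<eta>_def)
  obtain K where K: "K \<ge> 0" "\<And>(J :: 'q padic set set) z. finite J \<Longrightarrow> card J \<le> CARD('q) \<Longrightarrow>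
      cmod (\<Sum>j\<in>J. z j) ^ 6 \<le> (1 + \<eta>) * (\<Sum>j\<in>J. cmod (z j) ^ 6)
      + K * (\<Sum>j\<in>J. \<Sum>l\<in>J - {j}. cmod (z j) ^ 2 * cmod (z l) ^ 4)"
    using broad_narrow[OF \<eta>, of "CARD('q)"] by blast
  have gap: "(1 + \<eta>) / \<beta>\<^sup>2 < 1" 
  proof -
    have "1 + \<eta> < \<beta>\<^sup>2" using \<beta>2 by (simp add: \<eta>_def field_simps)
    then show ?thesis using \<beta>2 by (simp add: divide_less_eq)
  qed
  obtain s where s: "K / (1 - (1 + \<eta>) / \<beta>\<^sup>2) < \<beta> ^ s" using real_arch_pow[OF \<beta>] by blast
  have small: "(1 + \<eta>) / \<beta>\<^sup>2 + K / \<beta> ^ s \<le> 1"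
  proof -
    have "K < \<beta> ^ s * (1 - (1 + \<eta>) / \<beta>\<^sup>2)" using s gap by (simp only: pos_divide_less_eq diff_gt_0_iff_gt)
    moreover have "0 < \<beta> ^ s" using \<beta> by simp
    ultimately have "K / \<beta> ^ s \<le> 1 - (1 + \<eta>) / \<beta>\<^sup>2"
      by (simp only: pos_divide_le_eq mult.commute less_imp_le)
    then show ?thesis by simp
  qed
  \<comment> \<open>Covers \<open>decoupling6_trivial\<close> for all \<open>n < 2 ^ s\<close>,
    where there are too few scales for \<open>s\<close> steps.\<close>
  define C where "C = real CARD('q) ^ (5 * 2 ^ s)"
  have C: "C > 0" unfolding C_def using CARD_gt_1(2)[where 'q='q] by simp
  have "decoupling6 TYPE('q) n (C * \<beta> ^ (2 * n))" for n
  proof (induction n rule: less_induct)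
    case (less n)
    show ?case
    proof (cases "2 ^ s \<le> n")
      case True
      show ?thesis
        by (rule decoupling6_step[OF odd _ \<beta> True less \<eta> K small]) (use C in simp)
    next
      case False
      have "real CARD('q) ^ (5 * n) \<le> C"
        unfolding C_def using False CARD_gt_1(1)[where 'q='q] by (intro power_increasing) auto
      also have "\<dots> \<le> C * \<beta> ^ (2 * n)" using C \<beta> by (simp add: one_le_power)
      finally have "real CARD('q) ^ (5 * n) * norm6_sum g A ^ 3 \<le> C * \<beta> ^ (2 * n) * norm6_sum g A ^ 3"
        for g and A :: "'q padic set" by (intro mult_right_mono) auto
      then show ?thesis using decoupling6_trivial[of n, where 'q='q] unfolding decoupling6_def
        by (meson order_trans)
    qed
  qed
  then show ?thesis using C by blast
qed

section \<open>Interpolation\<close>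

lemma nn_integral_powr_lessThan:
  fixes y :: real
  assumes "-1 < e" "0 \<le> y"
  shows "(\<integral>\<^sup>+s. (if 0 < s \<and> s < y then ennreal (s powr e) else 0) \<partial>lborel) = ennreal (y powr (e + 1) / (e + 1))"
proof -
  have "(\<integral>\<^sup>+s. ennreal (indicator {0..y} s * s powr e) \<partial>lborel) = ennreal (y powr (e + 1) / (e + 1))"
    by (rule nn_integral_has_integral_lebesgue[OF _ has_integral_powr_from_0[OF assms]]) simp
  moreover have "(\<integral>\<^sup>+s. (if 0 < s \<and> s < y then ennreal (s powr e) else 0) \<partial>lborel)
      = (\<integral>\<^sup>+s. ennreal (indicator {0..y} s * s powr e) \<partial>lborel)"
  proof (rule nn_integral_cong_AE)
    show "AE s in lborel. (if 0 < s \<and> s < y then ennreal (s powr e) else 0) = ennreal (indicator {0..y} s * s powr e)"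
      using AE_lborel_singleton[of 0] AE_lborel_singleton[of y]
      by eventually_elim (auto simp: indicator_def)
  qed
  ultimately show ?thesis by simp
qed

lemma nn_integral_powr_atLeast:
  fixes y :: real
  assumes "e < -1" "0 < y"
  shows "(\<integral>\<^sup>+s. (if y \<le> s then ennreal (s powr e) else 0) \<partial>lborel) = ennreal (y powr (e + 1) / - (e + 1))"
proof -
  have "(\<integral>\<^sup>+s. ennreal (indicator {y..} s * s powr e) \<partial>lborel) = ennreal (- (y powr (e + 1)) / (e + 1))"
    by (rule nn_integral_has_integral_lebesgue[OF _ has_integral_powr_to_inf[OF assms]]) simp
  moreover have "(\<integral>\<^sup>+s. (if y \<le> s then ennreal (s powr e) else 0) \<partial>lborel)
      = (\<integral>\<^sup>+s. ennreal (indicator {y..} s * s powr e) \<partial>lborel)"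
    by (intro nn_integral_cong) (auto simp: indicator_def)
  ultimately show ?thesis by (simp add: minus_divide_right)
qed

context sigma_finite_measure
begin

text \<open>After exchanging the integrals, \<open>s powr (p - 1 - r)\<close> is integrated over
  \<open>0 < s < K * u x\<close>, which converges at 0 because \<open>r < p\<close>. In the
  counterpart for small values the range is \<open>s \<ge> K * u x\<close>, with convergence at
  infinity because \<open>p < r\<close>.\<close>

lemma nn_integral_truncate_above:
  fixes u :: "'a \<Rightarrow> real"
  assumes [measurable]: "u \<in> borel_measurable M" and u: "\<And>x. 0 \<le> u x" and "r < p" "0 < K"
  shows "(\<integral>\<^sup>+s. (if 0 < s then ennreal (s powr (p - 1 - r)) else 0) *
      (\<integral>\<^sup>+x. (if s < K * u x then ennreal (u x powr r) else 0) \<partial>M) \<partial>lborel)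
    = ennreal (K powr (p - r) / (p - r)) * (\<integral>\<^sup>+x. ennreal (u x powr p) \<partial>M)"
proof -
  interpret P: pair_sigma_finite M lborel ..
  let ?w = "\<lambda>s. if 0 < s then ennreal (s powr (p - 1 - r)) else 0"
  let ?v = "\<lambda>s x. if s < K * u x then ennreal (u x powr r) else 0"
  let ?c = "K powr (p - r) / (p - r)"
  have "(\<integral>\<^sup>+s. ?w s * (\<integral>\<^sup>+x. ?v s x \<partial>M) \<partial>lborel)
      = (\<integral>\<^sup>+s. (\<integral>\<^sup>+x. ?w s * ?v s x \<partial>M) \<partial>lborel)"
    by (intro nn_integral_cong nn_integral_cmult[symmetric]) measurable
  also have "\<dots> = (\<integral>\<^sup>+x. (\<integral>\<^sup>+s. ?w s * ?v s x \<partial>lborel) \<partial>M)"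
    by (rule P.Fubini') measurable
  also have "\<dots> = (\<integral>\<^sup>+x. ennreal (?c) * ennreal (u x powr p) \<partial>M)"
  proof (rule nn_integral_cong)
    fix x
    have "(\<integral>\<^sup>+s. ?w s * ?v s x \<partial>lborel)
        = (\<integral>\<^sup>+s. ennreal (u x powr r) * (if 0 < s \<and> s < K * u x then ennreal (s powr (p - 1 - r)) else 0) \<partial>lborel)"
      by (intro nn_integral_cong) (auto simp: mult.commute)
    also have "\<dots> = ennreal (u x powr r) * ennreal ((K * u x) powr (p - r) / (p - r))"
      using assms u[of x] nn_integral_powr_lessThan[of "p - 1 - r" "K * u x"]
      by (subst nn_integral_cmult) simp_all
    also have "\<dots> = ennreal (?c) * ennreal (u x powr p)"
    proof -
      have "u x powr r * ((K * u x) powr (p - r) / (p - r)) = ?c * u x powr p"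
        using assms u[of x] powr_add[of "u x" r "p - r"] by (simp add: powr_mult)
      then show ?thesis using assms by (simp add: ennreal_mult[symmetric])
    qed
    finally show "(\<integral>\<^sup>+s. ?w s * ?v s x \<partial>lborel)
        = ennreal (?c) * ennreal (u x powr p)" .
  qed
  also have "\<dots> = ennreal (?c) * (\<integral>\<^sup>+x. ennreal (u x powr p) \<partial>M)"
    by (rule nn_integral_cmult) measurable
  finally show ?thesis .
qed

lemma nn_integral_truncate_below:
  fixes u :: "'a \<Rightarrow> real"
  assumes [measurable]: "u \<in> borel_measurable M" and u: "\<And>x. 0 \<le> u x" and "p < r" "0 < K"
  shows "(\<integral>\<^sup>+s. (if 0 < s then ennreal (s powr (p - 1 - r)) else 0) *
      (\<integral>\<^sup>+x. (if s < K * u x then 0 else ennreal (u x powr r)) \<partial>M) \<partial>lborel)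
    = ennreal (K powr (p - r) / (r - p)) * (\<integral>\<^sup>+x. ennreal (u x powr p) \<partial>M)"
proof -
  interpret P: pair_sigma_finite M lborel ..
  let ?w = "\<lambda>s. if 0 < s then ennreal (s powr (p - 1 - r)) else 0"
  let ?v = "\<lambda>s x. if s < K * u x then 0 else ennreal (u x powr r)"
  let ?c = "K powr (p - r) / (r - p)"
  have "(\<integral>\<^sup>+s. ?w s * (\<integral>\<^sup>+x. ?v s x \<partial>M) \<partial>lborel)
      = (\<integral>\<^sup>+s. (\<integral>\<^sup>+x. ?w s * ?v s x \<partial>M) \<partial>lborel)"
    by (intro nn_integral_cong nn_integral_cmult[symmetric]) measurable
  also have "\<dots> = (\<integral>\<^sup>+x. (\<integral>\<^sup>+s. ?w s * ?v s x \<partial>lborel) \<partial>M)"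
    by (rule P.Fubini') measurable
  also have "\<dots> = (\<integral>\<^sup>+x. ennreal (?c) * ennreal (u x powr p) \<partial>M)"
  proof (rule nn_integral_cong)
    fix x
    show "(\<integral>\<^sup>+s. ?w s * ?v s x \<partial>lborel)
        = ennreal (?c) * ennreal (u x powr p)"
    proof (cases "u x = 0")
      case False
      then have ux: "0 < u x" using u[of x] by simp
      then have Ku: "0 < K * u x" using assms by simp
      have "(\<integral>\<^sup>+s. ?w s * ?v s x \<partial>lborel)
          = (\<integral>\<^sup>+s. ennreal (u x powr r) * (if K * u x \<le> s then ennreal (s powr (p - 1 - r)) else 0) \<partial>lborel)"
        using Ku by (intro nn_integral_cong) (auto simp: mult.commute)
      also have "\<dots> = ennreal (u x powr r) * ennreal ((K * u x) powr (p - r) / (r - p))"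
        using assms Ku nn_integral_powr_atLeast[of "p - 1 - r" "K * u x"]
        by (subst nn_integral_cmult) simp_all
      also have "\<dots> = ennreal (?c) * ennreal (u x powr p)"
      proof -
        have "u x powr r * ((K * u x) powr (p - r) / (r - p)) = ?c * u x powr p"
          using assms ux powr_add[of "u x" r "p - r"] by (simp add: powr_mult)
        then show ?thesis using assms by (simp add: ennreal_mult[symmetric])
      qed
      finally show ?thesis .
    next
      case True
      then have "?v s x = 0" for s by simp
      then show ?thesis using True by (simp only:) simp
    qed
  qed
  also have "\<dots> = ennreal (?c) * (\<integral>\<^sup>+x. ennreal (u x powr p) \<partial>M)"
    by (rule nn_integral_cmult) measurable
  finally show ?thesis .
qed

text \<open>Marcinkiewicz interpolation with a separate cut for each \<open>u i\<close>, at height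
  \<open>s / K i\<close>. The assumed bound on the distribution function is linear in the truncated
  integrals, so that it can be integrated against \<open>s powr (p - 1)\<close> term by
  term.\<close>

lemma nn_integral_powr_interpolate:
  fixes F :: "'a \<Rightarrow> real" and u :: "'i \<Rightarrow> 'a \<Rightarrow> real"
  assumes [measurable]: "F \<in> borel_measurable M" and F: "\<And>x. 0 \<le> F x"
    and um: "\<And>i. i \<in> I \<Longrightarrow> u i \<in> borel_measurable M" and u: "\<And>i x. 0 \<le> u i x"
    and K: "\<And>i. i \<in> I \<Longrightarrow> 0 < K i" and \<alpha>: "\<And>i. i \<in> I \<Longrightarrow> 0 \<le> \<alpha> i" and \<beta>: "\<And>i. i \<in> I \<Longrightarrow> 0 \<le> \<beta> i"
    and p: "r0 < p" "p < r1" "0 < p"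
    and weak: "\<And>s. 0 < s \<Longrightarrow> (\<integral>\<^sup>+x. (if s < F x then 1 else 0) \<partial>M) \<le>
      (\<Sum>i\<in>I. ennreal (\<alpha> i * s powr - r0) * (\<integral>\<^sup>+x. (if s < K i * u i x then ennreal (u i x powr r0) else 0) \<partial>M)) +
      (\<Sum>i\<in>I. ennreal (\<beta> i * s powr - r1) * (\<integral>\<^sup>+x. (if s < K i * u i x then 0 else ennreal (u i x powr r1)) \<partial>M))"
  shows "(\<integral>\<^sup>+x. ennreal (F x powr p) \<partial>M) \<le> ennreal p *
      (\<Sum>i\<in>I. ennreal (\<alpha> i * (K i powr (p - r0) / (p - r0)) + \<beta> i * (K i powr (p - r1) / (r1 - p)))
        * (\<integral>\<^sup>+x. ennreal (u i x powr p) \<partial>M))"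
proof -
  let ?w = "\<lambda>r s. if 0 < s then ennreal (s powr (p - 1 - r)) else 0"
  let ?hi = "\<lambda>i s. \<integral>\<^sup>+x. (if s < K i * u i x then ennreal (u i x powr r0) else 0) \<partial>M"
  let ?lo = "\<lambda>i s. \<integral>\<^sup>+x. (if s < K i * u i x then 0 else ennreal (u i x powr r1)) \<partial>M"
  let ?N = "\<lambda>i. \<integral>\<^sup>+x. ennreal (u i x powr p) \<partial>M"
  have hm: "?hi i \<in> borel_measurable lborel" "?lo i \<in> borel_measurable lborel" if "i \<in> I" for i
    using um[OF that] by measurable
  \<comment> \<open>The layer cake formula for \<open>F\<close>, obtained as the case
    \<open>r = 0\<close>, \<open>K = 1\<close> of the truncation lemma.\<close>
  have "ennreal (1 / p) * (\<integral>\<^sup>+x. ennreal (F x powr p) \<partial>M)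
      = (\<integral>\<^sup>+s. ?w 0 s * (\<integral>\<^sup>+x. (if s < 1 * F x then ennreal (F x powr 0) else 0) \<partial>M) \<partial>lborel)"
    using nn_integral_truncate_above[of F 0 p 1] p F by simp
  also have "\<dots> \<le> (\<integral>\<^sup>+s. (\<Sum>i\<in>I. ennreal (\<alpha> i) * (?w r0 s * ?hi i s))
      + (\<Sum>i\<in>I. ennreal (\<beta> i) * (?w r1 s * ?lo i s)) \<partial>lborel)"
  proof (rule nn_integral_mono)
    fix s :: real
    show "?w 0 s * (\<integral>\<^sup>+x. (if s < 1 * F x then ennreal (F x powr 0) else 0) \<partial>M) \<le>
        (\<Sum>i\<in>I. ennreal (\<alpha> i) * (?w r0 s * ?hi i s)) + (\<Sum>i\<in>I. ennreal (\<beta> i) * (?w r1 s * ?lo i s))"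
    proof (cases "0 < s")
      case True
      have split: "ennreal (s powr (p - 1)) * ennreal (c * s powr - r) = ennreal c * ennreal (s powr (p - 1 - r))"
        if "0 \<le> c" for c r
        using that by (simp add: ennreal_mult[symmetric] powr_add[symmetric] mult.left_commute)
      have "(\<integral>\<^sup>+x. (if s < 1 * F x then ennreal (F x powr 0) else 0) \<partial>M) = (\<integral>\<^sup>+x. (if s < F x then 1 else 0) \<partial>M)"
        using True by (intro nn_integral_cong) auto
      then have "?w 0 s * (\<integral>\<^sup>+x. (if s < 1 * F x then ennreal (F x powr 0) else 0) \<partial>M)
        \<le> ennreal (s powr (p - 1)) * ((\<Sum>i\<in>I. ennreal (\<alpha> i * s powr - r0) * ?hi i s)
          + (\<Sum>i\<in>I. ennreal (\<beta> i * s powr - r1) * ?lo i s))"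
        using True weak[OF True] by (simp add: mult_left_mono)
      also have "\<dots> = (\<Sum>i\<in>I. ennreal (\<alpha> i) * (?w r0 s * ?hi i s)) + (\<Sum>i\<in>I. ennreal (\<beta> i) * (?w r1 s * ?lo i s))"
        unfolding distrib_left sum_distrib_left mult.assoc[symmetric] using True \<alpha> \<beta>
        by (intro arg_cong2[where f="(+)"] sum.cong refl) (simp_all add: split)
      finally show ?thesis .
    qed simp
  qed
  also have "\<dots> = (\<Sum>i\<in>I. ennreal (\<alpha> i) * (\<integral>\<^sup>+s. ?w r0 s * ?hi i s \<partial>lborel))
      + (\<Sum>i\<in>I. ennreal (\<beta> i) * (\<integral>\<^sup>+s. ?w r1 s * ?lo i s \<partial>lborel))"
    using hm by (simp add: nn_integral_add nn_integral_sum nn_integral_cmult)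
  also have "\<dots> = (\<Sum>i\<in>I. ennreal (\<alpha> i) * (ennreal (K i powr (p - r0) / (p - r0)) * ?N i))
      + (\<Sum>i\<in>I. ennreal (\<beta> i) * (ennreal (K i powr (p - r1) / (r1 - p)) * ?N i))"
    using nn_integral_truncate_above[OF um u p(1) K] nn_integral_truncate_below[OF um u p(2) K]
    by (intro arg_cong2[where f="(+)"] sum.cong refl) simp_all
  also have "\<dots> = (\<Sum>i\<in>I. ennreal (\<alpha> i * (K i powr (p - r0) / (p - r0)) + \<beta> i * (K i powr (p - r1) / (r1 - p))) * ?N i)"
    unfolding sum.distrib[symmetric]
  proof (intro sum.cong refl)
    fix i assume i: "i \<in> I"
    let ?c = "K i powr (p - r0) / (p - r0)" and ?d = "K i powr (p - r1) / (r1 - p)"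
    have cd: "0 \<le> ?c" "0 \<le> ?d" using p by simp_all
    have "ennreal (\<alpha> i * ?c + \<beta> i * ?d) = ennreal (\<alpha> i) * ennreal ?c + ennreal (\<beta> i) * ennreal ?d"
      using cd \<alpha>[OF i] \<beta>[OF i] by (simp only: ennreal_plus ennreal_mult mult_nonneg_nonneg)
    then show "ennreal (\<alpha> i) * (ennreal ?c * ?N i) + ennreal (\<beta> i) * (ennreal ?d * ?N i)
        = ennreal (\<alpha> i * ?c + \<beta> i * ?d) * ?N i"
      by (simp only: distrib_right mult.assoc)
  qed
  finally have *: "ennreal (1 / p) * (\<integral>\<^sup>+x. ennreal (F x powr p) \<partial>M) \<le> \<dots>" .
  have "ennreal p * ennreal (1 / p) = 1" using p by (simp add: ennreal_mult[symmetric])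
  then have "(\<integral>\<^sup>+x. ennreal (F x powr p) \<partial>M) = ennreal p * (ennreal (1 / p) * (\<integral>\<^sup>+x. ennreal (F x powr p) \<partial>M))"
    by (simp add: mult.assoc[symmetric])
  also have "\<dots> \<le> ennreal p * (\<Sum>i\<in>I. ennreal (\<alpha> i * (K i powr (p - r0) / (p - r0)) + \<beta> i * (K i powr (p - r1) / (r1 - p))) * ?N i)"
    by (rule mult_left_mono[OF *]) simp
  finally show ?thesis .
qed

end

subsection \<open>Decoupling for wave packets\<close>

definition norm_powr_integral :: "real \<Rightarrow> ('q::prime_card padic_fun) \<Rightarrow> real" where
  "norm_powr_integral p f = (\<integral>x. cmod (f x) powr p \<partial>padic_haar2)"

definition square_norm_sum :: "real \<Rightarrow> ('q::prime_card padic \<Rightarrow> 'q padic_fun) \<Rightarrow> 'q padic set \<Rightarrow> real" where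
  "square_norm_sum p g A = (\<Sum>a\<in>A. (norm_powr_integral p (g a) powr (1 / p))\<^sup>2)"

lemma norm_powr_integral_nonneg [simp]: "0 \<le> norm_powr_integral p f"
  unfolding norm_powr_integral_def by (intro Bochner_Integration.integral_nonneg) simp

lemma square_norm_sum_nonneg [simp]: "0 \<le> square_norm_sum p g A"
  unfolding square_norm_sum_def by (intro sum_nonneg) simp

lemma norm_powr_integral_power:
  "0 < n \<Longrightarrow> norm_powr_integral (real n) f = (\<integral>x. cmod (f x) ^ n \<partial>padic_haar2)"
  unfolding norm_powr_integral_def by (simp add: powr_realpow')

lemma nn_integral_norm_powr:
  assumes "bounded_finsupp padic_haar2 f" "0 \<le> p"
  shows "(\<integral>\<^sup>+x. ennreal (cmod (f x) powr p) \<partial>padic_haar2) = ennreal (norm_powr_integral p f)"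
  unfolding norm_powr_integral_def
  by (intro nn_integral_eq_integral bounded_finsupp_integrable bounded_finsupp_norm_powr assms) simp

lemma wave_family_truncate:
  assumes "wave_family k A g" and S: "\<And>a. S a \<in> sets borel"
  shows "wave_family k A (\<lambda>a x. g a x * indicator (S a) (cmod (g a x)))"
  unfolding wave_family_def
proof (intro conjI ballI)
  fix a assume "a \<in> A"
  then have g: "bounded_finsupp padic_haar2 (g a)" "padic_wave a k (g a)"
    using assms by (auto simp: wave_family_def)
  show "bounded_finsupp padic_haar2 (\<lambda>x. g a x * indicator (S a) (cmod (g a x)))"
  proof (rule bounded_finsupp_mult[OF g(1), where C=1])
    have "(\<lambda>x. cmod (g a x)) \<in> borel_measurable padic_haar2" using g(1) by measurable
    then show "(\<lambda>x. indicator (S a) (cmod (g a x)) :: complex) \<in> borel_measurable padic_haar2"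
      using S[of a] by measurable
  qed (simp add: indicator_def)
  show "padic_wave a k (\<lambda>x. g a x * indicator (S a) (cmod (g a x)))"
    using padic_wave_truncate[OF g(2), of "indicator (S a)"] .
qed (use assms in \<open>simp_all add: wave_family_def\<close>)

lemma truncate_norm_power_integral:
  assumes g: "bounded_finsupp padic_haar2 g" and S: "S \<in> sets borel" and n: "0 < n"
  shows "ennreal (\<integral>x. cmod (g x * indicator S (cmod (g x))) ^ n \<partial>padic_haar2)
    = (\<integral>\<^sup>+x. (if cmod (g x) \<in> S then ennreal (cmod (g x) powr real n) else 0) \<partial>padic_haar2)"
proof -
  have m: "(\<lambda>x. cmod (g x)) \<in> borel_measurable padic_haar2" using g by measurable
  have "bounded_finsupp padic_haar2 (\<lambda>x. g x * indicator S (cmod (g x)))"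
    by (rule bounded_finsupp_mult[OF g, where C=1]) (use m S in \<open>auto simp: indicator_def\<close>)
  then have "integrable padic_haar2 (\<lambda>x. cmod (g x * indicator S (cmod (g x))) ^ n)"
    using n by (intro bounded_finsupp_integrable bounded_finsupp_norm_power)
  then have "ennreal (\<integral>x. cmod (g x * indicator S (cmod (g x))) ^ n \<partial>padic_haar2)
      = (\<integral>\<^sup>+x. ennreal (cmod (g x * indicator S (cmod (g x))) ^ n) \<partial>padic_haar2)"
    by (intro nn_integral_eq_integral[symmetric]) auto
  also have "\<dots> = (\<integral>\<^sup>+x. (if cmod (g x) \<in> S then ennreal (cmod (g x) powr real n) else 0) \<partial>padic_haar2)"
    using n by (intro nn_integral_cong) (auto simp: indicator_def powr_realpow' zero_power)
  finally show ?thesis .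
qed

lemma wave_family_square_integral:
  assumes A: "wave_family k A g"
  shows "(\<integral>x. cmod (\<Sum>a\<in>A. g a x) ^ 2 \<partial>padic_haar2) = (\<Sum>a\<in>A. \<integral>x. cmod (g a x) ^ 2 \<partial>padic_haar2)"
proof -
  have "(\<integral>x. cmod (\<Sum>a\<in>A. g a x) ^ 2 * 1 \<partial>padic_haar2) = (\<Sum>a\<in>A. \<integral>x. cmod (g a x) ^ 2 * 1 \<partial>padic_haar2)"
  proof (rule padic_wave_sum_orthogonal[where B=1])
    fix a b assume ab: "a \<in> A" "b \<in> A" "a \<noteq> b"
    have "(\<integral>x. g a x * cnj (g b x) \<partial>padic_haar2) = 0"
      by (rule padic_wave_orthogonal[of a k _ b])
         (use A ab in \<open>auto simp: wave_family_def intro: bounded_finsupp_measurable\<close>)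
    then show "(\<integral>x. g a x * cnj (g b x) * complex_of_real 1 \<partial>padic_haar2) = 0" by simp
  qed (use A in \<open>auto simp: wave_family_def\<close>)
  then show ?thesis by simp
qed

text \<open>Hoelder's inequality with weights bounds the cube of the sum of the \<open>?y a\<close>
  by \<open>(\<Sum>a\<in>A. w a)\<^sup>2\<close> times the sum of
  \<open>?y a ^ 3 / (w a)\<^sup>2\<close>, and \<open>?y a ^ 3\<close> is an integral. This is the
  linear form of decoupling that interpolation needs; nothing is lost when the weights are
  proportional to the \<open>?y a\<close>.\<close>

lemma decoupling6_weighted:
  fixes A :: "'q::prime_card padic set"
  assumes D: "decoupling6 TYPE('q) n D" "0 \<le> D" and A: "wave_family k A g" "padic_diam_le A (k - int n)"
    and w: "\<And>a. a \<in> A \<Longrightarrow> 0 < w a"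
  shows "(\<integral>x. cmod (\<Sum>a\<in>A. g a x) ^ 6 \<partial>padic_haar2)
    \<le> (\<Sum>a\<in>A. D * (\<Sum>a\<in>A. w a)\<^sup>2 / (w a)\<^sup>2 * (\<integral>x. cmod (g a x) ^ 6 \<partial>padic_haar2))"
proof -
  let ?y = "\<lambda>a. root 3 (\<integral>x. cmod (g a x) ^ 6 \<partial>padic_haar2)"
  have fin: "finite A" using A(1) by (rule wave_family_finite)
  have y: "0 \<le> ?y a" for a by simp
  have "(\<integral>x. cmod (\<Sum>a\<in>A. g a x) ^ 6 \<partial>padic_haar2) \<le> D * norm6_sum g A ^ 3"
    by (rule decoupling6D[OF D(1) A]) simp
  also have "norm6_sum g A = (\<Sum>a\<in>A. w a * (?y a / w a))"
    unfolding norm6_sum_def using w by (intro sum.cong refl) (simp add: less_imp_neq[symmetric])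
  also have "D * (\<Sum>a\<in>A. w a * (?y a / w a)) ^ 3 \<le> D * ((\<Sum>a\<in>A. w a)\<^sup>2 * (\<Sum>a\<in>A. w a * (?y a / w a) ^ 3))"
    using weighted_power_mean[OF fin, of w "\<lambda>a. ?y a / w a" 2] w y D(2)
    by (intro mult_left_mono) (auto simp: less_imp_le numeral_3_eq_3 numeral_2_eq_2)
  also have "\<dots> = (\<Sum>a\<in>A. D * (\<Sum>a\<in>A. w a)\<^sup>2 / (w a)\<^sup>2 * (\<integral>x. cmod (g a x) ^ 6 \<partial>padic_haar2))"
    unfolding sum_distrib_left
  proof (intro sum.cong refl)
    fix a assume "a \<in> A"
    then have "w a > 0" by (rule w)
    then show "D * ((\<Sum>a\<in>A. w a)\<^sup>2 * (w a * (?y a / w a) ^ 3))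
      = D * (\<Sum>a\<in>A. w a)\<^sup>2 / (w a)\<^sup>2 * (\<integral>x. cmod (g a x) ^ 6 \<partial>padic_haar2)"
      by (simp only: power_divide root_3_cubed) (simp add: power2_eq_square power3_eq_cube)
  qed
  finally show ?thesis .
qed

lemma ennreal_sum_mult_add:
  assumes "\<And>a. a \<in> A \<Longrightarrow> 0 \<le> c a" "\<And>a. a \<in> A \<Longrightarrow> 0 \<le> d a"
    and "\<And>a. a \<in> A \<Longrightarrow> 0 \<le> c' a" "\<And>a. a \<in> A \<Longrightarrow> 0 \<le> d' a"
  shows "ennreal ((\<Sum>a\<in>A. c a * d a) + (\<Sum>a\<in>A. c' a * d' a))
    = (\<Sum>a\<in>A. ennreal (c a) * ennreal (d a)) + (\<Sum>a\<in>A. ennreal (c' a) * ennreal (d' a))"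
proof -
  have "ennreal (\<Sum>a\<in>A. c a * d a) = (\<Sum>a\<in>A. ennreal (c a) * ennreal (d a))"
    "ennreal (\<Sum>a\<in>A. c' a * d' a) = (\<Sum>a\<in>A. ennreal (c' a) * ennreal (d' a))"
    using assms by (simp_all add: sum_ennreal[symmetric] ennreal_mult)
  then show ?thesis using assms by (simp add: ennreal_plus sum_nonneg)
qed

text \<open>The truncations \<open>hi\<close> and \<open>lo\<close> of the two interpolation arguments are again families of wave
  packets, so that the estimates at exponents 2, 6 and \<open>\<infinity>\<close> apply to them.\<close>

lemma wave_family_interpolate:
  fixes A :: "'q::prime_card padic set" and g :: "'q padic \<Rightarrow> 'q padic_fun"
  assumes A: "wave_family k A g"
    and K: "\<And>a. a \<in> A \<Longrightarrow> 0 < K a" and \<alpha>: "\<And>a. a \<in> A \<Longrightarrow> 0 \<le> \<alpha> a" and \<beta>: "\<And>a. a \<in> A \<Longrightarrow> 0 \<le> \<beta> a"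
    and p: "real m0 < p" "p < real m1" "0 < m0" "0 < m1"
    and weak: "\<And>s hi lo. 0 < s \<Longrightarrow> wave_family k A hi \<Longrightarrow> wave_family k A lo \<Longrightarrow>
      (\<And>a x. g a x = hi a x + lo a x) \<Longrightarrow> (\<And>a x. a \<in> A \<Longrightarrow> cmod (lo a x) \<le> s / K a) \<Longrightarrow>
      (\<integral>\<^sup>+x. (if s < cmod (\<Sum>a\<in>A. g a x) then 1 else 0) \<partial>padic_haar2)
      \<le> ennreal ((\<Sum>a\<in>A. \<alpha> a * s powr - real m0 * (\<integral>x. cmod (hi a x) ^ m0 \<partial>padic_haar2))
        + (\<Sum>a\<in>A. \<beta> a * s powr - real m1 * (\<integral>x. cmod (lo a x) ^ m1 \<partial>padic_haar2)))"
  shows "norm_powr_integral p (\<lambda>x. \<Sum>a\<in>A. g a x) \<le> p *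
    (\<Sum>a\<in>A. (\<alpha> a * (K a powr (p - real m0) / (p - real m0)) + \<beta> a * (K a powr (p - real m1) / (real m1 - p)))
      * norm_powr_integral p (g a))"
proof -
  let ?E = "\<lambda>s. \<integral>\<^sup>+x. (if s < cmod (\<Sum>a\<in>A. g a x) then 1 else 0) \<partial>padic_haar2"
  let ?N = "\<lambda>a. norm_powr_integral p (g a)" and ?f = "\<lambda>x. \<Sum>a\<in>A. g a x"
  let ?c = "\<lambda>a. \<alpha> a * (K a powr (p - real m0) / (p - real m0)) + \<beta> a * (K a powr (p - real m1) / (real m1 - p))"
  have fin: "finite A" using A by (rule wave_family_finite)
  have bg: "bounded_finsupp padic_haar2 (g a)" if "a \<in> A" for a using A that by (simp add: wave_family_def)
  have bf: "bounded_finsupp padic_haar2 ?f" using A by (rule wave_family_bounded_finsupp)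
  have p0: "0 < p" using p by linarith
  have int_nonneg: "0 \<le> (\<integral>x. cmod (h x) ^ m \<partial>padic_haar2)" for h :: "'q padic_fun" and m
    by (intro Bochner_Integration.integral_nonneg) simp
  have "(\<integral>\<^sup>+x. ennreal (cmod (\<Sum>a\<in>A. g a x) powr p) \<partial>padic_haar2) \<le> ennreal p *
      (\<Sum>a\<in>A. ennreal (?c a)
        * (\<integral>\<^sup>+x. ennreal (cmod (g a x) powr p) \<partial>padic_haar2))"
  proof (rule padic_haar2.nn_integral_powr_interpolate[OF _ _ _ _ K \<alpha> \<beta> p(1,2) p0])
    show "(\<lambda>x. cmod (\<Sum>a\<in>A. g a x)) \<in> borel_measurable padic_haar2"
      using bounded_finsupp_measurable[OF bf] by measurable
    show "(\<lambda>x. cmod (g a x)) \<in> borel_measurable padic_haar2" if "a \<in> A" for a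
      using bounded_finsupp_measurable[OF bg[OF that]] by measurable
    fix s :: real assume s: "0 < s"
    let ?S = "\<lambda>a. {y. s < K a * y}" and ?T = "\<lambda>a. {y. \<not> s < K a * y}"
    let ?hi = "\<lambda>a x. g a x * indicator (?S a) (cmod (g a x))" and ?lo = "\<lambda>a x. g a x * indicator (?T a) (cmod (g a x))"
    have S: "?S a \<in> sets borel" "?T a \<in> sets borel" for a by measurable
    have "?E s
      \<le> ennreal ((\<Sum>a\<in>A. \<alpha> a * s powr - real m0 * (\<integral>x. cmod (?hi a x) ^ m0 \<partial>padic_haar2))
        + (\<Sum>a\<in>A. \<beta> a * s powr - real m1 * (\<integral>x. cmod (?lo a x) ^ m1 \<partial>padic_haar2)))"
    proof (rule weak[OF s])
      show "wave_family k A ?hi" "wave_family k A ?lo" by (intro wave_family_truncate A S)+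
      show "g a x = ?hi a x + ?lo a x" for a x by (simp add: indicator_def)
      show "cmod (?lo a x) \<le> s / K a" if "a \<in> A" for a x
        using K[OF that] s by (auto simp: indicator_def field_simps)
    qed
    also have "\<dots> = (\<Sum>a\<in>A. ennreal (\<alpha> a * s powr - real m0) * ennreal (\<integral>x. cmod (?hi a x) ^ m0 \<partial>padic_haar2))
        + (\<Sum>a\<in>A. ennreal (\<beta> a * s powr - real m1) * ennreal (\<integral>x. cmod (?lo a x) ^ m1 \<partial>padic_haar2))"
    proof -
      have nn: "0 \<le> \<alpha> a * s powr - real m0" "0 \<le> \<beta> a * s powr - real m1" if "a \<in> A" for a
        using \<alpha>[OF that] \<beta>[OF that] by simp_all
      show ?thesis by (rule ennreal_sum_mult_add) (simp_all only: nn int_nonneg)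
    qed
    also have "\<dots> = (\<Sum>a\<in>A. ennreal (\<alpha> a * s powr - real m0) *
          (\<integral>\<^sup>+x. (if s < K a * cmod (g a x) then ennreal (cmod (g a x) powr real m0) else 0) \<partial>padic_haar2)) +
        (\<Sum>a\<in>A. ennreal (\<beta> a * s powr - real m1) *
          (\<integral>\<^sup>+x. (if s < K a * cmod (g a x) then 0 else ennreal (cmod (g a x) powr real m1)) \<partial>padic_haar2))"
    proof (intro arg_cong2[where f="(+)"] sum.cong refl arg_cong2[where f="(*)"])
      fix a assume a: "a \<in> A"
      show "ennreal (\<integral>x. cmod (?hi a x) ^ m0 \<partial>padic_haar2) =
          (\<integral>\<^sup>+x. (if s < K a * cmod (g a x) then ennreal (cmod (g a x) powr real m0) else 0) \<partial>padic_haar2)"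
        unfolding truncate_norm_power_integral[OF bg[OF a] S(1) p(3)] by simp
      show "ennreal (\<integral>x. cmod (?lo a x) ^ m1 \<partial>padic_haar2) =
          (\<integral>\<^sup>+x. (if s < K a * cmod (g a x) then 0 else ennreal (cmod (g a x) powr real m1)) \<partial>padic_haar2)"
        unfolding truncate_norm_power_integral[OF bg[OF a] S(2) p(4)] by (intro nn_integral_cong) simp
    qed
    finally show "?E s \<le> \<dots>" .
  qed simp_all
  also have "(\<Sum>a\<in>A. ennreal (?c a)
        * (\<integral>\<^sup>+x. ennreal (cmod (g a x) powr p) \<partial>padic_haar2))
      = (\<Sum>a\<in>A. ennreal (?c a
        * ?N a))"
  proof (intro sum.cong refl)
    fix a assume a: "a \<in> A"
    have "0 \<le> ?c a"
      using \<alpha>[OF a] \<beta>[OF a] p by (intro add_nonneg_nonneg mult_nonneg_nonneg divide_nonneg_nonneg) auto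
    then show "ennreal (?c a)
        * (\<integral>\<^sup>+x. ennreal (cmod (g a x) powr p) \<partial>padic_haar2)
      = ennreal (?c a
        * ?N a)"
      using nn_integral_norm_powr[OF bg[OF a], of p] p0 by (simp add: ennreal_mult)
  qed
  finally have le: "ennreal (norm_powr_integral p ?f) \<le> ennreal p * \<dots>"
    using nn_integral_norm_powr[OF bf, of p] p0 by simp
  let ?R = "\<Sum>a\<in>A. ?c a
      * ?N a"
  have nn: "0 \<le> ?c a
      * ?N a" if a: "a \<in> A" for a
    using \<alpha>[OF a] \<beta>[OF a] p by (intro mult_nonneg_nonneg[OF add_nonneg_nonneg] mult_nonneg_nonneg divide_nonneg_nonneg) auto
  have "ennreal (norm_powr_integral p ?f) \<le> ennreal (p * ?R)"
    using le nn p0 by (simp only: sum_ennreal ennreal_mult sum_nonneg less_imp_le)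
  moreover have "0 \<le> p * ?R" by (rule mult_nonneg_nonneg[OF less_imp_le[OF p0] sum_nonneg[OF nn]])
  ultimately show ?thesis by (simp only: ennreal_le_iff)
qed

section \<open>Estimates between the exponents 2, 6 and infinity\<close>

lemma nn_integral_if_le:
  assumes "bounded_finsupp M h" "\<And>x. 0 \<le> h x" "\<And>x. P x \<Longrightarrow> 1 \<le> h x"
  shows "(\<integral>\<^sup>+x. (if P x then 1 else 0) \<partial>M) \<le> ennreal (\<integral>x. h x \<partial>M)"
proof -
  have "(\<integral>\<^sup>+x. (if P x then 1 else 0) \<partial>M) \<le> (\<integral>\<^sup>+x. ennreal (h x) \<partial>M)"
    using assms(2,3) by (intro nn_integral_mono) auto
  also have "\<dots> = ennreal (\<integral>x. h x \<partial>M)"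
    using assms by (intro nn_integral_eq_integral bounded_finsupp_integrable) auto
  finally show ?thesis .
qed

text \<open>Chebyshev's inequality at height \<open>s / 2\<close>, which one of the two truncated
  sums must exceed when the full sum exceeds \<open>s\<close>. The powers \<open>2 ^ 2\<close> and
  \<open>2 ^ 6\<close> are the constants 4 and 64 below.\<close>

lemma half_power_bound:
  fixes s y :: real
  assumes "0 < s" "s / 2 < y"
  shows "1 \<le> 2 ^ m * s powr - real m * y ^ m"
proof -
  have "(s / 2) ^ m \<le> y ^ m" using assms by (intro power_mono) auto
  then show ?thesis using assms by (simp add: powr_minus powr_realpow field_simps)
qed

text \<open>With \<open>K = L * sqrt W / c\<close>, an arc of norm \<open>c\<close> contributes, at
  either exponent, \<open>c\<^sup>2\<close> times a factor common to all arcs. In the applications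
  \<open>W\<close> is the sum of the \<open>c\<^sup>2\<close>, so that summation produces
  \<open>W powr (p / 2)\<close>.\<close>

lemma truncation_constants:
  fixes L W c p :: real
  assumes "0 < L" "0 < W" "0 < c"
  shows "(L * sqrt W / c) powr (p - 2) * c powr p = L powr (p - 2) * W powr (p / 2 - 1) * c\<^sup>2"
    and "W\<^sup>2 * (1 / (c\<^sup>2)\<^sup>2) * ((L * sqrt W / c) powr (p - 6) * c powr p)
      = L powr (p - 6) * W powr (p / 2 - 1) * c\<^sup>2"
proof -
  have K: "(L * sqrt W / c) powr e = L powr e * W powr (e / 2) * c powr - e" for e
  proof -
    have "(L * sqrt W / c) powr e = L powr e * (W powr (1 / 2)) powr e / c powr e"
      using assms by (simp add: powr_divide powr_mult powr_half_sqrt)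
    then show ?thesis by (simp add: powr_powr powr_minus_divide)
  qed
  have c2: "c powr 2 = c\<^sup>2" using assms by (simp add: powr_numeral)
  have c4: "1 / (c\<^sup>2)\<^sup>2 = c powr - 4"
    using assms by (simp add: powr_minus powr_numeral power_mult[symmetric] divide_inverse)
  have W2: "W\<^sup>2 = W powr 2" using assms by (simp add: powr_numeral)
  have "(L * sqrt W / c) powr (p - 2) * c powr p = L powr (p - 2) * W powr (p / 2 - 1) * c powr (- (p - 2) + p)"
    unfolding K powr_add by (simp add: diff_divide_distrib)
  then show "(L * sqrt W / c) powr (p - 2) * c powr p = L powr (p - 2) * W powr (p / 2 - 1) * c\<^sup>2"
    using c2 by simp
  have "W\<^sup>2 * (1 / (c\<^sup>2)\<^sup>2) * ((L * sqrt W / c) powr (p - 6) * c powr p)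
      = L powr (p - 6) * W powr (2 + (p - 6) / 2) * c powr (- 4 + (- (p - 6) + p))"
    unfolding W2 c4 K powr_add by (simp only: mult_ac)
  moreover have "2 + (p - 6) / 2 = p / 2 - 1" by (simp add: field_simps)
  ultimately show "W\<^sup>2 * (1 / (c\<^sup>2)\<^sup>2) * ((L * sqrt W / c) powr (p - 6) * c powr p)
      = L powr (p - 6) * W powr (p / 2 - 1) * c\<^sup>2"
    using c2 by simp
qed

text \<open>Values of \<open>g a\<close> above the height \<open>s * c a / sqrt W\<close> are
  estimated at exponent 2 by orthogonality, the others at exponent 6. The factors
  \<open>1 / (p - 2)\<close> and \<open>1 / (6 - p)\<close> come from integrating over
  \<open>s\<close>; they blow up at the endpoints, which are therefore treated separately.\<close>

lemma decoupling_subcritical: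
  fixes A :: "'q::prime_card padic set"
  assumes D: "decoupling6 TYPE('q) n D" "0 \<le> D" and A: "wave_family k A g" "padic_diam_le A (k - int n)"
    and p: "2 < p" "p < 6" and pos: "\<And>a. a \<in> A \<Longrightarrow> 0 < norm_powr_integral p (g a)" and ne: "A \<noteq> {}"
  shows "norm_powr_integral p (\<lambda>x. \<Sum>a\<in>A. g a x)
    \<le> p * (4 / (p - 2) + 64 * D / (6 - p)) * square_norm_sum p g A powr (p / 2)"
proof -
  define c where "c a = norm_powr_integral p (g a) powr (1 / p)" for a
  let ?E = "\<lambda>s. \<integral>\<^sup>+x. (if s < cmod (\<Sum>a\<in>A. g a x) then 1 else 0) \<partial>padic_haar2"
  let ?N = "\<lambda>a. norm_powr_integral p (g a)"
  define W where "W = square_norm_sum p g A"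
  have fin: "finite A" using A(1) by (rule wave_family_finite)
  have c: "0 < c a" if "a \<in> A" for a unfolding c_def using pos[OF that] by simp
  have cp: "c a powr p = ?N a" if "a \<in> A" for a
    unfolding c_def using pos[OF that] p by (simp add: powr_powr)
  have Wc: "W = (\<Sum>a\<in>A. (c a)\<^sup>2)" unfolding W_def square_norm_sum_def c_def ..
  have W: "0 < W" unfolding Wc by (rule sum_pos[OF fin ne]) (rule zero_less_power[OF c])
  define K where "K a = sqrt W / c a" for a
  let ?\<beta> = "\<lambda>a. 64 * (D * W\<^sup>2 / ((c a)\<^sup>2)\<^sup>2)"
  have le: "norm_powr_integral p (\<lambda>x. \<Sum>a\<in>A. g a x) \<le> p *
    (\<Sum>a\<in>A. (4 * (K a powr (p - real 2) / (p - real 2)) + ?\<beta> a * (K a powr (p - real 6) / (real 6 - p)))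
      * ?N a)"
  proof (rule wave_family_interpolate[OF A(1)])
    fix s :: real and hi lo :: "'q padic \<Rightarrow> 'q padic_fun"
    assume s: "0 < s" and hi: "wave_family k A hi" and lo: "wave_family k A lo" and g: "\<And>a x. g a x = hi a x + lo a x"
    let ?h = "\<lambda>x. 4 * s powr - real 2 * cmod (\<Sum>a\<in>A. hi a x) ^ 2 + 64 * s powr - real 6 * cmod (\<Sum>a\<in>A. lo a x) ^ 6"
    have b: "bounded_finsupp padic_haar2 (\<lambda>x. cmod (\<Sum>a\<in>A. hi a x) ^ 2)"
      "bounded_finsupp padic_haar2 (\<lambda>x. cmod (\<Sum>a\<in>A. lo a x) ^ 6)"
      by (intro bounded_finsupp_norm_power wave_family_bounded_finsupp[OF hi] wave_family_bounded_finsupp[OF lo]; simp)+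
    have "?E s \<le> ennreal (\<integral>x. ?h x \<partial>padic_haar2)"
    proof (rule nn_integral_if_le)
      have "bounded_finsupp padic_haar2 (\<lambda>x. cmod (\<Sum>a\<in>A. hi a x) ^ 2 * (4 * s powr - real 2)
          + cmod (\<Sum>a\<in>A. lo a x) ^ 6 * (64 * s powr - real 6))"
        by (intro bounded_finsupp_add bounded_finsupp_mult[OF b(1)] bounded_finsupp_mult[OF b(2)]) (simp, rule order_refl, simp, rule order_refl)
      then show "bounded_finsupp padic_haar2 ?h" by (simp only: mult.commute)
      fix x
      show "0 \<le> ?h x" by simp
      assume "s < cmod (\<Sum>a\<in>A. g a x)"
      also have "cmod (\<Sum>a\<in>A. g a x) \<le> cmod (\<Sum>a\<in>A. hi a x) + cmod (\<Sum>a\<in>A. lo a x)"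
        unfolding g sum.distrib by (rule norm_triangle_ineq)
      finally have "s / 2 < cmod (\<Sum>a\<in>A. hi a x) \<or> s / 2 < cmod (\<Sum>a\<in>A. lo a x)" by linarith
      then show "1 \<le> ?h x"
      proof
        assume "s / 2 < cmod (\<Sum>a\<in>A. hi a x)"
        from half_power_bound[OF s this, of 2] show ?thesis by (intro add_increasing2) simp_all
      next
        assume "s / 2 < cmod (\<Sum>a\<in>A. lo a x)"
        from half_power_bound[OF s this, of 6] show ?thesis by (intro add_increasing) simp_all
      qed
    qed
    also have "(\<integral>x. ?h x \<partial>padic_haar2) = 4 * s powr - real 2 * (\<integral>x. cmod (\<Sum>a\<in>A. hi a x) ^ 2 \<partial>padic_haar2)
        + 64 * s powr - real 6 * (\<integral>x. cmod (\<Sum>a\<in>A. lo a x) ^ 6 \<partial>padic_haar2)"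
      using b[THEN bounded_finsupp_integrable] by simp
    \<comment> \<open>The weights are taken from \<open>g\<close> and not from the truncation
      \<open>lo\<close>, so the coefficients do not vary with the height \<open>s\<close>.\<close>
    also have "\<dots> \<le> 4 * s powr - real 2 * (\<Sum>a\<in>A. \<integral>x. cmod (hi a x) ^ 2 \<partial>padic_haar2)
        + 64 * s powr - real 6 * (\<Sum>a\<in>A. D * W\<^sup>2 / ((c a)\<^sup>2)\<^sup>2 * (\<integral>x. cmod (lo a x) ^ 6 \<partial>padic_haar2))"
      unfolding wave_family_square_integral[OF hi] Wc
      by (intro add_mono mult_left_mono decoupling6_weighted[OF D lo A(2)] zero_less_power c) auto
    also have "\<dots> = (\<Sum>a\<in>A. 4 * s powr - real 2 * (\<integral>x. cmod (hi a x) ^ 2 \<partial>padic_haar2))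
        + (\<Sum>a\<in>A. ?\<beta> a * s powr - real 6 * (\<integral>x. cmod (lo a x) ^ 6 \<partial>padic_haar2))"
      unfolding sum_distrib_left by (intro arg_cong2[where f="(+)"] sum.cong refl) (simp_all only: mult_ac times_divide_eq_right)
    finally show "?E s
      \<le> ennreal ((\<Sum>a\<in>A. 4 * s powr - real 2 * (\<integral>x. cmod (hi a x) ^ 2 \<partial>padic_haar2))
        + (\<Sum>a\<in>A. ?\<beta> a * s powr - real 6 * (\<integral>x. cmod (lo a x) ^ 6 \<partial>padic_haar2)))"
      by (simp add: ennreal_leI)
  next
    show "0 < K a" if "a \<in> A" for a using c[OF that] W by (simp add: K_def)
    show "0 \<le> ?\<beta> a" for a using D(2) by simp
  qed (use p in simp_all)
  have "(\<Sum>a\<in>A. (4 * (K a powr (p - real 2) / (p - real 2)) + ?\<beta> a * (K a powr (p - real 6) / (real 6 - p)))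
      * ?N a) = (\<Sum>a\<in>A. (4 / (p - 2) + 64 * D / (6 - p)) * W powr (p / 2 - 1) * (c a)\<^sup>2)"
  proof (intro sum.cong refl)
    fix a assume a: "a \<in> A"
    have 1: "K a powr (p - 2) * c a powr p = W powr (p / 2 - 1) * (c a)\<^sup>2"
      using truncation_constants(1)[of 1 W "c a" p] W c[OF a] by (simp add: K_def)
    have 2: "W\<^sup>2 * (1 / ((c a)\<^sup>2)\<^sup>2) * (K a powr (p - 6) * c a powr p) = W powr (p / 2 - 1) * (c a)\<^sup>2"
      using truncation_constants(2)[of 1 W "c a" p] W c[OF a] by (simp add: K_def)
    have "(4 * (K a powr (p - real 2) / (p - real 2)) + ?\<beta> a * (K a powr (p - real 6) / (real 6 - p))) * ?N a
      = 4 / (p - 2) * (K a powr (p - 2) * c a powr p)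
        + 64 * D / (6 - p) * (W\<^sup>2 * (1 / ((c a)\<^sup>2)\<^sup>2) * (K a powr (p - 6) * c a powr p))"
      unfolding cp[OF a, symmetric] by (simp add: distrib_left distrib_right mult_ac)
    also have "\<dots> = (4 / (p - 2) + 64 * D / (6 - p)) * W powr (p / 2 - 1) * (c a)\<^sup>2"
      unfolding 1 2 by (simp add: distrib_right)
    finally show "(4 * (K a powr (p - real 2) / (p - real 2)) + ?\<beta> a * (K a powr (p - real 6) / (real 6 - p))) * ?N a
      = (4 / (p - 2) + 64 * D / (6 - p)) * W powr (p / 2 - 1) * (c a)\<^sup>2" .
  qed
  also have "\<dots> = (4 / (p - 2) + 64 * D / (6 - p)) * (W powr (p / 2 - 1) * W powr 1)"
    unfolding sum_distrib_left[symmetric] Wc[symmetric] using W by (simp add: mult.assoc)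
  also have "\<dots> = (4 / (p - 2) + 64 * D / (6 - p)) * W powr (p / 2)" by (simp only: powr_add[symmetric] diff_add_cancel)
  finally have eq: "(\<Sum>a\<in>A. (4 * (K a powr (p - real 2) / (p - real 2)) + ?\<beta> a * (K a powr (p - real 6) / (real 6 - p)))
      * ?N a) = \<dots>" .
  show ?thesis using le unfolding eq by (simp only: W_def mult.assoc)
qed

text \<open>The extra factor \<open>L\<close> lowers the truncation height so far that, by the
  Cauchy-Schwarz inequality over at most \<open>q ^ n\<close> arcs, the small parts add up to at
  most \<open>s / 2\<close> pointwise. Only the large parts remain, at exponent 6, and
  \<open>L powr (p - 6)\<close> is the origin of the power
  \<open>q ^ (n * (p / 2 - 3))\<close>.\<close>

lemma decoupling_supercritical:
  fixes A :: "'q::prime_card padic set"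
  assumes D: "decoupling6 TYPE('q) n D" "0 \<le> D" and A: "wave_family k A g" "padic_diam_le A (k - int n)"
    and p: "6 < p" and pos: "\<And>a. a \<in> A \<Longrightarrow> 0 < norm_powr_integral p (g a)" and ne: "A \<noteq> {}"
  shows "norm_powr_integral p (\<lambda>x. \<Sum>a\<in>A. g a x)
    \<le> p * (64 * D / (p - 6) * (2 * sqrt (real CARD('q) ^ n)) powr (p - 6)) * square_norm_sum p g A powr (p / 2)"
proof -
  define c where "c a = norm_powr_integral p (g a) powr (1 / p)" for a
  let ?E = "\<lambda>s. \<integral>\<^sup>+x. (if s < cmod (\<Sum>a\<in>A. g a x) then 1 else 0) \<partial>padic_haar2"
  let ?N = "\<lambda>a. norm_powr_integral p (g a)"
  define W where "W = square_norm_sum p g A"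
  define L where "L = 2 * sqrt (real CARD('q) ^ n)"
  have L: "0 < L" unfolding L_def using CARD_gt_1(2)[where 'q='q] by simp
  have fin: "finite A" using A(1) by (rule wave_family_finite)
  have c: "0 < c a" if "a \<in> A" for a unfolding c_def using pos[OF that] by simp
  have cp: "c a powr p = ?N a" if "a \<in> A" for a
    unfolding c_def using pos[OF that] p by (simp add: powr_powr)
  have Wc: "W = (\<Sum>a\<in>A. (c a)\<^sup>2)" unfolding W_def square_norm_sum_def c_def ..
  have W: "0 < W" unfolding Wc by (rule sum_pos[OF fin ne]) (rule zero_less_power[OF c])
  define K where "K a = L * sqrt W / c a" for a
  have c_sum: "(\<Sum>a\<in>A. c a) \<le> sqrt (real CARD('q) ^ n) * sqrt W"
  proof (rule power2_le_imp_le)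
    have "(\<Sum>a\<in>A. c a)\<^sup>2 \<le> real (card A) * W"
      unfolding Wc using sum_power_le_card[OF fin, of c 1] c by (simp add: less_imp_le numeral_2_eq_2)
    also have "\<dots> \<le> real CARD('q) ^ n * W"
      using card_wave_family[OF A] W by (intro mult_right_mono) (simp_all flip: of_nat_power)
    finally show "(\<Sum>a\<in>A. c a)\<^sup>2 \<le> (sqrt (real CARD('q) ^ n) * sqrt W)\<^sup>2"
      using W by (simp add: power_mult_distrib)
  qed (use W in simp)
  let ?\<alpha> = "\<lambda>a. 64 * (D * W\<^sup>2 / ((c a)\<^sup>2)\<^sup>2)"
  \<comment> \<open>Any exponent above \<open>p\<close> can stand for the upper endpoint, since its
    coefficient is 0.\<close>
  obtain m1 :: nat where m1: "p < real m1" using reals_Archimedean2 by blast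
  have le: "norm_powr_integral p (\<lambda>x. \<Sum>a\<in>A. g a x) \<le> p *
    (\<Sum>a\<in>A. (?\<alpha> a * (K a powr (p - real 6) / (p - real 6)) + 0 * (K a powr (p - real m1) / (real m1 - p)))
      * ?N a)"
  proof (rule wave_family_interpolate[OF A(1)])
    fix s :: real and hi lo :: "'q padic \<Rightarrow> 'q padic_fun"
    assume s: "0 < s" and hi: "wave_family k A hi" and lo: "wave_family k A lo" and g: "\<And>a x. g a x = hi a x + lo a x"
      and lo_le: "\<And>a x. a \<in> A \<Longrightarrow> cmod (lo a x) \<le> s / K a"
    let ?h = "\<lambda>x. 64 * s powr - real 6 * cmod (\<Sum>a\<in>A. hi a x) ^ 6"
    have b: "bounded_finsupp padic_haar2 (\<lambda>x. cmod (\<Sum>a\<in>A. hi a x) ^ 6)"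
      by (intro bounded_finsupp_norm_power wave_family_bounded_finsupp[OF hi]) simp
    have lo_half: "cmod (\<Sum>a\<in>A. lo a x) \<le> s / 2" for x
    proof -
      have "cmod (\<Sum>a\<in>A. lo a x) \<le> (\<Sum>a\<in>A. s / K a)" using lo_le by (rule sum_norm_le)
      also have "\<dots> = s / (L * sqrt W) * (\<Sum>a\<in>A. c a)" by (simp add: K_def sum_distrib_left)
      also have "\<dots> \<le> s / (L * sqrt W) * (sqrt (real CARD('q) ^ n) * sqrt W)"
        using s L W by (intro mult_left_mono c_sum) simp
      also have "\<dots> = s / 2" unfolding L_def using W CARD_gt_1(2)[where 'q='q] by simp
      finally show ?thesis .
    qed
    have "?E s \<le> ennreal (\<integral>x. ?h x \<partial>padic_haar2)"
    proof (rule nn_integral_if_le)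
      have "bounded_finsupp padic_haar2 (\<lambda>x. cmod (\<Sum>a\<in>A. hi a x) ^ 6 * (64 * s powr - real 6))"
        by (rule bounded_finsupp_mult[OF b]) (simp, rule order_refl)
      then show "bounded_finsupp padic_haar2 ?h" by (simp only: mult.commute)
      fix x
      show "0 \<le> ?h x" by simp
      assume "s < cmod (\<Sum>a\<in>A. g a x)"
      also have "cmod (\<Sum>a\<in>A. g a x) \<le> cmod (\<Sum>a\<in>A. hi a x) + cmod (\<Sum>a\<in>A. lo a x)"
        unfolding g sum.distrib by (rule norm_triangle_ineq)
      finally have "s / 2 < cmod (\<Sum>a\<in>A. hi a x)" using lo_half[of x] by linarith
      from half_power_bound[OF s this, of 6] show "1 \<le> ?h x" by simp
    qed
    also have "(\<integral>x. ?h x \<partial>padic_haar2) = 64 * s powr - real 6 * (\<integral>x. cmod (\<Sum>a\<in>A. hi a x) ^ 6 \<partial>padic_haar2)"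
      by simp
    also have "\<dots> \<le> 64 * s powr - real 6 * (\<Sum>a\<in>A. D * W\<^sup>2 / ((c a)\<^sup>2)\<^sup>2 * (\<integral>x. cmod (hi a x) ^ 6 \<partial>padic_haar2))"
      unfolding Wc by (intro mult_left_mono decoupling6_weighted[OF D hi A(2)] zero_less_power c) auto
    also have "\<dots> = (\<Sum>a\<in>A. ?\<alpha> a * s powr - real 6 * (\<integral>x. cmod (hi a x) ^ 6 \<partial>padic_haar2))
        + (\<Sum>a\<in>A. 0 * s powr - real m1 * (\<integral>x. cmod (lo a x) ^ m1 \<partial>padic_haar2))"
      unfolding sum_distrib_left by (simp add: mult_ac)
    finally show "?E s
      \<le> ennreal ((\<Sum>a\<in>A. ?\<alpha> a * s powr - real 6 * (\<integral>x. cmod (hi a x) ^ 6 \<partial>padic_haar2))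
        + (\<Sum>a\<in>A. 0 * s powr - real m1 * (\<integral>x. cmod (lo a x) ^ m1 \<partial>padic_haar2)))"
      by (simp add: ennreal_leI)
  next
    show "0 < K a" if "a \<in> A" for a using c[OF that] W L by (simp add: K_def)
    show "0 \<le> ?\<alpha> a" for a using D(2) by simp
  qed (use p m1 in simp_all)
  have "(\<Sum>a\<in>A. (?\<alpha> a * (K a powr (p - real 6) / (p - real 6)) + 0 * (K a powr (p - real m1) / (real m1 - p)))
      * ?N a) = (\<Sum>a\<in>A. 64 * D / (p - 6) * L powr (p - 6) * W powr (p / 2 - 1) * (c a)\<^sup>2)"
  proof (intro sum.cong refl)
    fix a assume a: "a \<in> A"
    have 2: "W\<^sup>2 * (1 / ((c a)\<^sup>2)\<^sup>2) * (K a powr (p - 6) * c a powr p) = L powr (p - 6) * W powr (p / 2 - 1) * (c a)\<^sup>2"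
      unfolding K_def by (rule truncation_constants(2)[OF L W c[OF a]])
    have "(?\<alpha> a * (K a powr (p - real 6) / (p - real 6)) + 0 * (K a powr (p - real m1) / (real m1 - p))) * ?N a
      = 64 * D / (p - 6) * (W\<^sup>2 * (1 / ((c a)\<^sup>2)\<^sup>2) * (K a powr (p - 6) * c a powr p))"
      unfolding cp[OF a, symmetric] by (simp add: mult_ac)
    then show "(?\<alpha> a * (K a powr (p - real 6) / (p - real 6)) + 0 * (K a powr (p - real m1) / (real m1 - p))) * ?N a
      = 64 * D / (p - 6) * L powr (p - 6) * W powr (p / 2 - 1) * (c a)\<^sup>2"
      unfolding 2 by simp
  qed
  also have "\<dots> = 64 * D / (p - 6) * L powr (p - 6) * (W powr (p / 2 - 1) * W powr 1)"
    unfolding sum_distrib_left[symmetric] Wc[symmetric] using W by (simp add: mult.assoc)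
  also have "\<dots> = 64 * D / (p - 6) * L powr (p - 6) * W powr (p / 2)" by (simp only: powr_add[symmetric] diff_add_cancel)
  finally have eq: "(\<Sum>a\<in>A. (?\<alpha> a * (K a powr (p - real 6) / (p - real 6)) + 0 * (K a powr (p - real m1) / (real m1 - p)))
      * ?N a) = \<dots>" .
  show ?thesis using le unfolding eq by (simp only: W_def L_def mult.assoc)
qed

text \<open>The heights and weights of the interpolation divide by the norms of the packets. Packets
  of norm 0 vanish almost everywhere and are removed beforehand.\<close>

lemma wave_family_drop_null:
  fixes A :: "'q::prime_card padic set" and g :: "'q padic \<Rightarrow> 'q padic_fun"
  assumes A: "wave_family k A g" and p: "0 < p"
  defines "A0 \<equiv> {a \<in> A. 0 < norm_powr_integral p (g a)}"
  shows "norm_powr_integral p (\<lambda>x. \<Sum>a\<in>A. g a x) = norm_powr_integral p (\<lambda>x. \<Sum>a\<in>A0. g a x)"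
    and "square_norm_sum p g A = square_norm_sum p g A0"
proof -
  have fin: "finite A" using A by (rule wave_family_finite)
  have sub: "A0 \<subseteq> A" by (auto simp: A0_def)
  have null: "norm_powr_integral p (g a) = 0" if "a \<in> A - A0" for a
    using that norm_powr_integral_nonneg[of p "g a"] by (auto simp: A0_def less_le)
  have "AE x in padic_haar2. g a x = 0" if a: "a \<in> A - A0" for a
  proof -
    have "bounded_finsupp padic_haar2 (\<lambda>x. cmod (g a x) powr p)"
      using A a p by (intro bounded_finsupp_norm_powr) (auto simp: wave_family_def)
    from integral_nonneg_eq_0_iff_AE[OF bounded_finsupp_integrable[OF this]]
    have "AE x in padic_haar2. cmod (g a x) powr p = 0"
      using null[OF a] by (simp add: norm_powr_integral_def)
    then show ?thesis by eventually_elim simp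
  qed
  then have "AE x in padic_haar2. \<forall>a\<in>A - A0. g a x = 0"
    using fin by (intro AE_finite_allI) auto
  then have "AE x in padic_haar2. cmod (\<Sum>a\<in>A. g a x) powr p = cmod (\<Sum>a\<in>A0. g a x) powr p"
  proof eventually_elim
    case (elim x)
    have "(\<Sum>a\<in>A. g a x) = (\<Sum>a\<in>A0. g a x)"
      using elim fin sub by (intro sum.mono_neutral_right) auto
    then show ?case by simp
  qed
  then show "norm_powr_integral p (\<lambda>x. \<Sum>a\<in>A. g a x) = norm_powr_integral p (\<lambda>x. \<Sum>a\<in>A0. g a x)"
    unfolding norm_powr_integral_def using p
    by (intro integral_cong_AE bounded_finsupp_measurable bounded_finsupp_norm_powr
        wave_family_bounded_finsupp[OF A] wave_family_bounded_finsupp[OF wave_family_subset[OF A sub]]) auto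
  show "square_norm_sum p g A = square_norm_sum p g A0"
    unfolding square_norm_sum_def using fin sub null by (intro sum.mono_neutral_right) auto
qed

lemma wave_family_decoupling:
  assumes odd: "odd CARD('q::prime_card)" and p: "2 \<le> p" and \<epsilon>: "0 < \<epsilon>"
  shows "\<exists>C>0. \<forall>n k (A :: 'q padic set) g. wave_family k A g \<longrightarrow> padic_diam_le A (k - int n) \<longrightarrow>
    norm_powr_integral p (\<lambda>x. \<Sum>a\<in>A. g a x)
      \<le> C * (real CARD('q) powr (\<epsilon> * real n) * (1 + real CARD('q) powr (real n * (p / 2 - 3))))
        * square_norm_sum p g A powr (p / 2)"
proof -
  let ?q = "real CARD('q)"
  let ?X = "\<lambda>n. ?q powr (\<epsilon> * real n)" and ?Y = "\<lambda>n. ?q powr (real n * (p / 2 - 3))"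
  let ?N = "\<lambda>(A :: 'q padic set) g. norm_powr_integral p (\<lambda>x. \<Sum>a\<in>A. g a x)"
  let ?W = "\<lambda>(A :: 'q padic set) g. square_norm_sum p g A powr (p / 2)"
  let ?pos = "\<lambda>(A :: 'q padic set) g. \<forall>a\<in>A. 0 < norm_powr_integral p (g a)"
  \<comment> \<open>\<open>?Z\<close> is the one of the two summands that the bound uses: 1 up to
    exponent 6, and the power of \<open>q ^ n\<close> beyond it.\<close>
  let ?B = "\<lambda>n. ?X n * (1 + ?Y n)" and ?Z = "\<lambda>n. if p \<le> 6 then 1 else ?Y n"
  have q: "1 < ?q" by (rule CARD_gt_1)
  have X1: "1 \<le> ?X n" for n using q \<epsilon> by (intro ge_one_powr_ge_zero) auto
  \<comment> \<open>The choice \<open>\<beta> = ?q powr (\<epsilon> / 2)\<close> turns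
    \<open>\<beta> ^ (2 * n)\<close> into \<open>?X n\<close>.\<close>
  have "1 < ?q powr (\<epsilon> / 2)" using q \<epsilon> by (simp add: gr_one_powr)
  from decoupling6_critical[OF odd this] obtain D
    where D: "0 < D" "\<And>n. decoupling6 TYPE('q) n (D * (?q powr (\<epsilon> / 2)) ^ (2 * n))" by blast
  have X: "(?q powr (\<epsilon> / 2)) ^ (2 * n) = ?X n" for n
    using q by (simp add: powr_realpow[symmetric] powr_powr mult.commute)
  have DX: "decoupling6 TYPE('q) n (D * ?X n)" "0 \<le> D * ?X n" for n using D(2)[of n] D(1) unfolding X by simp_all
  have "\<exists>C>0. \<forall>n k (A :: 'q padic set) g. wave_family k A g \<longrightarrow> padic_diam_le A (k - int n) \<longrightarrow>
      ?pos A g \<longrightarrow> A \<noteq> {} \<longrightarrow>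
      ?N A g \<le> C * ?B n * ?W A g"
  proof -
    have reduce: "\<exists>C>0. \<forall>n k (A :: 'q padic set) g. wave_family k A g \<longrightarrow> padic_diam_le A (k - int n) \<longrightarrow>
        ?pos A g \<longrightarrow> A \<noteq> {} \<longrightarrow>
        ?N A g \<le> C * ?B n * ?W A g"
      if C: "0 < C" and bound: "\<And>n k (A :: 'q padic set) g. wave_family k A g \<Longrightarrow> padic_diam_le A (k - int n) \<Longrightarrow>
        ?pos A g \<Longrightarrow> A \<noteq> {} \<Longrightarrow>
        ?N A g \<le> C * ?X n * ?Z n * ?W A g"
      for C
    proof (intro exI[of _ C] conjI C allI impI)
      fix n k and A :: "'q padic set" and g
      assume a: "wave_family k A g" "padic_diam_le A (k - int n)" "?pos A g" "A \<noteq> {}"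
      have "?N A g
          \<le> C * ?X n * ?Z n * ?W A g" by (rule bound[OF a])
      also have "\<dots> \<le> C * ?X n * (1 + ?Y n) * ?W A g"
        using C by (intro mult_right_mono mult_left_mono) auto
      finally show "?N A g \<le> C * ?B n * ?W A g"
        by (simp only: mult.assoc)
    qed
    consider "p = 2" | "2 < p" "p < 6" | "p = 6" | "6 < p" using p by linarith
    then show ?thesis
    proof cases
      case 1
      show ?thesis
      proof (rule reduce[of 1])
        fix n k and A :: "'q padic set" and g assume A: "wave_family k A g"
        have sq: "norm_powr_integral 2 f = (\<integral>x. cmod (f x) ^ 2 \<partial>padic_haar2)" for f :: "'q padic_fun"
          using norm_powr_integral_power[of 2 f] by simp
        have "norm_powr_integral 2 (\<lambda>x. \<Sum>a\<in>A. g a x) = (\<Sum>a\<in>A. norm_powr_integral 2 (g a))"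
          unfolding sq by (rule wave_family_square_integral[OF A])
        also have "\<dots> = square_norm_sum 2 g A"
          unfolding square_norm_sum_def by (intro sum.cong refl) (simp add: powr_half_sqrt)
        also have "\<dots> \<le> ?X n * square_norm_sum 2 g A" using mult_right_mono[OF X1[of n] square_norm_sum_nonneg[of 2 g A]] by simp
        finally show "?N A g
            \<le> 1 * ?X n * ?Z n * ?W A g"
          using 1 by simp
      qed simp
    next
      case 2
      show ?thesis
      proof (rule reduce[of "p * (4 / (p - 2) + 64 * D / (6 - p))"])
        show "0 < p * (4 / (p - 2) + 64 * D / (6 - p))"
          using 2 D(1) by (intro mult_pos_pos add_pos_pos divide_pos_pos) auto
        fix n k and A :: "'q padic set" and g
        assume a: "wave_family k A g" "padic_diam_le A (k - int n)" "?pos A g" "A \<noteq> {}"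
        have "?N A g
            \<le> p * (4 / (p - 2) + 64 * (D * ?X n) / (6 - p)) * ?W A g"
          using a(3) by (intro decoupling_subcritical[OF DX a(1,2) 2 _ a(4)]) blast
        also have "\<dots> \<le> p * (4 / (p - 2) * ?X n + 64 * (D * ?X n) / (6 - p)) * ?W A g"
          using 2 X1[of n] by (intro mult_right_mono mult_left_mono add_right_mono) (auto simp: divide_le_cancel)
        also have "\<dots> = p * (4 / (p - 2) + 64 * D / (6 - p)) * ?X n * ?W A g"
          by (simp add: distrib_right distrib_left mult_ac)
        finally show "?N A g
            \<le> p * (4 / (p - 2) + 64 * D / (6 - p)) * ?X n * ?Z n * ?W A g"
          using 2 by simp
      qed
    next
      case 3
      show ?thesis
      proof (rule reduce[OF D(1)])
        fix n k and A :: "'q padic set" and g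
        assume a: "wave_family k A g" "padic_diam_le A (k - int n)"
        have six: "norm_powr_integral 6 f = (\<integral>x. cmod (f x) ^ 6 \<partial>padic_haar2)" for f :: "'q padic_fun"
          using norm_powr_integral_power[of 6 f] by simp
        have "norm_powr_integral 6 (\<lambda>x. \<Sum>a\<in>A. g a x) \<le> D * ?X n * norm6_sum g A ^ 3"
          unfolding six by (rule decoupling6D[OF DX(1) a]) simp
        also have "norm6_sum g A = square_norm_sum 6 g A"
          unfolding norm6_sum_def square_norm_sum_def six[symmetric]
        proof (intro sum.cong refl)
          fix a
          have "root 3 y = (y powr (1 / 6))\<^sup>2" if "0 \<le> y" for y :: real
          proof (cases "y = 0")
            case False
            then show ?thesis using that by (simp add: root_powr_inverse powr_power)
          qed simp
          then show "root 3 (norm_powr_integral 6 (g a)) = (norm_powr_integral 6 (g a) powr (1 / 6))\<^sup>2" by simp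
        qed
        also have "square_norm_sum 6 g A ^ 3 = square_norm_sum 6 g A powr 3"
          using powr_realpow'[of "square_norm_sum 6 g A" 3] by simp
        finally show "?N A g
            \<le> D * ?X n * ?Z n * ?W A g"
          using 3 by simp
      qed
    next
      case 4
      show ?thesis
      proof (rule reduce[of "p * (64 * D / (p - 6) * 2 powr (p - 6))"])
        show "0 < p * (64 * D / (p - 6) * 2 powr (p - 6))"
          using 4 D(1) by (intro mult_pos_pos divide_pos_pos) auto
        fix n k and A :: "'q padic set" and g
        assume a: "wave_family k A g" "padic_diam_le A (k - int n)" "?pos A g" "A \<noteq> {}"
        have "?N A g
            \<le> p * (64 * (D * ?X n) / (p - 6) * (2 * sqrt (?q ^ n)) powr (p - 6)) * ?W A g"
          using a(3) by (intro decoupling_supercritical[OF DX a(1,2) 4 _ a(4)]) blast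
        also have "(2 * sqrt (?q ^ n)) powr (p - 6) = 2 powr (p - 6) * ?Y n"
        proof -
          have "sqrt (?q ^ n) = ?q powr (real n / 2)"
            using q by (simp add: powr_half_sqrt[symmetric] powr_realpow[symmetric] powr_powr)
          moreover have "real n / 2 * (p - 6) = real n * (p / 2 - 3)" by (simp add: field_simps)
          ultimately have "sqrt (?q ^ n) powr (p - 6) = ?Y n" by (simp only: powr_powr)
          then show ?thesis by (simp add: powr_mult)
        qed
        also have "p * (64 * (D * ?X n) / (p - 6) * (2 powr (p - 6) * ?Y n)) = p * (64 * D / (p - 6) * 2 powr (p - 6)) * ?X n * ?Y n"
          by simp
        finally show "?N A g
            \<le> p * (64 * D / (p - 6) * 2 powr (p - 6)) * ?X n * ?Z n * ?W A g"
          using 4 by simp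
      qed
    qed
  qed
  then obtain C where C: "C > 0" "\<And>n k (A :: 'q padic set) g. wave_family k A g \<Longrightarrow> padic_diam_le A (k - int n) \<Longrightarrow>
      ?pos A g \<Longrightarrow> A \<noteq> {} \<Longrightarrow>
      ?N A g \<le> C * ?B n * ?W A g"
    by blast
  show ?thesis
  proof (intro exI[of _ C] conjI C(1) allI impI)
    fix n k and A :: "'q padic set" and g
    assume A: "wave_family k A g" "padic_diam_le A (k - int n)"
    let ?A0 = "{a \<in> A. 0 < norm_powr_integral p (g a)}"
    have "?N ?A0 g \<le> C * ?B n * ?W ?A0 g"
    proof (cases "?A0 = {}")
      case False
      then show ?thesis
        using wave_family_subset[OF A(1), of ?A0] padic_diam_le_subset[OF A(2), of ?A0] by (intro C) auto
    next
      case True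
      then show ?thesis by (simp only:) (simp add: norm_powr_integral_def square_norm_sum_def)
    qed
    then show "?N A g \<le> C * ?B n * ?W A g"
      using wave_family_drop_null[OF A(1), of p] p by simp
  qed
qed

section \<open>Frequency localization\<close>

lemma padic_theta_interval_iff:
  fixes a :: "'q::prime_card padic"
  shows "(\<xi>, \<eta>) \<in> padic_theta (padic_interval a (real CARD('q) powi (- int k))) \<longleftrightarrow>
    padic_le (\<xi> - a) (- int k) \<and> padic_le (\<eta> - \<xi>\<^sup>2) (- 2 * int k)"
proof -
  have "(real CARD('q) powi (- int k)) ^ 2 = real CARD('q) powi (- 2 * int k)"
    unfolding power2_eq_square CARD_powi_add[symmetric] by simp
  then show ?thesis
    by (simp only: padic_theta_def padic_length_interval mem_Collect_eq case_prod_conv)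
       (simp add: padic_interval_def)
qed

text \<open>The cutoff is an average of modulated translates of \<open>f\<close> in the first
  variable. On the frequency side the average is a character sum in \<open>a - fst \<xi>\<close>,
  which for \<open>fst \<xi>\<close> in the integers is the indicator of \<open>I\<close>. This
  explicit Schwartz function solves the definite description, and injectivity of the transform makes
  it unique.\<close>

lemma padic_freq_restrict_interval:
  fixes f :: "'q::prime_card padic_fun" and k :: nat
  assumes f: "padic_schwartz f" and supp: "\<And>\<xi>. padic_fourier f \<xi> \<noteq> 0 \<Longrightarrow> padic_abs (fst \<xi>) \<le> 1"
    and a: "padic_abs a \<le> 1"
  defines "I \<equiv> padic_interval a (real CARD('q) powi (- int k))"
  shows "padic_schwartz (padic_freq_restrict I f)"
    and "padic_fourier (padic_freq_restrict I f) \<xi> = padic_fourier f \<xi> * indicator (I \<times> UNIV) \<xi>"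
proof -
  let ?q = "of_nat CARD('q) :: 'q padic" and ?M = "CARD('q) ^ k"
  \<comment> \<open>For \<open>j < ?M\<close> these represent the ball of radius
    \<open>q ^ k\<close> modulo the unit ball.\<close>
  define t where "t j = of_nat j * ?q powi (- int k)" for j :: nat
  define c where "c j = inverse (of_nat ?M) * padic_char (a * t j)" for j
  define g where "g x = (\<Sum>j<?M. c j * f (fst x + (- t j), snd x + 0))" for x
  have q: "?q \<noteq> 0" "?M \<noteq> 0" using prime_gt_0_nat[OF prime_card[where 'a='q]] by simp_all
  have terms: "padic_schwartz (\<lambda>x. c j * f (fst x + (- t j), snd x + 0))" for j
    by (intro padic_schwartz_cmult padic_schwartz_translate f)
  have g: "padic_schwartz g" unfolding g_def by (intro padic_schwartz_sum terms)
  have Fg: "padic_fourier g \<xi> = padic_fourier f \<xi> * indicator (I \<times> UNIV) \<xi>" for \<xi>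
  proof (cases "padic_fourier f \<xi> = 0")
    case False
    let ?z = "(a - fst \<xi>) * ?q powi (- int k)"
    have Mz: "of_nat ?M * ?z = a - fst \<xi>" using q by (simp add: power_int_minus)
    have "padic_abs (of_nat ?M * ?z) \<le> 1" unfolding Mz by (intro padic_abs_diff_le a supp False)
    from padic_char_sum[OF this]
    have sum: "(\<Sum>j<?M. padic_char (of_nat j * ?z)) = (if padic_abs ?z \<le> 1 then of_nat ?M else 0)" .
    have "padic_abs ?z \<le> 1 \<longleftrightarrow> padic_le (fst \<xi> - a) (- int k)"
      unfolding padic_abs_mult padic_abs_q_powi padic_abs_minus_commute[of a]
      using CARD_gt_1(2)[where 'q='q] by (simp add: power_int_minus field_simps)
    then have ind: "(if padic_abs ?z \<le> 1 then of_nat ?M else 0) = (of_nat ?M :: complex) * indicator (I \<times> UNIV) \<xi>"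
      by (cases \<xi>) (simp add: I_def padic_interval_def indicator_def)
    have "padic_fourier g \<xi> = (\<Sum>j<?M. c j * (padic_char (- t j * fst \<xi> + 0 * snd \<xi>) * padic_fourier f \<xi>))"
      unfolding g_def padic_fourier_sum[OF terms] padic_fourier_cmult padic_fourier_translate[OF f] ..
    also have "\<dots> = (\<Sum>j<?M. inverse (of_nat ?M) * padic_fourier f \<xi> * padic_char (of_nat j * ?z))"
    proof (intro sum.cong refl)
      fix j
      have "of_nat j * ?z = a * t j + (- t j * fst \<xi> + 0 * snd \<xi>)" unfolding t_def by (simp add: algebra_simps)
      then have "padic_char (of_nat j * ?z) = padic_char (a * t j) * padic_char (- t j * fst \<xi> + 0 * snd \<xi>)"
        by (simp only: padic_char_add)
      then show "c j * (padic_char (- t j * fst \<xi> + 0 * snd \<xi>) * padic_fourier f \<xi>)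
          = inverse (of_nat ?M) * padic_fourier f \<xi> * padic_char (of_nat j * ?z)"
        by (simp only: c_def mult_ac)
    qed
    also have "\<dots> = inverse (of_nat ?M) * padic_fourier f \<xi> * (of_nat ?M * indicator (I \<times> UNIV) \<xi>)"
      unfolding sum_distrib_left[symmetric] sum ind ..
    also have "\<dots> = padic_fourier f \<xi> * indicator (I \<times> UNIV) \<xi>" using q(2) by simp
    finally show ?thesis .
  next
    case True
    then show ?thesis
      unfolding g_def padic_fourier_sum[OF terms] padic_fourier_cmult padic_fourier_translate[OF f] by simp
  qed
  have "padic_freq_restrict I f = g"
    unfolding padic_freq_restrict_def
  proof (rule the_equality)
    show "padic_schwartz g \<and> padic_fourier g = (\<lambda>\<xi>. padic_fourier f \<xi> * indicator (I \<times> UNIV) \<xi>)"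
      using g Fg by auto
    fix h assume "padic_schwartz h \<and> padic_fourier h = (\<lambda>\<xi>. padic_fourier f \<xi> * indicator (I \<times> UNIV) \<xi>)"
    then show "h = g" using g Fg by (intro padic_fourier_inject) auto
  qed
  then show "padic_schwartz (padic_freq_restrict I f)"
    "padic_fourier (padic_freq_restrict I f) \<xi> = padic_fourier f \<xi> * indicator (I \<times> UNIV) \<xi>"
    using g Fg by simp_all
qed

lemma padic_of_nat_separated:
  "padic_le (of_nat M - of_nat N :: 'q::prime_card padic) (- int k) \<Longrightarrow>
    M < CARD('q) ^ k \<Longrightarrow> N < CARD('q) ^ k \<Longrightarrow> M = N"
proof -
  assume a: "padic_le (of_nat M - of_nat N :: 'q padic) (- int k)"
    and MN: "M < CARD('q) ^ k" "N < CARD('q) ^ k"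
  have "padic_le (of_int (int M - int N) :: 'q padic) (- int k)"
    using a by (simp only: of_int_diff of_int_of_nat_eq)
  then have "int CARD('q) ^ k dvd int M - int N"
    by (simp only: padic_abs_of_int qadic_abs_of_int_le[OF prime_card])
  then have "int M mod int (CARD('q) ^ k) = int N mod int (CARD('q) ^ k)"
    by (simp only: mod_eq_dvd_iff of_nat_power)
  moreover have "int M < int (CARD('q) ^ k)" "int N < int (CARD('q) ^ k)"
    using MN by (simp_all only: of_nat_less_iff)
  ultimately show "M = N" by (simp only: mod_pos_pos_trivial of_nat_0_le_iff of_nat_eq_iff)
qed

text \<open>The integers \<open>0, ..., q ^ k - 1\<close> serve as centres of the intervals of the
  partition. The scale and the number of scales are both \<open>k\<close>, whence the exponent
  \<open>int k - int k\<close>.\<close>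

lemma padic_decoupling_decomposition:
  fixes f :: "'q::prime_card padic_fun" and k :: nat
  assumes f: "padic_schwartz f"
    and supp: "{\<xi>. padic_fourier f \<xi> \<noteq> 0} \<subseteq> (\<Union>K\<in>padic_partition (real CARD('q) powi (- int k)). padic_theta K)"
  defines "A \<equiv> (of_nat :: nat \<Rightarrow> 'q padic) ` {..<CARD('q) ^ k}"
    and "g \<equiv> \<lambda>a. padic_freq_restrict (padic_interval a (real CARD('q) powi (- int k))) f"
  shows "wave_family (int k) A g" "padic_diam_le A (int k - int k)" "f = (\<lambda>x. \<Sum>a\<in>A. g a x)"
    and "(\<Sum>K\<in>padic_partition (real CARD('q) powi (- int k)). h (padic_freq_restrict K f)) = (\<Sum>a\<in>A. h (g a))"
proof -
  let ?r = "real CARD('q) powi (- int k)"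
  let ?I = "\<lambda>a :: 'q padic. padic_interval a ?r"
  have partition: "padic_partition ?r = ?I ` A"
    unfolding padic_partition_eq A_def image_image ..
  have fin: "finite A" by (simp add: A_def)
  have a1: "padic_abs a \<le> 1" if "a \<in> A" for a using that by (auto simp: A_def)
  have sep: "a = b" if "a \<in> A" "b \<in> A" "padic_abs (a - b) \<le> ?r" for a b
    using that padic_of_nat_separated[where 'q='q and k=k] unfolding A_def by blast
  have supp': "\<exists>a\<in>A. padic_abs (\<xi> - a) \<le> ?r \<and> padic_le (\<eta> - \<xi>\<^sup>2) (- 2 * int k)"
    if "padic_fourier f (\<xi>, \<eta>) \<noteq> 0" for \<xi> \<eta>
  proof -
    have "(\<xi>, \<eta>) \<in> (\<Union>K\<in>padic_partition ?r. padic_theta K)" using supp that by blast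
    then obtain a where "a \<in> A" "(\<xi>, \<eta>) \<in> padic_theta (?I a)" unfolding partition by blast
    then show ?thesis unfolding padic_theta_interval_iff by blast
  qed
  have r1: "?r \<le> 1" using CARD_gt_1(1)[where 'q='q] by (simp add: powi_le_1_iff)
  have supp1: "padic_abs (fst \<xi>) \<le> 1" if nz: "padic_fourier f \<xi> \<noteq> 0" for \<xi>
  proof -
    obtain \<xi>1 \<xi>2 where \<xi>: "\<xi> = (\<xi>1, \<xi>2)" by (cases \<xi>)
    obtain a where a: "a \<in> A" "padic_abs (\<xi>1 - a) \<le> ?r" using supp'[of \<xi>1 \<xi>2] nz \<xi> by blast
    have "padic_abs (\<xi>1 - a + a) \<le> 1"
      by (rule padic_abs_add_le[OF order_trans[OF a(2) r1] a1[OF a(1)]])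
    then show ?thesis by (simp add: \<xi>)
  qed
  have g: "padic_schwartz (g a)" "padic_fourier (g a) \<xi> = padic_fourier f \<xi> * indicator (?I a \<times> UNIV) \<xi>"
    if "a \<in> A" for a \<xi>
    unfolding g_def using padic_freq_restrict_interval[OF f supp1 a1[OF that]] by simp_all
  show "wave_family (int k) A g"
    unfolding wave_family_def
  proof (intro conjI ballI impI)
    fix a assume a: "a \<in> A"
    show "bounded_finsupp padic_haar2 (g a)" by (intro padic_schwartz_bounded_finsupp g a)
    show "padic_wave a (int k) (g a)"
    proof (rule padic_wave_fourier[OF g(1)[OF a]])
      fix \<xi> \<eta> assume "padic_fourier (g a) (\<xi>, \<eta>) \<noteq> 0"
      then have nz: "padic_fourier f (\<xi>, \<eta>) \<noteq> 0" "padic_abs (\<xi> - a) \<le> ?r"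
        unfolding g(2)[OF a] by (auto simp: indicator_def padic_interval_def split: if_splits)
      then show "padic_le (\<xi> - a) (- int k) \<and> padic_le (\<eta> - \<xi>\<^sup>2) (- 2 * int k)"
        using supp' by blast
    qed
    show "a = b" if "b \<in> A" "padic_abs (a - b) \<le> ?r" for b by (rule sep[OF a that])
  qed (rule fin)
  show "padic_diam_le A (int k - int k)"
    unfolding padic_diam_le_def using padic_abs_diff_le[OF a1 a1] by simp
  show "f = (\<lambda>x. \<Sum>a\<in>A. g a x)"
  proof (rule padic_fourier_inject[OF f])
    show "padic_schwartz (\<lambda>x. \<Sum>a\<in>A. g a x)" by (intro padic_schwartz_sum g)
    fix \<xi> :: "'q padic \<times> 'q padic"
    obtain \<xi>1 \<xi>2 where \<xi>: "\<xi> = (\<xi>1, \<xi>2)" by (cases \<xi>)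
    have "padic_fourier (\<lambda>x. \<Sum>a\<in>A. g a x) \<xi> = (\<Sum>a\<in>A. padic_fourier f \<xi> * indicator (?I a \<times> UNIV) \<xi>)"
      using g by (simp add: padic_fourier_sum)
    also have "\<dots> = padic_fourier f \<xi>"
    proof (cases "padic_fourier f \<xi> = 0")
      case False
      then obtain a where a: "a \<in> A" "padic_abs (\<xi>1 - a) \<le> ?r" using supp'[of \<xi>1 \<xi>2] \<xi> by blast
      have "indicator (?I b \<times> UNIV) \<xi> = (if b = a then 1 else 0 :: complex)" if b: "b \<in> A" for b
      proof (cases "padic_abs (\<xi>1 - b) \<le> ?r")
        case True
        have "padic_abs (b - a) \<le> ?r"
          by (rule padic_diff_le[OF _ a(2)]) (use True in \<open>simp add: padic_abs_minus_commute\<close>)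
        then have "b = a" by (rule sep[OF b a(1)])
        then show ?thesis using True by (simp add: \<xi> padic_interval_def)
      next
        case F: False
        then have "b \<noteq> a" using a(2) by blast
        then show ?thesis using F by (simp add: \<xi> padic_interval_def)
      qed
      then have "(\<Sum>b\<in>A. padic_fourier f \<xi> * indicator (?I b \<times> UNIV) \<xi>) = (\<Sum>b\<in>A. if b = a then padic_fourier f \<xi> else 0)"
        by (intro sum.cong refl) simp
      then show ?thesis using fin a(1) by simp
    qed simp
    finally show "padic_fourier f \<xi> = padic_fourier (\<lambda>x. \<Sum>a\<in>A. g a x) \<xi>" by (rule sym)
  qed
  have "inj_on ?I A"
  proof (rule inj_onI)
    fix a b assume ab: "a \<in> A" "b \<in> A" "?I a = ?I b"
    have "a \<in> ?I a" by (simp add: padic_interval_def)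
    then have "padic_abs (a - b) \<le> ?r" unfolding ab(3) by (simp only: padic_interval_def mem_Collect_eq)
    then show "a = b" by (rule sep[OF ab(1,2)])
  qed
  then show "(\<Sum>K\<in>padic_partition ?r. h (padic_freq_restrict K f)) = (\<Sum>a\<in>A. h (g a))"
    unfolding partition g_def by (simp add: sum.reindex)
qed

section \<open>From wave packets to the decoupling constant\<close>

lemma padic_Lp_norm_ereal: "padic_Lp_norm (ereal p) f = norm_powr_integral p f powr (1 / p)"
  by (simp add: padic_Lp_norm_def norm_powr_integral_def)

lemma padic_Lp_norm_infinity_le:
  assumes f: "bounded_finsupp padic_haar2 f" and le: "AE x in padic_haar2. cmod (f x) \<le> c" and "0 \<le> c"
  shows "padic_Lp_norm \<infinity> f \<le> c"
proof -
  have "(\<lambda>x. ereal (cmod (f x))) \<in> borel_measurable padic_haar2" using bounded_finsupp_measurable[OF f] by measurable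
  then have "esssup padic_haar2 (\<lambda>x. ereal (cmod (f x))) \<le> ereal c" using le by (intro esssup_I) auto
  then show ?thesis using \<open>0 \<le> c\<close> unfolding padic_Lp_norm_def
    by (cases "esssup padic_haar2 (\<lambda>x. ereal (cmod (f x)))") auto
qed

text \<open>Boundedness keeps the essential supremum away from \<infinity>, which
  \<open>real_of_ereal\<close> would send to 0.\<close>

lemma AE_le_padic_Lp_norm_infinity:
  assumes f: "bounded_finsupp padic_haar2 f"
  shows "AE x in padic_haar2. cmod (f x) \<le> padic_Lp_norm \<infinity> f"
proof -
  let ?e = "esssup padic_haar2 (\<lambda>x. ereal (cmod (f x)))"
  have m: "(\<lambda>x. ereal (cmod (f x))) \<in> borel_measurable padic_haar2" using bounded_finsupp_measurable[OF f] by measurable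
  obtain B where B: "\<And>x. cmod (f x) \<le> B" using f by (auto simp: bounded_finsupp_def)
  have "?e \<le> ereal B" using m B by (intro esssup_I) auto
  then have fin: "?e \<noteq> \<infinity>" by auto
  have "AE x in padic_haar2. ereal (cmod (f x)) \<le> ?e" by (rule esssup_AE)
  then show ?thesis
  proof eventually_elim
    case (elim x)
    then show ?case using fin unfolding padic_Lp_norm_def by (cases ?e) auto
  qed
qed

lemma padic_decoupling_constant_le:
  assumes "0 \<le> B" and "\<And>f :: 'q padic_fun. padic_schwartz f \<Longrightarrow>
    {\<xi>. padic_fourier f \<xi> \<noteq> 0} \<subseteq> (\<Union>K\<in>padic_partition \<delta>. padic_theta K) \<Longrightarrow>
    padic_Lp_norm p f \<le> B * sqrt (\<Sum>K\<in>padic_partition \<delta>. (padic_Lp_norm p (padic_freq_restrict K f))\<^sup>2)"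
  shows "padic_decoupling_constant TYPE('q::prime_card) p \<delta> \<le> ennreal B"
  unfolding padic_decoupling_constant_def
proof (rule Inf_lower, rule CollectI, intro allI impI)
  fix f :: "'q padic_fun"
  let ?S = "sqrt (\<Sum>K\<in>padic_partition \<delta>. (padic_Lp_norm p (padic_freq_restrict K f))\<^sup>2)"
  assume f: "padic_schwartz f" "{\<xi>. padic_fourier f \<xi> \<noteq> 0} \<subseteq> (\<Union>K\<in>padic_partition \<delta>. padic_theta K)"
  have "0 \<le> ?S" by (intro real_sqrt_ge_zero sum_nonneg) simp
  then show "ennreal (padic_Lp_norm p f) \<le> ennreal B * ennreal ?S"
    using ennreal_leI[OF assms(2)[OF f]] assms(1) by (simp add: ennreal_mult)
qed

text \<open>Subadditivity of the power \<open>1 / r\<close>; it keeps the two summands of the bound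
  apart when the root is taken.\<close>

lemma one_add_powr_le:
  fixes y r :: real
  assumes "0 \<le> y" "1 \<le> r"
  shows "(1 + y) powr (1 / r) \<le> 1 + y powr (1 / r)"
proof -
  let ?a = "y powr (1 / r)"
  have a: "?a powr r = y" using assms by (simp add: powr_powr)
  have "1 + y = 1 + ?a * ?a powr (r - 1)"
  proof (cases "y = 0")
    case False
    then have "?a * ?a powr (r - 1) = ?a powr 1 * ?a powr (r - 1)" by simp
    also have "\<dots> = ?a powr r" by (simp only: powr_add[symmetric]) simp
    finally show ?thesis using a by simp
  qed simp
  also have "\<dots> \<le> (1 + ?a) powr (r - 1) + ?a * (1 + ?a) powr (r - 1)"
    using assms by (intro add_mono mult_left_mono powr_mono2 ge_one_powr_ge_zero) auto
  also have "\<dots> = (1 + ?a) powr 1 * (1 + ?a) powr (r - 1)" by (simp add: distrib_right)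
  also have "\<dots> = (1 + ?a) powr r" by (simp only: powr_add[symmetric]) simp
  finally have "(1 + y) powr (1 / r) \<le> ((1 + ?a) powr r) powr (1 / r)"
    using assms by (intro powr_mono2) auto
  also have "\<dots> = 1 + ?a" using assms by (simp add: powr_powr)
  finally show ?thesis .
qed

text \<open>The Cauchy-Schwarz inequality over the \<open>q ^ k\<close> intervals already gives the
  power \<open>\<delta> powr (- 1 / 2)\<close>. The exceptional null sets are finitely many, one for
  each interval.\<close>

lemma padic_decoupling_constant_infinity:
  "padic_decoupling_constant TYPE('q::prime_card) \<infinity> (real CARD('q) powi (- int k)) \<le> ennreal (sqrt (real CARD('q) ^ k))"
proof (rule padic_decoupling_constant_le)
  fix f :: "'q padic_fun"
  assume f: "padic_schwartz f"
    "{\<xi>. padic_fourier f \<xi> \<noteq> 0} \<subseteq> (\<Union>K\<in>padic_partition (real CARD('q) powi (- int k)). padic_theta K)"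
  define A where "A = (of_nat :: nat \<Rightarrow> 'q padic) ` {..<CARD('q) ^ k}"
  define g where "g = (\<lambda>a. padic_freq_restrict (padic_interval a (real CARD('q) powi (- int k))) f)"
  note dec = padic_decoupling_decomposition[OF f, folded A_def, folded g_def]
  let ?e = "\<lambda>a. padic_Lp_norm \<infinity> (g a)"
  let ?B = "sqrt (real CARD('q) ^ k) * sqrt (\<Sum>a\<in>A. (?e a)\<^sup>2)"
  have fin: "finite A" by (simp add: A_def)
  have "(\<Sum>a\<in>A. ?e a)\<^sup>2 \<le> real (card A) * (\<Sum>a\<in>A. (?e a)\<^sup>2)"
    using sum_squared_le_sum_of_squares[of ?e A] by (simp add: mult.commute)
  also have "\<dots> \<le> real CARD('q) ^ k * (\<Sum>a\<in>A. (?e a)\<^sup>2)"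
    using card_wave_family[OF dec(1,2)] by (intro mult_right_mono sum_nonneg) (simp_all flip: of_nat_power)
  finally have "\<bar>\<Sum>a\<in>A. ?e a\<bar> \<le> ?B"
    unfolding real_sqrt_mult[symmetric] using real_sqrt_le_mono by fastforce
  then have sum_le: "(\<Sum>a\<in>A. ?e a) \<le> ?B" by linarith
  have "\<forall>a\<in>A. AE x in padic_haar2. cmod (g a x) \<le> ?e a"
    using dec(1) by (intro ballI AE_le_padic_Lp_norm_infinity) (simp add: wave_family_def)
  then have "AE x in padic_haar2. \<forall>a\<in>A. cmod (g a x) \<le> ?e a" using fin by (intro AE_finite_allI) auto
  then have "AE x in padic_haar2. cmod (f x) \<le> ?B"
  proof eventually_elim
    case (elim x)
    have "cmod (f x) = cmod (\<Sum>a\<in>A. g a x)" by (subst dec(3)) (simp only: g_def)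
    also have "\<dots> \<le> (\<Sum>a\<in>A. ?e a)" using elim by (intro sum_norm_le) simp
    finally show ?case using sum_le by linarith
  qed
  moreover have "0 \<le> ?B" by (intro mult_nonneg_nonneg real_sqrt_ge_zero sum_nonneg) simp_all
  ultimately have "padic_Lp_norm \<infinity> f \<le> ?B"
    by (rule padic_Lp_norm_infinity_le[OF padic_schwartz_bounded_finsupp[OF f(1)]])
  then show "padic_Lp_norm \<infinity> f \<le> sqrt (real CARD('q) ^ k) *
      sqrt (\<Sum>K\<in>padic_partition (real CARD('q) powi (- int k)). (padic_Lp_norm \<infinity> (padic_freq_restrict K f))\<^sup>2)"
    by (simp only: dec(4)[of "\<lambda>h. (padic_Lp_norm \<infinity> h)\<^sup>2"] g_def)
qed simp

lemma padic_decoupling_constant_finite: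
  assumes odd: "odd CARD('q::prime_card)" and r: "2 \<le> r" and \<epsilon>: "0 < \<epsilon>"
  shows "\<exists>C\<ge>0. \<forall>k. padic_decoupling_constant TYPE('q) (ereal r) (real CARD('q) powi (- int k))
    \<le> ennreal (C * real CARD('q) powr (\<epsilon> * real k) * (1 + real CARD('q) powr (real k * (1 / 2 - 3 / r))))"
proof -
  let ?q = "real CARD('q)"
  let ?X = "\<lambda>n. ?q powr (\<epsilon> * real n)" and ?Y = "\<lambda>n. ?q powr (real n * (r / 2 - 3))"
  have q: "1 < ?q" by (rule CARD_gt_1)
  obtain C where C: "C > 0" "\<And>n k (A :: 'q padic set) g. wave_family k A g \<Longrightarrow> padic_diam_le A (k - int n) \<Longrightarrow>
      norm_powr_integral r (\<lambda>x. \<Sum>a\<in>A. g a x) \<le> C * (?X n * (1 + ?Y n)) * square_norm_sum r g A powr (r / 2)"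
    using wave_family_decoupling[OF odd r \<epsilon>] by blast
  show ?thesis
  proof (intro exI[of _ "C powr (1 / r)"] conjI allI)
    fix k
    let ?B = "C powr (1 / r) * ?X k * (1 + ?q powr (real k * (1 / 2 - 3 / r)))"
    show "padic_decoupling_constant TYPE('q) (ereal r) (?q powi (- int k)) \<le> ennreal ?B"
    proof (rule padic_decoupling_constant_le)
      fix f :: "'q padic_fun"
      assume f: "padic_schwartz f"
        "{\<xi>. padic_fourier f \<xi> \<noteq> 0} \<subseteq> (\<Union>K\<in>padic_partition (?q powi (- int k)). padic_theta K)"
      define A where "A = (of_nat :: nat \<Rightarrow> 'q padic) ` {..<CARD('q) ^ k}"
      define g where "g = (\<lambda>a. padic_freq_restrict (padic_interval a (?q powi (- int k))) f)"
      note dec = padic_decoupling_decomposition[OF f, folded A_def, folded g_def]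
      let ?W = "square_norm_sum r g A"
      have "norm_powr_integral r f = norm_powr_integral r (\<lambda>x. \<Sum>a\<in>A. g a x)" by (subst dec(3)) (simp only: g_def)
      also have "\<dots> \<le> C * (?X k * (1 + ?Y k)) * ?W powr (r / 2)" by (rule C(2)[OF dec(1,2)])
      finally have "padic_Lp_norm (ereal r) f \<le> (C * (?X k * (1 + ?Y k)) * ?W powr (r / 2)) powr (1 / r)"
        unfolding padic_Lp_norm_ereal using r by (intro powr_mono2) auto
      also have "\<dots> = C powr (1 / r) * (?X k powr (1 / r) * (1 + ?Y k) powr (1 / r)) * (?W powr (r / 2)) powr (1 / r)"
        using C(1) by (simp add: powr_mult add_nonneg_nonneg)
      also have "(?W powr (r / 2)) powr (1 / r) = sqrt ?W"
        using r by (simp add: powr_powr powr_half_sqrt)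
      also have "C powr (1 / r) * (?X k powr (1 / r) * (1 + ?Y k) powr (1 / r)) * sqrt ?W
          \<le> C powr (1 / r) * (?X k * (1 + ?q powr (real k * (1 / 2 - 3 / r)))) * sqrt ?W"
      proof (intro mult_right_mono mult_left_mono mult_mono)
        \<comment> \<open>The loss is at least 1, so taking its root only decreases it.\<close>
        have "?X k powr (1 / r) \<le> ?X k powr 1"
          using q \<epsilon> r by (intro powr_mono ge_one_powr_ge_zero) auto
        then show "?X k powr (1 / r) \<le> ?X k" by simp
        have "real k * (r / 2 - 3) * (1 / r) = real k * (1 / 2 - 3 / r)" using r by (simp add: field_simps)
        then have "?Y k powr (1 / r) = ?q powr (real k * (1 / 2 - 3 / r))" by (simp only: powr_powr)
        then show "(1 + ?Y k) powr (1 / r) \<le> 1 + ?q powr (real k * (1 / 2 - 3 / r))"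
          using one_add_powr_le[of "?Y k" r] r by simp
      qed auto
      also have "?W = (\<Sum>a\<in>A. (padic_Lp_norm (ereal r) (g a))\<^sup>2)"
        unfolding square_norm_sum_def padic_Lp_norm_ereal ..
      finally show "padic_Lp_norm (ereal r) f \<le> ?B *
          sqrt (\<Sum>K\<in>padic_partition (?q powi (- int k)). (padic_Lp_norm (ereal r) (padic_freq_restrict K f))\<^sup>2)"
        by (simp only: dec(4)[of "\<lambda>h. (padic_Lp_norm (ereal r) h)\<^sup>2"] g_def mult.assoc)
    qed (auto intro!: mult_nonneg_nonneg add_nonneg_nonneg)
  qed simp
qed

theorem theorem1p1:
  fixes p :: ereal and \<epsilon> :: real
  assumes "odd CARD('q::prime_card)" and "2 \<le> p" and "0 < \<epsilon>"
  shows "\<exists>C :: real. \<forall>\<delta> \<in> {real CARD('q) powi (- int k) | k :: nat. True}.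
    padic_decoupling_constant TYPE('q) p \<delta>
      \<le> ennreal (C * \<delta> powr (- \<epsilon>) * (1 + \<delta> powr (- (1 / 2 - real_of_ereal (3 / p)))))"
proof -
  let ?q = "real CARD('q)"
  have q: "1 < ?q" by (rule CARD_gt_1)
  have \<delta>: "(?q powi (- int k)) powr (- e) = ?q powr (real k * e)" for k e
  proof -
    have "?q powi (- int k) = ?q powr (- real k)"
      using q by (simp add: power_int_minus powr_minus powr_realpow)
    then show ?thesis by (simp add: powr_powr)
  qed
  show ?thesis
  proof (cases p)
    case (real r)
    then have r: "2 \<le> r" using assms(2) by simp
    have 3: "real_of_ereal (3 / p) = 3 / r" using real r by simp
    obtain C where "C \<ge> 0" and C: "\<And>k. padic_decoupling_constant TYPE('q) (ereal r) (?q powi (- int k))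
      \<le> ennreal (C * ?q powr (\<epsilon> * real k) * (1 + ?q powr (real k * (1 / 2 - 3 / r))))"
      using padic_decoupling_constant_finite[OF assms(1) r assms(3)] by blast
    show ?thesis
    proof (intro exI[of _ C] ballI)
      fix \<delta> assume "\<delta> \<in> {?q powi (- int k) | k :: nat. True}"
      then obtain k :: nat where k: "\<delta> = ?q powi (- int k)" by blast
      show "padic_decoupling_constant TYPE('q) p \<delta>
        \<le> ennreal (C * \<delta> powr (- \<epsilon>) * (1 + \<delta> powr (- (1 / 2 - real_of_ereal (3 / p)))))"
        unfolding k \<delta> 3 using C[of k] real by (simp only: mult.commute[of \<epsilon>])
    qed
  next
    case PInf
    show ?thesis
    proof (intro exI[of _ 1] ballI)
      fix \<delta> assume "\<delta> \<in> {?q powi (- int k) | k :: nat. True}"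
      then obtain k :: nat where k: "\<delta> = ?q powi (- int k)" by blast
      \<comment> \<open>Here \<open>3 / p\<close> is 0, so the second summand alone is the bound
        from the Cauchy-Schwarz inequality; the factor carrying \<epsilon> is at least 1.\<close>
      have "sqrt (?q ^ k) = ?q powr (real k * (1 / 2))"
        using q by (simp add: powr_half_sqrt[symmetric] powr_realpow[symmetric] powr_powr)
      also have "\<dots> \<le> ?q powr (real k * \<epsilon>) * (1 + ?q powr (real k * (1 / 2)))"
      proof -
        have "1 \<le> ?q powr (real k * \<epsilon>)" using q assms(3) by (intro ge_one_powr_ge_zero) auto
        then have "1 * (1 + ?q powr (real k * (1 / 2))) \<le> ?q powr (real k * \<epsilon>) * (1 + ?q powr (real k * (1 / 2)))"
          by (intro mult_right_mono) auto
        then show ?thesis by simp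
      qed
      finally have "ennreal (sqrt (?q ^ k)) \<le> ennreal (1 * ?q powr (real k * \<epsilon>) * (1 + ?q powr (real k * (1 / 2 - 0))))"
        by (simp add: ennreal_leI)
      moreover have "real_of_ereal (3 / p) = 0" using PInf by simp
      ultimately show "padic_decoupling_constant TYPE('q) p \<delta>
        \<le> ennreal (1 * \<delta> powr (- \<epsilon>) * (1 + \<delta> powr (- (1 / 2 - real_of_ereal (3 / p)))))"
        unfolding k \<delta> using order_trans[OF padic_decoupling_constant_infinity[of k, where 'q='q]] PInf by (simp only:)
    qed
  next
    case MInf
    then show ?thesis using assms(2) by simp
  qed
qed

end
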